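(* There exists a constant $\alpha\in(0,1)$ such that for any $\eta\in(0,1)$, all integers $d\ge1$ and $s\ge1$, all $\sigma>0$, any $\boldsymbol\Sigma$ satisfying Assumptions $(\varepsilon^*0)$ and $(\varepsilon^*1)$ with $s\le\min\{\alpha d,\|\boldsymbol\Sigma\|_F\}$, and any $\boldsymbol\theta\in B_0(s,d)$, \[ \mathbf P_{\boldsymbol\theta,\boldsymbol\Sigma}\left((\hat N^*_\eta-\|\boldsymbol\theta\|_2)^2\le c_\eta\sigma^2\psi^*(s,\boldsymbol\Sigma)\right)\ge1-\eta, \] where $c_\eta>0$ is a constant depending only on $\eta$.
   Context: Model: one observes $\boldsymbol Y=\boldsymbol\theta+\sigma\boldsymbol\varepsilon\in\mathbb R^d$, $\boldsymbol\varepsilon\sim\mathcal N(\boldsymbol0,\boldsymbol\Sigma)$, $\boldsymbol\Sigma$ a covariance matrix with known diagonal entries $\sigma_i^2$ and known $\|\boldsymbol\Sigma\|_F$; $\sigma>0$ unknown. $B_0(s,d)=\{\boldsymbol\theta:\|\boldsymbol\theta\|_0\le s\}$. Assumption $(\varepsilon^*0)$: $\max_i\sigma_i^2\le1$; Assumption $(\varepsilon^*1)$: $\min_i\sigma_i^2\ge c_*$ for a constant $c_*>0$. $\tilde Y_i=Y_i/\sigma_i$; $\hat F_{Y^2}$ the empirical c.d.f. of $\tilde Y_1^2,\dots,\tilde Y_d^2$; $F$ the c.d.f. of $\chi^2_1$; $\hat\sigma_S^2(t)=t/F^{-1}(\hat F_{Y^2}(t))$ if $\hat F_{Y^2}(t)>0$,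 $+\infty$ otherwise; $\hat t=\min\{2^\ell:\ell\in\mathbb Z,\hat F_{Y^2}(2^\ell)\ge0.5\}$; $\hat\sigma_S^2=\hat\sigma_S^2(\hat t)$. For $a\in(0,1)$ let $q_a$ be the $a$-quantile of $\chi^2_1$. $\hat M=\min\{t:\hat F_{Y^2}(t)\ge0.5\}$, $\hat\sigma_\eta^2=\hat M/q_{1-\eta/20}$. $\tau_\eta=3\sqrt{\frac{q_{1-\eta/20}}{q_{\eta/20}}\log(1+\|\boldsymbol\Sigma\|_F^2/s^2)}$, $\alpha_{s,\eta}=\mathbf E[Z^2\mathbb 1\{|Z|\ge\tau_\eta\}]$ with $Z\sim\mathcal N(0,1)$, \[ \hat Q^*_\eta=\sum_{i=1}^dY_i^2\mathbb 1\{|Y_i|>\max\{\hat\sigma_S,\hat\sigma_\eta\}\sigma_i\tau_\eta\}-\hat\sigma_S^2\alpha_{s,\eta}\sum_{i=1}^d\sigma_i^2,\qquad\hat N^*_\eta=\sqrt{|\hat Q^*_\eta|}. \] $\psi^*(s,\boldsymbol\Sigma)=s\log(1+\|\boldsymbol\Sigma\|_F^2/s^2)$ if $s\le\|\boldsymbol\Sigma\|_F$, and $\frac{s}{1\vee\log(s/\|\boldsymbol\Sigma\|_F)}$ otherwise. *)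

theory Defs
  imports "HOL-Probability.Probability"
begin

definition std_normal_measure :: "real measure" where
  "std_normal_measure = density lborel std_normal_density"

definition std_gauss_vec :: "nat \<Rightarrow> (nat \<Rightarrow> real) measure" where
  "std_gauss_vec d = PiM {..<d} (\<lambda>_. std_normal_measure)"

(* covariance matrix Sigma = A A^T, so that A Z ~ N(0, Sigma) *)
definition cov :: "nat \<Rightarrow> (nat \<Rightarrow> nat \<Rightarrow> real) \<Rightarrow> nat \<Rightarrow> nat \<Rightarrow> real" where
  "cov d A i j = (\<Sum>k<d. A i k * A j k)"

definition frob :: "nat \<Rightarrow> (nat \<Rightarrow> nat \<Rightarrow> real) \<Rightarrow> real" where
  "frob d S = sqrt (\<Sum>i<d. \<Sum>j<d. (S i j)^2)"

definition chi1_cdf :: "real \<Rightarrow> real" where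
  "chi1_cdf t = measure std_normal_measure {z. z^2 \<le> t}"

(* a-quantile q_a of chi^2_1 (generalized inverse; used for a in (0,1)) *)
definition chi1_quantile :: "real \<Rightarrow> real" where
  "chi1_quantile a = Inf {t. a \<le> chi1_cdf t}"

(* F^{-1}(p) for p in (0,1], with F^{-1}(1) = +infinity *)
definition chi1_inv :: "real \<Rightarrow> ereal" where
  "chi1_inv p = (if 1 \<le> p then PInfty else ereal (chi1_quantile p))"

(* empirical c.d.f. of Ytilde_i^2, Ytilde_i = Y_i / sigma_i, sig2 i = sigma_i^2 *)
definition Fhat :: "nat \<Rightarrow> (nat \<Rightarrow> real) \<Rightarrow> (nat \<Rightarrow> real) \<Rightarrow> real \<Rightarrow> real" where
  "Fhat d sig2 Y t = real (card {i\<in>{..<d}. (Y i / sqrt (sig2 i))^2 \<le> t}) / real d"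

definition sigmaS2_fun :: "nat \<Rightarrow> (nat \<Rightarrow> real) \<Rightarrow> (nat \<Rightarrow> real) \<Rightarrow> real \<Rightarrow> ereal" where
  "sigmaS2_fun d sig2 Y t =
     (if Fhat d sig2 Y t > 0 then ereal t / chi1_inv (Fhat d sig2 Y t) else PInfty)"

definition t_hat :: "nat \<Rightarrow> (nat \<Rightarrow> real) \<Rightarrow> (nat \<Rightarrow> real) \<Rightarrow> real" where
  "t_hat d sig2 Y = Inf {2 powr (real_of_int l) | l. Fhat d sig2 Y (2 powr (real_of_int l)) \<ge> 1/2}"

(* hat sigma_S^2 = hat sigma_S^2(hat t); finite since Fhat(hat t) >= 1/2 > 0 *)
definition sigmaS2_hat :: "nat \<Rightarrow> (nat \<Rightarrow> real) \<Rightarrow> (nat \<Rightarrow> real) \<Rightarrow> real" where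
  "sigmaS2_hat d sig2 Y = real_of_ereal (sigmaS2_fun d sig2 Y (t_hat d sig2 Y))"

definition M_hat :: "nat \<Rightarrow> (nat \<Rightarrow> real) \<Rightarrow> (nat \<Rightarrow> real) \<Rightarrow> real" where
  "M_hat d sig2 Y = Inf {t. Fhat d sig2 Y t \<ge> 1/2}"

definition sigma_eta2_hat :: "real \<Rightarrow> nat \<Rightarrow> (nat \<Rightarrow> real) \<Rightarrow> (nat \<Rightarrow> real) \<Rightarrow> real" where
  "sigma_eta2_hat \<eta> d sig2 Y = M_hat d sig2 Y / chi1_quantile (1 - \<eta>/20)"

definition tau :: "real \<Rightarrow> nat \<Rightarrow> real \<Rightarrow> real" where
  "tau \<eta> s F = 3 * sqrt (chi1_quantile (1 - \<eta>/20) / chi1_quantile (\<eta>/20)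
                         * ln (1 + F^2 / (real s)^2))"

definition alpha_se :: "real \<Rightarrow> nat \<Rightarrow> real \<Rightarrow> real" where
  "alpha_se \<eta> s F =
     integral\<^sup>L std_normal_measure (\<lambda>z. z^2 * indicator {z. \<bar>z\<bar> \<ge> tau \<eta> s F} z)"

(* sig2 i = sigma_i^2, F = ||Sigma||_F *)
definition Q_hat :: "real \<Rightarrow> nat \<Rightarrow> nat \<Rightarrow> (nat \<Rightarrow> real) \<Rightarrow> real \<Rightarrow> (nat \<Rightarrow> real) \<Rightarrow> real" where
  "Q_hat \<eta> d s sig2 F Y =
     (\<Sum>i<d. (Y i)^2 * (if \<bar>Y i\<bar> > max (sqrt (sigmaS2_hat d sig2 Y)) (sqrt (sigma_eta2_hat \<eta> d sig2 Y))
                                     * sqrt (sig2 i) * tau \<eta> s F then 1 else 0))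
     - sigmaS2_hat d sig2 Y * alpha_se \<eta> s F * (\<Sum>i<d. sig2 i)"

definition N_hat :: "real \<Rightarrow> nat \<Rightarrow> nat \<Rightarrow> (nat \<Rightarrow> real) \<Rightarrow> real \<Rightarrow> (nat \<Rightarrow> real) \<Rightarrow> real" where
  "N_hat \<eta> d s sig2 F Y = sqrt \<bar>Q_hat \<eta> d s sig2 F Y\<bar>"

definition psi_star :: "nat \<Rightarrow> real \<Rightarrow> real" where
  "psi_star s F = (if real s \<le> F then real s * ln (1 + F^2 / (real s)^2)
                   else real s / max 1 (ln (real s / F)))"

end

theory Submission
  imports Defs
begin

text \<open>Write \<open>X i\<close> for the standardized noise, \<open>F\<close> for the Frobenius norm, \<open>S\<close> for the support of
  \<open>\<theta>\<close> and \<open>L = ln (1 + F^2 / s^2)\<close>. Three observations carry the proof.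

  First, if \<open>g\<close> is even, the covariance of \<open>g (X i)\<close> and \<open>g (X j)\<close> is at most of the order of the
  squared correlation, since the first-order term of the Gaussian density ratio is odd. Hence weighted
  sums of \<open>g (X i)\<close> have standard deviation of order \<open>F\<close>; in particular the empirical c.d.f. has error
  of order \<open>F / d\<close>.

  Second, by Markov's inequality the median of the normalized squares lies between \<open>\<sigma>^2\<close> times the
  \<open>\<eta>/20\<close> and \<open>1 - \<eta>/20\<close> quantiles, so the dyadic point is one of boundedly many and
  \<open>sigmaS2_hat / \<sigma>^2 = 1 + O(F / d)\<close>, while the threshold on \<open>\<bar>X i\<bar>\<close> is at least \<open>3 * sqrt L\<close>.

  Third, the thresholded noise is a decreasing function of the random threshold. If \<open>F / d\<close> is small,
  the maximum in the threshold is \<open>sqrt sigmaS2_hat\<close> and the noise is sandwiched between its values at two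
  deterministic thresholds, where the second-moment bound applies; if \<open>F / d\<close> is bounded below, the
  expected thresholded noise is already of order \<open>s\<close>. The coordinates in \<open>S\<close> cost at most the squared
  threshold each.\<close>

section \<open>Linear images of Gaussian vectors\<close>

text \<open>The threshold is computed from the same data as the sum that it truncates, so a
  second-moment bound at a fixed threshold says nothing about it directly. This is why the sandwich
  uses a scale error \<open>e\<close> that is fixed before sampling. Errors of order
  \<open>s\<close> are affordable because \<open>L \<ge> 1/2\<close>. A relative scale error of
  order \<open>F / d\<close> fits exactly: it multiplies at most \<open>d\<close> coordinates whose
  mean truncated square is of order \<open>s / F\<close>. That mean, and the factor
  \<open>(s / F)^2\<close> in the truncated second moments, come from
  \<open>exp (- L) \<le> (s / F)^2\<close>, so the threshold has to exceed a multiple of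
  \<open>sqrt L\<close>. The factor 3 and the ratio of quantiles in \<open>tau\<close> secure this
  even when the scale is only known up to a constant. The choice \<alpha> = 1/4 protects the median:
  the signal moves the empirical c.d.f. by at most 1/4, and each tail at level
  \<open>\<eta>/20\<close> contributes less than another 1/4. The lower bound \<open>cstar\<close>
  on the variances enters when the unweighted correlations of the counts are compared with
  \<open>F^2\<close>, so the final constant depends on \<open>cstar\<close> and
  \<open>\<eta>\<close>.\<close>

lemma prob_space_std_normal_measure: "prob_space std_normal_measure"
  unfolding std_normal_measure_def by (rule prob_space_normal_density) simp

interpretation std_normal: prob_space std_normal_measure
  by (rule prob_space_std_normal_measure)

lemma sets_std_normal_measure [simp, measurable_cong]: "sets std_normal_measure = sets borel"
  by (simp add: std_normal_measure_def)

lemma space_std_normal_measure [simp]: "space std_normal_measure = UNIV"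
  by (simp add: std_normal_measure_def)

lemma nn_integral_std_normal:
  assumes [measurable]: "f \<in> borel_measurable borel"
  shows "(\<integral>\<^sup>+x. f x \<partial>std_normal_measure) = (\<integral>\<^sup>+x. ennreal (std_normal_density x) * f x \<partial>lborel)"
  unfolding std_normal_measure_def by (subst nn_integral_density) auto

text \<open>A rotation with \<open>c \<noteq> 0\<close> is a composition of two one-dimensional
  affine substitutions, first in \<open>u\<close> for fixed \<open>v\<close>, then in
  \<open>v\<close> for fixed image of \<open>u\<close>; their Jacobians
  \<open>1 / \<bar>c\<bar>\<close> and \<open>\<bar>c\<bar>\<close> cancel. For \<open>c = 0\<close>
  it is a swap of the axes with a sign.\<close>

lemma nn_integral_lborel_rotation:
  fixes f :: "real \<times> real \<Rightarrow> ennreal"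
  assumes [measurable]: "f \<in> borel_measurable (borel \<Otimes>\<^sub>M borel)" and cs: "c\<^sup>2 + s\<^sup>2 = 1"
  shows "(\<integral>\<^sup>+u. \<integral>\<^sup>+v. f (c * u - s * v, s * u + c * v) \<partial>lborel \<partial>lborel) =
         (\<integral>\<^sup>+u. \<integral>\<^sup>+v. f (u, v) \<partial>lborel \<partial>lborel)"
proof (cases "c = 0")
  case True
  with cs have s: "s = 1 \<or> s = -1"
    by (simp add: power2_eq_1_iff)
  then have s2: "s * s = 1" and s0: "s \<noteq> 0" and as: "\<bar>s\<bar> = 1" by auto
  have "(\<integral>\<^sup>+u. \<integral>\<^sup>+v. f (u, v) \<partial>lborel \<partial>lborel) = (\<integral>\<^sup>+v. \<integral>\<^sup>+u. f (u, v) \<partial>lborel \<partial>lborel)"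
    by (rule lborel_pair.Fubini') simp
  also have "\<dots> = (\<integral>\<^sup>+v. \<integral>\<^sup>+u. f (- s * u, v) \<partial>lborel \<partial>lborel)"
    by (rule nn_integral_cong, subst nn_integral_real_affine[where c = "-s" and t = 0]) (use s0 as in auto)
  also have "\<dots> = (\<integral>\<^sup>+v. \<integral>\<^sup>+u. f (- s * u, s * v) \<partial>lborel \<partial>lborel)"
    by (subst nn_integral_real_affine[where c = "s" and t = 0]) (use s0 as in auto)
  finally show ?thesis using True by simp
next
  case False
  have inner: "(\<integral>\<^sup>+u. f (c * u - s * v, s * u + c * v) \<partial>lborel) =
       ennreal (1 / \<bar>c\<bar>) * (\<integral>\<^sup>+x. f (x, (s / c) * x + v / c) \<partial>lborel)" for v
  proof -
    have eq: "c * (s * v / c + 1 / c * x) - s * v = x"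
       "s * (s * v / c + 1 / c * x) + c * v = (s / c) * x + v / c" for x
    proof -
      show "c * (s * v / c + 1 / c * x) - s * v = x" using False by (simp add: field_simps)
      have "s * (s * v / c + 1 / c * x) + c * v = (s / c) * x + (c\<^sup>2 + s\<^sup>2) * v / c"
        using False by (simp add: field_simps power2_eq_square)
      then show "s * (s * v / c + 1 / c * x) + c * v = (s / c) * x + v / c" using cs by simp
    qed
    show ?thesis
      by (subst nn_integral_real_affine[where c = "1 / c" and t = "s * v / c"])
         (use False in \<open>auto simp: eq simp del: times_divide_eq_left times_divide_eq_right mult_1\<close>)
  qed
  have "(\<integral>\<^sup>+u. \<integral>\<^sup>+v. f (c * u - s * v, s * u + c * v) \<partial>lborel \<partial>lborel) =
        (\<integral>\<^sup>+v. \<integral>\<^sup>+u. f (c * u - s * v, s * u + c * v) \<partial>lborel \<partial>lborel)"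
    by (rule lborel_pair.Fubini'[symmetric]) simp
  also have "\<dots> = ennreal (1 / \<bar>c\<bar>) * (\<integral>\<^sup>+v. \<integral>\<^sup>+x. f (x, (s / c) * x + v / c) \<partial>lborel \<partial>lborel)"
    unfolding inner by (subst nn_integral_cmult) auto
  also have "(\<integral>\<^sup>+v. \<integral>\<^sup>+x. f (x, (s / c) * x + v / c) \<partial>lborel \<partial>lborel) =
     (\<integral>\<^sup>+x. \<integral>\<^sup>+v. f (x, (s / c) * x + v / c) \<partial>lborel \<partial>lborel)"
    by (rule lborel_pair.Fubini') simp
  also have "\<dots> = (\<integral>\<^sup>+x. ennreal \<bar>c\<bar> * (\<integral>\<^sup>+y. f (x, y) \<partial>lborel) \<partial>lborel)"
  proof (rule nn_integral_cong)
    fix x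
    have eq: "s / c * x + (- s * x + c * y) / c = y" for y
      using False by (simp add: field_simps)
    show "(\<integral>\<^sup>+v. f (x, (s / c) * x + v / c) \<partial>lborel) = ennreal \<bar>c\<bar> * (\<integral>\<^sup>+y. f (x, y) \<partial>lborel)"
      by (subst nn_integral_real_affine[where c = c and t = "- s * x"]) (use False in \<open>auto simp only: eq\<close>, simp)
  qed
  also have "\<dots> = ennreal \<bar>c\<bar> * (\<integral>\<^sup>+x. \<integral>\<^sup>+y. f (x, y) \<partial>lborel \<partial>lborel)"
    by (rule nn_integral_cmult) simp
  also have "ennreal (1 / \<bar>c\<bar>) * (ennreal \<bar>c\<bar> * (\<integral>\<^sup>+x. \<integral>\<^sup>+y. f (x, y) \<partial>lborel \<partial>lborel)) =
     (\<integral>\<^sup>+x. \<integral>\<^sup>+y. f (x, y) \<partial>lborel \<partial>lborel)"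
    using False by (simp add: mult.assoc[symmetric] ennreal_mult[symmetric])
  finally show ?thesis .
qed

lemma nn_integral_std_normal2:
  assumes [measurable]: "f \<in> borel_measurable (borel \<Otimes>\<^sub>M borel)"
  shows "(\<integral>\<^sup>+u. \<integral>\<^sup>+v. f (u, v) \<partial>std_normal_measure \<partial>std_normal_measure) =
         (\<integral>\<^sup>+u. \<integral>\<^sup>+v. ennreal (std_normal_density u * std_normal_density v) * f (u, v) \<partial>lborel \<partial>lborel)"
  by (simp add: nn_integral_std_normal nn_integral_cmult[symmetric] ennreal_mult mult.assoc)

lemma std_normal_density_prod_eq:
  "std_normal_density u * std_normal_density v = exp (- (u\<^sup>2 + v\<^sup>2) / 2) / (2 * pi)"
  by (simp add: std_normal_density_def exp_add[symmetric] diff_divide_distrib add_divide_distrib)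

text \<open>The product density depends on \<open>u^2 + v^2\<close> only, which a rotation
  preserves, so the invariance is inherited from Lebesgue measure.\<close>

lemma nn_integral_std_normal_rotation:
  fixes f :: "real \<times> real \<Rightarrow> ennreal"
  assumes [measurable]: "f \<in> borel_measurable (borel \<Otimes>\<^sub>M borel)" and cs: "c\<^sup>2 + s\<^sup>2 = 1"
  shows "(\<integral>\<^sup>+u. \<integral>\<^sup>+v. f (c * u - s * v, s * u + c * v) \<partial>std_normal_measure \<partial>std_normal_measure) =
         (\<integral>\<^sup>+u. \<integral>\<^sup>+v. f (u, v) \<partial>std_normal_measure \<partial>std_normal_measure)"
proof -
  have eq: "(c * u - s * v)\<^sup>2 + (s * u + c * v)\<^sup>2 = u\<^sup>2 + v\<^sup>2" for u v
  proof -
    have "(c * u - s * v)\<^sup>2 + (s * u + c * v)\<^sup>2 = (c\<^sup>2 + s\<^sup>2) * (u\<^sup>2 + v\<^sup>2)" by algebra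
    then show ?thesis using cs by simp
  qed
  have "(\<integral>\<^sup>+u. \<integral>\<^sup>+v. f (c * u - s * v, s * u + c * v) \<partial>std_normal_measure \<partial>std_normal_measure) =
     (\<integral>\<^sup>+u. \<integral>\<^sup>+v. ennreal (std_normal_density u * std_normal_density v) * f (c * u - s * v, s * u + c * v) \<partial>lborel \<partial>lborel)"
    using nn_integral_std_normal2[of "\<lambda>x. f (c * fst x - s * snd x, s * fst x + c * snd x)"] by simp
  also have "\<dots> = (\<integral>\<^sup>+u. \<integral>\<^sup>+v. ennreal (std_normal_density (c * u - s * v) * std_normal_density (s * u + c * v)) * f (c * u - s * v, s * u + c * v) \<partial>lborel \<partial>lborel)"
    unfolding std_normal_density_prod_eq eq ..
  also have "\<dots> = (\<integral>\<^sup>+u. \<integral>\<^sup>+v. ennreal (std_normal_density u * std_normal_density v) * f (u, v) \<partial>lborel \<partial>lborel)"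
    using nn_integral_lborel_rotation[OF _ cs, of "\<lambda>x. ennreal (std_normal_density (fst x) * std_normal_density (snd x)) * f x"]
    by simp
  also have "\<dots> = (\<integral>\<^sup>+u. \<integral>\<^sup>+v. f (u, v) \<partial>std_normal_measure \<partial>std_normal_measure)"
    by (rule nn_integral_std_normal2[symmetric]) simp
  finally show ?thesis .
qed

lemma polar_coordinates_exist:
  fixes p a :: real
  obtains c s where "c\<^sup>2 + s\<^sup>2 = 1" "p = sqrt (p\<^sup>2 + a\<^sup>2) * c" "a = sqrt (p\<^sup>2 + a\<^sup>2) * s"
proof (cases "p\<^sup>2 + a\<^sup>2 = 0")
  case True
  then have "p = 0" "a = 0" by (auto simp: sum_power2_eq_zero_iff)
  then show ?thesis using that[of 1 0] by simp
next
  case False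
  define n where "n = sqrt (p\<^sup>2 + a\<^sup>2)"
  have n: "n\<^sup>2 = p\<^sup>2 + a\<^sup>2" "n \<noteq> 0" using False by (auto simp: n_def)
  show ?thesis
    using that[of "p / n" "a / n"] n False
    by (auto simp: n_def[symmetric] power_divide add_divide_distrib[symmetric])
qed

lemma nn_integral_std_normal_lincomb:
  assumes [measurable]: "f \<in> borel_measurable borel"
  shows "(\<integral>\<^sup>+u. \<integral>\<^sup>+v. f (p * u + a * v) \<partial>std_normal_measure \<partial>std_normal_measure) =
         (\<integral>\<^sup>+v. f (sqrt (p\<^sup>2 + a\<^sup>2) * v) \<partial>std_normal_measure)"
proof -
  obtain c s where cs: "c\<^sup>2 + s\<^sup>2 = 1" "p = sqrt (p\<^sup>2 + a\<^sup>2) * c" "a = sqrt (p\<^sup>2 + a\<^sup>2) * s"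
    using polar_coordinates_exist .
  define n where "n = sqrt (p\<^sup>2 + a\<^sup>2)"
  have "p = n * c" "a = n * s" using cs by (auto simp: n_def)
  then have "(\<integral>\<^sup>+u. \<integral>\<^sup>+v. f (p * u + a * v) \<partial>std_normal_measure \<partial>std_normal_measure) =
     (\<integral>\<^sup>+u. \<integral>\<^sup>+v. f (n * (c * u - (-s) * v)) \<partial>std_normal_measure \<partial>std_normal_measure)"
    by (simp add: algebra_simps)
  also have "\<dots> = (\<integral>\<^sup>+u. \<integral>\<^sup>+v. f (n * u) \<partial>std_normal_measure \<partial>std_normal_measure)"
    using nn_integral_std_normal_rotation[of "\<lambda>x. f (n * fst x)" c "-s"] cs by simp
  finally show ?thesis by (simp add: n_def std_normal.emeasure_space_1[simplified])
qed

text \<open>The numbers \<open>p\<close>, \<open>q\<close>, \<open>r\<close> form the Cholesky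
  factor of the Gram matrix of \<open>a\<close> and \<open>b\<close>. In the induction a new
  coordinate \<open>y\<close> joins the two normals \<open>u\<close> and \<open>v\<close>: rotating
  the pair of \<open>u\<close> and \<open>y\<close> makes the first component a multiple of one
  normal, and the two normals left over in the second component are merged into one. Stating the law
  through nonnegative integrals of arbitrary Borel functions avoids integrability
  conditions.\<close>

lemma nn_integral_gaussian_pair:
  fixes a b :: "'i \<Rightarrow> real"
  assumes "finite J"
  shows "\<exists>p q r. 0 \<le> p \<and> p\<^sup>2 = (\<Sum>k\<in>J. (a k)\<^sup>2) \<and> p * q = (\<Sum>k\<in>J. a k * b k) \<and>
     q\<^sup>2 + r\<^sup>2 = (\<Sum>k\<in>J. (b k)\<^sup>2) \<and>
     (\<forall>f::real \<times> real \<Rightarrow> ennreal. f \<in> borel_measurable (borel \<Otimes>\<^sub>M borel) \<longrightarrow>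
       (\<integral>\<^sup>+z. f (\<Sum>k\<in>J. a k * z k, \<Sum>k\<in>J. b k * z k) \<partial>PiM J (\<lambda>_. std_normal_measure)) =
       (\<integral>\<^sup>+u. \<integral>\<^sup>+v. f (p * u, q * u + r * v) \<partial>std_normal_measure \<partial>std_normal_measure))"
  using assms
proof (induction J)
  case empty
  show ?case
    by (intro exI[of _ 0]) (auto simp: PiM_empty nn_integral_count_space_finite std_normal.emeasure_space_1[simplified])
next
  case (insert i J)
  interpret N2: pair_sigma_finite std_normal_measure std_normal_measure ..
  interpret product_sigma_finite "\<lambda>_::'i. std_normal_measure" ..
  obtain p q r where p0: "0 \<le> p" and p: "p\<^sup>2 = (\<Sum>k\<in>J. (a k)\<^sup>2)" and pq: "p * q = (\<Sum>k\<in>J. a k * b k)"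
    and qr: "q\<^sup>2 + r\<^sup>2 = (\<Sum>k\<in>J. (b k)\<^sup>2)"
    and IH: "\<And>f::real \<times> real \<Rightarrow> ennreal. f \<in> borel_measurable (borel \<Otimes>\<^sub>M borel) \<Longrightarrow>
       (\<integral>\<^sup>+z. f (\<Sum>k\<in>J. a k * z k, \<Sum>k\<in>J. b k * z k) \<partial>PiM J (\<lambda>_. std_normal_measure)) =
       (\<integral>\<^sup>+u. \<integral>\<^sup>+v. f (p * u, q * u + r * v) \<partial>std_normal_measure \<partial>std_normal_measure)"
    using insert.IH by blast
  define p' where "p' = sqrt (p\<^sup>2 + (a i)\<^sup>2)"
  obtain c s where cs: "c\<^sup>2 + s\<^sup>2 = 1" and pc: "p = p' * c" and as: "a i = p' * s"
    unfolding p'_def using polar_coordinates_exist .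
  \<comment> \<open>\<open>q'\<close> and \<open>w\<close> are the coordinates of the vector with
    entries \<open>q\<close> and \<open>b i\<close> in the rotated frame; \<open>r'\<close> is the
    standard deviation of what is independent of the first component.\<close>
  define q' where "q' = q * c + b i * s"
  define w where "w = b i * c - q * s"
  define r' where "r' = sqrt (w\<^sup>2 + r\<^sup>2)"
  have r': "r'\<^sup>2 = w\<^sup>2 + r\<^sup>2" by (simp add: r'_def)
  have p': "p'\<^sup>2 = p\<^sup>2 + (a i)\<^sup>2" by (simp add: p'_def)
  have "p' * q' = p * q + a i * b i"
    by (simp add: q'_def pc as algebra_simps)
  moreover have "q'\<^sup>2 + w\<^sup>2 = q\<^sup>2 + (b i)\<^sup>2"
  proof -
    have "q'\<^sup>2 + w\<^sup>2 = (c\<^sup>2 + s\<^sup>2) * (q\<^sup>2 + (b i)\<^sup>2)" unfolding q'_def w_def by algebra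
    then show ?thesis using cs by simp
  qed
  moreover have "(\<integral>\<^sup>+z. f (\<Sum>k\<in>insert i J. a k * z k, \<Sum>k\<in>insert i J. b k * z k) \<partial>PiM (insert i J) (\<lambda>_. std_normal_measure)) =
       (\<integral>\<^sup>+u. \<integral>\<^sup>+v. f (p' * u, q' * u + r' * v) \<partial>std_normal_measure \<partial>std_normal_measure)"
    if [measurable]: "f \<in> borel_measurable (borel \<Otimes>\<^sub>M borel)" for f :: "real \<times> real \<Rightarrow> ennreal"
  proof -
    have upd: "(\<Sum>k\<in>insert i J. h k * (x(i := y)) k) = (\<Sum>k\<in>J. h k * x k) + h i * y" for h x and y :: real
      using insert.hyps by (auto intro!: sum.cong simp: add.commute)
    have [measurable]: "(\<lambda>z. \<Sum>k\<in>insert i J. h k * z k) \<in> borel_measurable (PiM (insert i J) (\<lambda>_. std_normal_measure))" for h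
      by measurable
    have "(\<integral>\<^sup>+z. f (\<Sum>k\<in>insert i J. a k * z k, \<Sum>k\<in>insert i J. b k * z k) \<partial>PiM (insert i J) (\<lambda>_. std_normal_measure)) =
      (\<integral>\<^sup>+x. \<integral>\<^sup>+y. f ((\<Sum>k\<in>J. a k * x k) + a i * y, (\<Sum>k\<in>J. b k * x k) + b i * y) \<partial>std_normal_measure \<partial>PiM J (\<lambda>_. std_normal_measure))"
      by (subst product_nn_integral_insert) (use insert.hyps in \<open>simp_all only: upd, measurable\<close>)
    also have "\<dots> = (\<integral>\<^sup>+u. \<integral>\<^sup>+v. \<integral>\<^sup>+y. f (p * u + a i * y, q * u + r * v + b i * y) \<partial>std_normal_measure \<partial>std_normal_measure \<partial>std_normal_measure)"
      using IH[of "\<lambda>x. \<integral>\<^sup>+y. f (fst x + a i * y, snd x + b i * y) \<partial>std_normal_measure"] by simp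
    also have "\<dots> = (\<integral>\<^sup>+u. \<integral>\<^sup>+y. \<integral>\<^sup>+v. f (p * u + a i * y, q * u + r * v + b i * y) \<partial>std_normal_measure \<partial>std_normal_measure \<partial>std_normal_measure)"
      by (intro nn_integral_cong N2.Fubini') simp
    also have "\<dots> = (\<integral>\<^sup>+u. \<integral>\<^sup>+y. \<integral>\<^sup>+v. f (p' * (c * u - (-s) * y), q' * (c * u - (-s) * y) + w * ((-s) * u + c * y) + r * v) \<partial>std_normal_measure \<partial>std_normal_measure \<partial>std_normal_measure)"
    proof -
      have "q' * (c * u - (-s) * y) + w * ((-s) * u + c * y) = (c\<^sup>2 + s\<^sup>2) * (q * u + b i * y)" for u y
        unfolding q'_def w_def by algebra
      then have "q' * (c * u - (-s) * y) + w * ((-s) * u + c * y) + r * v = q * u + r * v + b i * y" for u y v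
        using cs by simp
      moreover have "p' * (c * u - (-s) * y) = p * u + a i * y" for u y
        by (simp add: pc as algebra_simps)
      ultimately show ?thesis by presburger
    qed
    also have "\<dots> = (\<integral>\<^sup>+u. \<integral>\<^sup>+y. \<integral>\<^sup>+v. f (p' * u, q' * u + w * y + r * v) \<partial>std_normal_measure \<partial>std_normal_measure \<partial>std_normal_measure)"
      using nn_integral_std_normal_rotation[of "\<lambda>x. \<integral>\<^sup>+v. f (p' * fst x, q' * fst x + w * snd x + r * v) \<partial>std_normal_measure" c "-s"] cs
      by simp
    also have "\<dots> = (\<integral>\<^sup>+u. \<integral>\<^sup>+v. f (p' * u, q' * u + r' * v) \<partial>std_normal_measure \<partial>std_normal_measure)"
    proof (rule nn_integral_cong)
      fix u
      show "(\<integral>\<^sup>+y. \<integral>\<^sup>+v. f (p' * u, q' * u + w * y + r * v) \<partial>std_normal_measure \<partial>std_normal_measure) =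
          (\<integral>\<^sup>+v. f (p' * u, q' * u + r' * v) \<partial>std_normal_measure)"
        using nn_integral_std_normal_lincomb[of "\<lambda>x. f (p' * u, q' * u + x)" w r]
        by (simp add: r'_def add.assoc)
    qed
    finally show ?thesis .
  qed
  ultimately show ?case
    using insert.hyps p pq qr p' r'
    by (intro exI[of _ p'] exI[of _ q'] exI[of _ r']) (auto simp: p'_def)
qed

section \<open>Even functions of two correlated Gaussians\<close>

text \<open>The tilted density is, up to the factor \<open>s\<close>, the centred normal density
  with variance \<open>1 / (1 - 2 * c)\<close>. Every moment bound below is reduced to this
  integral.\<close>

lemma nn_integral_std_normal_exp_square:
  fixes c :: real
  assumes "c < 1/2"
  shows "(\<integral>\<^sup>+x. ennreal (exp (c * x\<^sup>2)) \<partial>std_normal_measure) = ennreal (1 / sqrt (1 - 2 * c))"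
proof -
  define s where "s = 1 / sqrt (1 - 2 * c)"
  have s: "s > 0" using assms by (simp add: s_def)
  have s2: "1 / s\<^sup>2 = 1 - 2 * c" using assms by (simp add: s_def power_divide)
  have eq: "std_normal_density x * exp (c * x\<^sup>2) = s * normal_density 0 s x" for x
  proof -
    have "- (x\<^sup>2 / 2) + c * x\<^sup>2 = - x\<^sup>2 / 2 * (1 / s\<^sup>2)" unfolding s2 by (simp add: field_simps)
    also have "\<dots> = - (x - 0)\<^sup>2 / (2 * s\<^sup>2)" by simp
    finally have e: "exp (- (x\<^sup>2 / 2)) * exp (c * x\<^sup>2) = exp (- (x - 0)\<^sup>2 / (2 * s\<^sup>2))"
      unfolding exp_add[symmetric] by simp
    have "sqrt (2 * pi * s\<^sup>2) = s * sqrt (2 * pi)" using s by (simp add: real_sqrt_mult)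
    then show ?thesis using s e unfolding normal_density_def std_normal_density_def
      by (simp add: field_simps)
  qed
  have "(\<integral>\<^sup>+x. ennreal (exp (c * x\<^sup>2)) \<partial>std_normal_measure) =
      (\<integral>\<^sup>+x. ennreal s * ennreal (normal_density 0 s x) \<partial>lborel)"
    using s by (subst nn_integral_std_normal) (auto simp: ennreal_mult[symmetric] eq)
  also have "\<dots> = ennreal s * (\<integral>\<^sup>+x. ennreal (normal_density 0 s x) \<partial>lborel)"
    by (rule nn_integral_cmult) simp
  also have "(\<integral>\<^sup>+x. ennreal (normal_density 0 s x) \<partial>lborel) = 1"
    using s integral_normal_density[of s 0] integrable_normal_density[of s 0]
    by (subst nn_integral_eq_integral) auto
  finally show ?thesis by (simp add: s_def)
qed

lemma nn_integral_std_normal_uminus: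
  assumes [measurable]: "f \<in> borel_measurable borel"
  shows "(\<integral>\<^sup>+x. f (- x) \<partial>std_normal_measure) = (\<integral>\<^sup>+x. f x \<partial>std_normal_measure)"
  using nn_integral_real_affine[of "\<lambda>x. ennreal (std_normal_density x) * f x" "-1" 0]
  by (simp add: nn_integral_std_normal std_normal_density_def)

text \<open>For \<open>r^2 = 1 - q^2\<close> this is the joint density of two standard normals with
  correlation \<open>q\<close>, divided by the product of their densities.\<close>

definition mehler_kernel :: "real \<Rightarrow> real \<Rightarrow> real \<Rightarrow> real \<Rightarrow> real" where
  "mehler_kernel q r u y = exp (- (q\<^sup>2 * (u\<^sup>2 + y\<^sup>2) - 2 * q * u * y) / (2 * r\<^sup>2)) / \<bar>r\<bar>"

text \<open>Substituting \<open>y = q * u + r * v\<close>, the exponent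
  \<open>(y - q * u)^2 / r^2\<close> exceeds \<open>y^2\<close> by exactly the quadratic form in the
  kernel, because \<open>q^2 = 1 - r^2\<close>.\<close>

lemma nn_integral_mehler_kernel:
  assumes [measurable]: "f \<in> borel_measurable borel" and "q\<^sup>2 + r\<^sup>2 = 1" "r \<noteq> 0"
  shows "(\<integral>\<^sup>+v. f (q * u + r * v) \<partial>std_normal_measure) =
         (\<integral>\<^sup>+y. ennreal (mehler_kernel q r u y) * f y \<partial>std_normal_measure)"
proof -
  have eq: "std_normal_density (- q * u / r + (1 / r) * y) = std_normal_density y * (mehler_kernel q r u y * \<bar>r\<bar>)" for y
  proof -
    have q2: "q\<^sup>2 = 1 - r\<^sup>2" using assms by simp
    have "(- q * u / r + (1 / r) * y)\<^sup>2 = (y - q * u)\<^sup>2 / r\<^sup>2"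
      by (simp add: power_divide[symmetric] diff_divide_distrib)
    also have "\<dots> = y\<^sup>2 + (q\<^sup>2 * (u\<^sup>2 + y\<^sup>2) - 2 * q * u * y) / r\<^sup>2"
      using \<open>r \<noteq> 0\<close> by (simp add: field_simps q2 power2_diff power_mult_distrib)
    finally have "- (- q * u / r + (1 / r) * y)\<^sup>2 / 2 =
       - y\<^sup>2 / 2 + - (q\<^sup>2 * (u\<^sup>2 + y\<^sup>2) - 2 * q * u * y) / (2 * r\<^sup>2)"
      by (simp add: diff_divide_distrib add_divide_distrib)
    then show ?thesis
      unfolding std_normal_density_def mehler_kernel_def using \<open>r \<noteq> 0\<close> by (simp add: exp_add[symmetric])
  qed
  have eq2: "q * u + r * (- q * u / r + (1 / r) * y) = y" for y
    using \<open>r \<noteq> 0\<close> by (simp add: field_simps)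
  have K: "mehler_kernel q r u y \<ge> 0" for y by (simp add: mehler_kernel_def)
  have [measurable]: "mehler_kernel q r u \<in> borel_measurable borel"
    unfolding mehler_kernel_def by measurable
  have "(\<integral>\<^sup>+v. f (q * u + r * v) \<partial>std_normal_measure) =
     (\<integral>\<^sup>+v. ennreal (std_normal_density v) * f (q * u + r * v) \<partial>lborel)"
    by (rule nn_integral_std_normal) simp
  also have "\<dots> = ennreal \<bar>1 / r\<bar> * (\<integral>\<^sup>+y. ennreal (std_normal_density (- q * u / r + (1 / r) * y)) *
        f (q * u + r * (- q * u / r + (1 / r) * y)) \<partial>lborel)"
    by (rule nn_integral_real_affine) (use \<open>r \<noteq> 0\<close> in auto)
  also have "\<dots> = (\<integral>\<^sup>+y. ennreal \<bar>1 / r\<bar> * (ennreal (std_normal_density y * (mehler_kernel q r u y * \<bar>r\<bar>)) * f y) \<partial>lborel)"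
    unfolding eq eq2 by (rule nn_integral_cmult[symmetric]) simp
  also have "\<dots> = (\<integral>\<^sup>+y. ennreal (std_normal_density y) * (ennreal (mehler_kernel q r u y) * f y) \<partial>lborel)"
    using \<open>r \<noteq> 0\<close> K
    by (intro nn_integral_cong) (simp add: mult.assoc[symmetric] ennreal_mult[symmetric])
  also have "\<dots> = (\<integral>\<^sup>+y. ennreal (mehler_kernel q r u y) * f y \<partial>std_normal_measure)"
    by (rule nn_integral_std_normal[symmetric]) simp
  finally show ?thesis .
qed

text \<open>From \<open>cosh (2 * x) = 1 + 2 * (sinh x)^2\<close> and
  \<open>sinh x \<le> x * exp x\<close> for \<open>x \<ge> 0\<close>. The point is that the error is
  quadratic in \<open>w\<close>.\<close>

lemma cosh_le: "cosh w \<le> 1 + w\<^sup>2 / 2 * exp \<bar>w\<bar>" for w :: real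
proof -
  define x where "x = \<bar>w\<bar> / 2"
  have x0: "x \<ge> 0" and w: "\<bar>w\<bar> = 2 * x" by (auto simp: x_def)
  have "1 - exp (- 2 * x) \<le> 2 * x" using exp_ge_add_one_self[of "- 2 * x"] by linarith
  then have "exp x * (1 - exp (- 2 * x)) \<le> exp x * (2 * x)" by simp
  then have "sinh x \<le> x * exp x"
    by (simp add: sinh_def algebra_simps exp_add[symmetric])
  then have "(sinh x)\<^sup>2 \<le> (x * exp x)\<^sup>2" using x0 by (intro power_mono) auto
  then have "cosh (2 * x) \<le> 1 + 2 * (x * exp x)\<^sup>2"
    using cosh_double[of x] cosh_square_eq[of x] by simp
  also have "2 * (x * exp x)\<^sup>2 = (2 * x)\<^sup>2 / 2 * exp (2 * x)"
    by (simp add: power_mult_distrib exp_double)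
  finally have "cosh \<bar>w\<bar> \<le> 1 + \<bar>w\<bar>\<^sup>2 / 2 * exp \<bar>w\<bar>" unfolding w by simp
  then show ?thesis by simp
qed

text \<open>Symmetrizing in \<open>u\<close> replaces \<open>exp w\<close> by \<open>cosh w\<close>,
  where \<open>w\<close> is linear in \<open>q\<close>, so what remains beyond 1 is of order
  \<open>q^2\<close>. The bound on \<open>q\<close> gives \<open>\<bar>w\<bar> \<le> Q / 16\<close>;
  with \<open>Q^2 \<le> 512 * exp (Q / 16)\<close> the growth is only \<open>exp (Q / 8)\<close>,
  which is integrable under the normal law in each variable.\<close>

lemma mehler_kernel_even_part_le:
  assumes "q\<^sup>2 + r\<^sup>2 = 1" "\<bar>q\<bar> \<le> 1/16"
  shows "mehler_kernel q r u y + mehler_kernel q r (- u) y \<le> 2 * (1 + 300 * q\<^sup>2 * exp ((u\<^sup>2 + y\<^sup>2) / 8))"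
proof -
  define Q where "Q = u\<^sup>2 + y\<^sup>2"
  define w where "w = q * u * y / r\<^sup>2"
  have Q0: "Q \<ge> 0" by (simp add: Q_def)
  have q2: "q\<^sup>2 \<le> 1/256" using power_mono[OF assms(2), of 2] by (simp add: power_divide)
  have r2: "r\<^sup>2 = 1 - q\<^sup>2" "r\<^sup>2 \<ge> 255/256" "r\<^sup>2 \<le> 1" using assms q2 zero_le_power2[of q] by linarith+
  have r1: "\<bar>r\<bar> \<le> 1" "r \<noteq> 0" using r2(2,3) abs_square_le_1[of r] by auto
  have "r\<^sup>2 \<le> \<bar>r\<bar>" using r1 mult_left_le[of "\<bar>r\<bar>" "\<bar>r\<bar>"] by (simp add: power2_eq_square)
  then have "1 / \<bar>r\<bar> \<le> 1 / r\<^sup>2" using r1 by (intro divide_left_mono) auto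
  also have "1 / r\<^sup>2 \<le> 1 + 2 * q\<^sup>2"
  proof -
    have "q\<^sup>2 * (2 * q\<^sup>2) \<le> q\<^sup>2 * 1" using q2 by (intro mult_left_mono) auto
    then have "1 \<le> (1 + 2 * q\<^sup>2) * r\<^sup>2" unfolding r2(1) by (simp add: algebra_simps)
    then show ?thesis using r1 by (simp add: divide_le_eq)
  qed
  finally have ir: "1 / \<bar>r\<bar> \<le> 1 + 2 * q\<^sup>2" .
  have "\<bar>u * y\<bar> \<le> Q / 2"
    using zero_le_power2[of "\<bar>u\<bar> - \<bar>y\<bar>"] by (simp add: Q_def power2_diff abs_mult)
  moreover have "\<bar>w\<bar> = \<bar>q\<bar> * \<bar>u * y\<bar> / r\<^sup>2" by (simp add: w_def abs_mult)
  ultimately have "\<bar>w\<bar> \<le> \<bar>q\<bar> * (Q / 2) / (1/2)"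
    using r2(2) Q0 by (simp only:) (intro frac_le mult_left_mono, auto)
  then have w1: "\<bar>w\<bar> \<le> \<bar>q\<bar> * Q" by simp
  also have "\<dots> \<le> 1/16 * Q" using assms Q0 by (intro mult_right_mono) auto
  finally have w2: "\<bar>w\<bar> \<le> Q / 16" by simp
  have "w\<^sup>2 \<le> (\<bar>q\<bar> * Q)\<^sup>2" using w1 by (metis abs_ge_zero power2_abs power_mono)
  then have w3: "w\<^sup>2 \<le> q\<^sup>2 * Q\<^sup>2" by (simp add: power_mult_distrib)
  have "(Q / 16)\<^sup>2 / 2 \<le> exp (Q / 16)"
    using exp_lower_Taylor_quadratic[of "Q/16"] Q0 by simp
  then have Q2: "Q\<^sup>2 \<le> 512 * exp (Q / 16)" by (simp add: power_divide)
  have "w\<^sup>2 / 2 * exp \<bar>w\<bar> \<le> (q\<^sup>2 * (512 * exp (Q / 16))) / 2 * exp (Q / 16)"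
  proof (rule mult_mono)
    have "w\<^sup>2 \<le> q\<^sup>2 * (512 * exp (Q / 16))"
      using w3 Q2 by (meson mult_left_mono order_trans zero_le_power2)
    then show "w\<^sup>2 / 2 \<le> (q\<^sup>2 * (512 * exp (Q / 16))) / 2" by simp
  qed (use w2 in auto)
  also have "\<dots> = 256 * q\<^sup>2 * exp (Q / 8)"
    by (simp add: exp_add[symmetric])
  finally have cw: "cosh w \<le> 1 + 256 * q\<^sup>2 * exp (Q / 8)" using cosh_le[of w] by linarith
  have "- (q\<^sup>2 * Q - 2 * q * u * y) / (2 * r\<^sup>2) = - (q\<^sup>2 * Q) / (2 * r\<^sup>2) + w"
       "- (q\<^sup>2 * Q - 2 * q * (-u) * y) / (2 * r\<^sup>2) = - (q\<^sup>2 * Q) / (2 * r\<^sup>2) + - w"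
    using r1 by (auto simp: w_def field_simps)
  then have "mehler_kernel q r u y + mehler_kernel q r (- u) y =
     1 / \<bar>r\<bar> * exp (- (q\<^sup>2 * Q) / (2 * r\<^sup>2)) * (exp w + exp (- w))"
    unfolding mehler_kernel_def Q_def[symmetric] power2_minus
    by (simp only: exp_add) (simp add: add_divide_distrib distrib_left)
  also have "\<dots> = 2 * (1 / \<bar>r\<bar> * exp (- (q\<^sup>2 * Q) / (2 * r\<^sup>2)) * cosh w)"
    by (simp add: cosh_def)
  also have "1 / \<bar>r\<bar> * exp (- (q\<^sup>2 * Q) / (2 * r\<^sup>2)) * cosh w \<le> (1 + 2 * q\<^sup>2) * 1 * (1 + 256 * q\<^sup>2 * exp (Q / 8))"
    using ir cw Q0 by (intro mult_mono) (auto intro!: divide_nonneg_nonneg mult_nonneg_nonneg)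
  \<comment> \<open>The coefficients of \<open>q^2 * exp (Q / 8)\<close> add up to at most
    \<open>2 + 256 + 512 / 256 = 260\<close>.\<close>
  also have "\<dots> \<le> 1 + 300 * q\<^sup>2 * exp (Q / 8)"
  proof -
    have "1 \<le> exp (Q / 8)" using Q0 by simp
    then have a: "q\<^sup>2 * 1 \<le> q\<^sup>2 * exp (Q / 8)" by (intro mult_left_mono) auto
    have b: "q\<^sup>2 * (q\<^sup>2 * exp (Q / 8)) \<le> 1/256 * (q\<^sup>2 * exp (Q / 8))"
      using q2 by (intro mult_right_mono) auto
    have "(1 + 2 * q\<^sup>2) * 1 * (1 + 256 * q\<^sup>2 * exp (Q / 8)) =
      1 + 2 * q\<^sup>2 + 256 * (q\<^sup>2 * exp (Q / 8)) + 512 * (q\<^sup>2 * (q\<^sup>2 * exp (Q / 8)))"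
      by (simp add: algebra_simps)
    moreover have "0 \<le> q\<^sup>2 * exp (Q / 8)" by simp
    ultimately show ?thesis using a b unfolding mult.assoc by linarith
  qed
  finally show ?thesis by (simp add: Q_def)
qed

text \<open>For even functions the term of first order in the correlation drops out, which is what
  makes the variances below comparable with the Frobenius norm of the covariance matrix.\<close>

lemma nn_integral_even_product_le:
  fixes g :: "real \<Rightarrow> real"
  assumes [measurable]: "g \<in> borel_measurable borel"
    and nonneg: "\<And>x. 0 \<le> g x" and even: "\<And>x. g (- x) = g x" and qr: "q\<^sup>2 + r\<^sup>2 = 1"
  shows "(\<integral>\<^sup>+u. \<integral>\<^sup>+v. ennreal (g u * g (q * u + r * v)) \<partial>std_normal_measure \<partial>std_normal_measure)
    \<le> (\<integral>\<^sup>+x. ennreal (g x) \<partial>std_normal_measure)\<^sup>2 +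
       ennreal (600 * q\<^sup>2) * (\<integral>\<^sup>+x. ennreal ((g x)\<^sup>2 * exp (x\<^sup>2 / 8)) \<partial>std_normal_measure)"
    (is "?I \<le> ?m\<^sup>2 + _ * ?D")
proof (cases "\<bar>q\<bar> \<le> 1/16")
  case False
  have "?I \<le> (\<integral>\<^sup>+u. \<integral>\<^sup>+v. ennreal ((g u)\<^sup>2 / 2) + ennreal ((g (q * u + r * v))\<^sup>2 / 2) \<partial>std_normal_measure \<partial>std_normal_measure)"
  proof (intro nn_integral_mono)
    fix u v
    have "g u * g (q * u + r * v) \<le> (g u)\<^sup>2 / 2 + (g (q * u + r * v))\<^sup>2 / 2"
      using sum_squares_bound[of "g u" "g (q * u + r * v)"] by simp
    then show "ennreal (g u * g (q * u + r * v)) \<le> ennreal ((g u)\<^sup>2 / 2) + ennreal ((g (q * u + r * v))\<^sup>2 / 2)"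
      by (simp add: ennreal_plus[symmetric] del: ennreal_plus)
  qed
  also have "\<dots> = (\<integral>\<^sup>+u. ennreal ((g u)\<^sup>2 / 2) \<partial>std_normal_measure) +
      (\<integral>\<^sup>+u. \<integral>\<^sup>+v. ennreal ((g (q * u + r * v))\<^sup>2 / 2) \<partial>std_normal_measure \<partial>std_normal_measure)"
    by (simp add: nn_integral_add std_normal.emeasure_space_1[simplified])
  also have "(\<integral>\<^sup>+u. \<integral>\<^sup>+v. ennreal ((g (q * u + r * v))\<^sup>2 / 2) \<partial>std_normal_measure \<partial>std_normal_measure) =
     (\<integral>\<^sup>+u. ennreal ((g u)\<^sup>2 / 2) \<partial>std_normal_measure)"
    using nn_integral_std_normal_lincomb[of "\<lambda>x. ennreal ((g x)\<^sup>2 / 2)" q r] qr by simp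
  also have "(\<integral>\<^sup>+u. ennreal ((g u)\<^sup>2 / 2) \<partial>std_normal_measure) + (\<integral>\<^sup>+u. ennreal ((g u)\<^sup>2 / 2) \<partial>std_normal_measure) =
     (\<integral>\<^sup>+u. ennreal ((g u)\<^sup>2) \<partial>std_normal_measure)"
    by (simp add: nn_integral_add[symmetric] ennreal_plus[symmetric] del: ennreal_plus)
  also have "\<dots> \<le> (\<integral>\<^sup>+u. ennreal (600 * q\<^sup>2) * ennreal ((g u)\<^sup>2 * exp (u\<^sup>2 / 8)) \<partial>std_normal_measure)"
  proof (rule nn_integral_mono)
    fix u
    have "(1/16)\<^sup>2 \<le> \<bar>q\<bar>\<^sup>2" using False by (intro power_mono) auto
    then have "1 \<le> 600 * q\<^sup>2" by (simp add: power_divide)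
    moreover have "1 * (g u)\<^sup>2 \<le> exp (u\<^sup>2 / 8) * (g u)\<^sup>2"
      by (intro mult_right_mono) auto
    ultimately have "1 * (g u)\<^sup>2 \<le> 600 * q\<^sup>2 * ((g u)\<^sup>2 * exp (u\<^sup>2 / 8))"
      by (intro mult_mono) (auto simp: mult.commute)
    then show "ennreal ((g u)\<^sup>2) \<le> ennreal (600 * q\<^sup>2) * ennreal ((g u)\<^sup>2 * exp (u\<^sup>2 / 8))"
      by (simp add: ennreal_mult[symmetric])
  qed
  also have "\<dots> = ennreal (600 * q\<^sup>2) * ?D" by (rule nn_integral_cmult) simp
  finally show ?thesis by (rule order_trans) simp
next
  case True
  have "q\<^sup>2 \<le> 1/256" using power_mono[OF True, of 2] by (simp add: power_divide)
  then have r0: "r \<noteq> 0" using qr by auto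
  have [measurable]: "(\<lambda>x. mehler_kernel q r (f x) (h x)) \<in> borel_measurable M"
    if [measurable]: "f \<in> borel_measurable M" "h \<in> borel_measurable M" for f h and M :: "'b measure"
    unfolding mehler_kernel_def by measurable
  have K0: "mehler_kernel q r u y \<ge> 0" for u y by (simp add: mehler_kernel_def)
  have I1: "?I = (\<integral>\<^sup>+u. \<integral>\<^sup>+y. ennreal (mehler_kernel q r u y * (g u * g y)) \<partial>std_normal_measure \<partial>std_normal_measure)"
  proof (rule nn_integral_cong)
    fix u
    show "(\<integral>\<^sup>+v. ennreal (g u * g (q * u + r * v)) \<partial>std_normal_measure) =
      (\<integral>\<^sup>+y. ennreal (mehler_kernel q r u y * (g u * g y)) \<partial>std_normal_measure)"
      using nn_integral_mehler_kernel[of "\<lambda>y. ennreal (g u * g y)" q r u] qr r0 nonneg K0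
      by (simp add: ennreal_mult[symmetric])
  qed
  \<comment> \<open>Reflecting \<open>u\<close> leaves both the normal law and \<open>g\<close>
    unchanged. Averaging \<open>I1\<close> and \<open>I2\<close> therefore puts the symmetrized
    kernel under the integral.\<close>
  have I2: "?I = (\<integral>\<^sup>+u. \<integral>\<^sup>+y. ennreal (mehler_kernel q r (- u) y * (g u * g y)) \<partial>std_normal_measure \<partial>std_normal_measure)"
    unfolding I1 using nn_integral_std_normal_uminus[of "\<lambda>u. \<integral>\<^sup>+y. ennreal (mehler_kernel q r u y * (g u * g y)) \<partial>std_normal_measure"]
    by (simp add: even)
  \<comment> \<open>The bound \<open>2 * g u * g y \<le> (g u)^2 + (g y)^2\<close> separates the
    variables in the error term: one variable carries the weighted second moment, the other only the
    integral of \<open>exp (x^2 / 8)\<close>, which is at most 2. This turns 300 into 600.\<close>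
  have le: "(mehler_kernel q r u y + mehler_kernel q r (- u) y) * (g u * g y) \<le>
       2 * (g u * g y) + 300 * q\<^sup>2 * ((g u)\<^sup>2 * exp (u\<^sup>2 / 8)) * exp (y\<^sup>2 / 8)
       + 300 * q\<^sup>2 * ((g y)\<^sup>2 * exp (y\<^sup>2 / 8)) * exp (u\<^sup>2 / 8)" for u y
  proof -
    have "(mehler_kernel q r u y + mehler_kernel q r (- u) y) * (g u * g y) \<le>
       2 * (1 + 300 * q\<^sup>2 * exp ((u\<^sup>2 + y\<^sup>2) / 8)) * (g u * g y)"
      using mehler_kernel_even_part_le[OF qr True] nonneg by (intro mult_right_mono) auto
    also have "\<dots> = 2 * (g u * g y) + 300 * q\<^sup>2 * exp ((u\<^sup>2 + y\<^sup>2) / 8) * (2 * g u * g y)"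
      by (simp add: algebra_simps)
    also have "\<dots> \<le> 2 * (g u * g y) + 300 * q\<^sup>2 * exp ((u\<^sup>2 + y\<^sup>2) / 8) * ((g u)\<^sup>2 + (g y)\<^sup>2)"
      using sum_squares_bound[of "g u" "g y"] by (intro add_left_mono mult_left_mono) auto
    also have "\<dots> = 2 * (g u * g y) + 300 * q\<^sup>2 * ((g u)\<^sup>2 * exp (u\<^sup>2 / 8)) * exp (y\<^sup>2 / 8)
       + 300 * q\<^sup>2 * ((g y)\<^sup>2 * exp (y\<^sup>2 / 8)) * exp (u\<^sup>2 / 8)"
      by (simp add: add_divide_distrib exp_add algebra_simps)
    finally show ?thesis .
  qed
  let ?E = "\<integral>\<^sup>+x. ennreal (exp (x\<^sup>2 / 8)) \<partial>std_normal_measure"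
  have E: "?E \<le> 2"
  proof -
    have "(1/2)\<^sup>2 \<le> (3::real)/4" by (simp add: power2_eq_square)
    then have "1/2 \<le> sqrt (3/4)" by (rule real_le_rsqrt)
    then have "1 / sqrt (3/4) \<le> 1 / (1/2)" by (intro divide_left_mono) auto
    then have "ennreal (1 / sqrt (3/4)) \<le> ennreal 2" by (intro ennreal_leI) simp
    then show ?thesis using nn_integral_std_normal_exp_square[of "1/8"] by simp
  qed
  have "2 * ?I = (\<integral>\<^sup>+u. \<integral>\<^sup>+y. ennreal ((mehler_kernel q r u y + mehler_kernel q r (- u) y) * (g u * g y)) \<partial>std_normal_measure \<partial>std_normal_measure)"
    unfolding mult_2
    by (subst (1) I1, subst I2) (simp add: nn_integral_add[symmetric] ennreal_plus[symmetric] K0 nonneg distrib_right del: ennreal_plus)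
  also have "\<dots> \<le> (\<integral>\<^sup>+u. \<integral>\<^sup>+y. 2 * (ennreal (g u) * ennreal (g y)) +
       ennreal (300 * q\<^sup>2) * ennreal ((g u)\<^sup>2 * exp (u\<^sup>2 / 8)) * ennreal (exp (y\<^sup>2 / 8))
       + ennreal (300 * q\<^sup>2) * ennreal ((g y)\<^sup>2 * exp (y\<^sup>2 / 8)) * ennreal (exp (u\<^sup>2 / 8)) \<partial>std_normal_measure \<partial>std_normal_measure)"
  proof (intro nn_integral_mono)
    fix u y
    show "ennreal ((mehler_kernel q r u y + mehler_kernel q r (- u) y) * (g u * g y)) \<le>
      2 * (ennreal (g u) * ennreal (g y)) +
       ennreal (300 * q\<^sup>2) * ennreal ((g u)\<^sup>2 * exp (u\<^sup>2 / 8)) * ennreal (exp (y\<^sup>2 / 8))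
       + ennreal (300 * q\<^sup>2) * ennreal ((g y)\<^sup>2 * exp (y\<^sup>2 / 8)) * ennreal (exp (u\<^sup>2 / 8))"
      using ennreal_leI[OF le[of u y]] nonneg by (simp add: ennreal_mult mult.assoc)
  qed
  also have "\<dots> = 2 * (?m * ?m) + ennreal (300 * q\<^sup>2) * ?D * ?E + ennreal (300 * q\<^sup>2) * ?D * ?E"
    by (simp add: nn_integral_add nn_integral_cmult nn_integral_multc mult.assoc)
  also have "\<dots> = 2 * (?m\<^sup>2 + ennreal (300 * q\<^sup>2) * ?D * ?E)"
    by (simp add: power2_eq_square distrib_left mult_2)
  also have "\<dots> \<le> 2 * (?m\<^sup>2 + ennreal (300 * q\<^sup>2) * ?D * 2)"
    by (intro mult_left_mono add_left_mono E) auto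
  also have "ennreal (300 * q\<^sup>2) * ?D * 2 = ennreal (600 * q\<^sup>2) * ?D"
  proof -
    have "ennreal (300 * q\<^sup>2) * ?D * 2 = (ennreal (300 * q\<^sup>2) * ennreal 2) * ?D" by (simp add: ac_simps)
    also have "ennreal (300 * q\<^sup>2) * ennreal 2 = ennreal (600 * q\<^sup>2)"
      by (subst ennreal_mult[symmetric]) auto
    finally show ?thesis .
  qed
  finally show ?thesis
    by (subst (asm) ennreal_mult_le_mult_iff) auto
qed

section \<open>Weighted sums over the coordinates of a Gaussian vector\<close>

text \<open>With unit rows, \<open>cov d B\<close> is the correlation matrix of standard normal
  variables \<open>X i\<close>; in the application \<open>B\<close> holds the rows of
  \<open>A\<close> divided by their standard deviations.\<close>

locale gaussian_rows =
  fixes d :: nat and B :: "nat \<Rightarrow> nat \<Rightarrow> real"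
  assumes unit_rows: "\<And>i. i < d \<Longrightarrow> cov d B i i = 1"
begin

definition X :: "nat \<Rightarrow> (nat \<Rightarrow> real) \<Rightarrow> real" where
  "X i z = (\<Sum>k<d. B i k * z k)"

sublocale prob_space "std_gauss_vec d"
  unfolding std_gauss_vec_def by (intro prob_space_PiM prob_space_std_normal_measure)

lemma measurable_X [measurable]: "X i \<in> borel_measurable (std_gauss_vec d)"
  unfolding X_def std_gauss_vec_def by measurable

lemma nn_integral_X_pair:
  assumes "i < d" "j < d"
  shows "\<exists>r. (cov d B i j)\<^sup>2 + r\<^sup>2 = 1 \<and>
    (\<forall>f::real \<times> real \<Rightarrow> ennreal. f \<in> borel_measurable (borel \<Otimes>\<^sub>M borel) \<longrightarrow>
       (\<integral>\<^sup>+z. f (X i z, X j z) \<partial>std_gauss_vec d) =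
       (\<integral>\<^sup>+u. \<integral>\<^sup>+v. f (u, cov d B i j * u + r * v) \<partial>std_normal_measure \<partial>std_normal_measure))"
proof -
  obtain p q r where p: "0 \<le> p" "p\<^sup>2 = (\<Sum>k<d. (B i k)\<^sup>2)" and q: "p * q = (\<Sum>k<d. B i k * B j k)"
    and r: "q\<^sup>2 + r\<^sup>2 = (\<Sum>k<d. (B j k)\<^sup>2)"
    and f: "\<And>f::real \<times> real \<Rightarrow> ennreal. f \<in> borel_measurable (borel \<Otimes>\<^sub>M borel) \<Longrightarrow>
       (\<integral>\<^sup>+z. f (\<Sum>k<d. B i k * z k, \<Sum>k<d. B j k * z k) \<partial>PiM {..<d} (\<lambda>_. std_normal_measure)) =
       (\<integral>\<^sup>+u. \<integral>\<^sup>+v. f (p * u, q * u + r * v) \<partial>std_normal_measure \<partial>std_normal_measure)"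
    using nn_integral_gaussian_pair[of "{..<d}" "B i" "B j"] by auto
  have "p\<^sup>2 = 1" using p unit_rows[OF assms(1)] by (simp add: cov_def power2_eq_square)
  then have p1: "p = 1" using p by (simp add: power2_eq_1_iff)
  have q1: "q = cov d B i j" using q p1 by (simp add: cov_def)
  have "q\<^sup>2 + r\<^sup>2 = 1" using r unit_rows[OF assms(2)] by (simp add: cov_def power2_eq_square)
  then show ?thesis
    using f unfolding q1 p1 X_def std_gauss_vec_def by (intro exI[of _ r]) simp
qed

lemma nn_integral_X:
  assumes "i < d" and [measurable]: "f \<in> borel_measurable borel"
  shows "(\<integral>\<^sup>+z. f (X i z) \<partial>std_gauss_vec d) = (\<integral>\<^sup>+x. f x \<partial>std_normal_measure)"
proof -
  obtain r where "\<And>f::real \<times> real \<Rightarrow> ennreal. f \<in> borel_measurable (borel \<Otimes>\<^sub>M borel) \<Longrightarrow>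
       (\<integral>\<^sup>+z. f (X i z, X i z) \<partial>std_gauss_vec d) =
       (\<integral>\<^sup>+u. \<integral>\<^sup>+v. f (u, cov d B i i * u + r * v) \<partial>std_normal_measure \<partial>std_normal_measure)"
    using nn_integral_X_pair[OF assms(1) assms(1)] by auto
  from this[of "\<lambda>x. f (fst x)"] show ?thesis
    by (simp add: std_normal.emeasure_space_1[simplified])
qed

lemma nn_integral_even_X_product_le:
  fixes g :: "real \<Rightarrow> real"
  assumes "i < d" "j < d" and [measurable]: "g \<in> borel_measurable borel"
    and "\<And>x. 0 \<le> g x" "\<And>x. g (- x) = g x"
  shows "(\<integral>\<^sup>+z. ennreal (g (X i z) * g (X j z)) \<partial>std_gauss_vec d)
    \<le> (\<integral>\<^sup>+x. ennreal (g x) \<partial>std_normal_measure)\<^sup>2 +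
       ennreal (600 * (cov d B i j)\<^sup>2) * (\<integral>\<^sup>+x. ennreal ((g x)\<^sup>2 * exp (x\<^sup>2 / 8)) \<partial>std_normal_measure)"
proof -
  obtain r where r: "(cov d B i j)\<^sup>2 + r\<^sup>2 = 1"
   and f: "\<And>f::real \<times> real \<Rightarrow> ennreal. f \<in> borel_measurable (borel \<Otimes>\<^sub>M borel) \<Longrightarrow>
       (\<integral>\<^sup>+z. f (X i z, X j z) \<partial>std_gauss_vec d) =
       (\<integral>\<^sup>+u. \<integral>\<^sup>+v. f (u, cov d B i j * u + r * v) \<partial>std_normal_measure \<partial>std_normal_measure)"
    using nn_integral_X_pair[OF assms(1,2)] by auto
  have "(\<integral>\<^sup>+z. ennreal (g (X i z) * g (X j z)) \<partial>std_gauss_vec d) =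
     (\<integral>\<^sup>+u. \<integral>\<^sup>+v. ennreal (g u * g (cov d B i j * u + r * v)) \<partial>std_normal_measure \<partial>std_normal_measure)"
    using f[of "\<lambda>x. ennreal (g (fst x) * g (snd x))"] by simp
  then show ?thesis using nn_integral_even_product_le[OF assms(3-5) r] by metis
qed

text \<open>Markov's inequality only sees the marginals, so it needs no bound on the correlations.\<close>

lemma prob_weighted_sum_ge_le:
  fixes g :: "real \<Rightarrow> real"
  assumes [measurable]: "g \<in> borel_measurable borel" and g: "\<And>x. 0 \<le> g x" "integrable std_normal_measure g"
    and w: "\<And>i. i \<in> I \<Longrightarrow> 0 \<le> w i" "I \<subseteq> {..<d}" and k: "0 < k"
  shows "prob {z \<in> space (std_gauss_vec d). k \<le> (\<Sum>i\<in>I. w i * g (X i z))}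
    \<le> (\<Sum>i\<in>I. w i) * (\<integral>x. g x \<partial>std_normal_measure) / k"
proof -
  let ?m = "\<integral>x. g x \<partial>std_normal_measure"
  have m0: "?m \<ge> 0" using g by (simp add: integral_nonneg_AE)
  have nn: "(\<integral>\<^sup>+z. ennreal (g (X i z)) \<partial>std_gauss_vec d) = ennreal ?m" if "i < d" for i
    using that g by (subst nn_integral_X) (auto intro!: nn_integral_eq_integral)
  have int: "integrable (std_gauss_vec d) (\<lambda>z. g (X i z))" if "i < d" for i
    using nn[OF that] g by (intro integrableI_nonneg) auto
  have int_eq: "expectation (\<lambda>z. g (X i z)) = ?m" if "i < d" for i
    using nn[OF that] g m0 by (intro integral_eq_nn_integral[THEN trans]) auto
  have "prob {z \<in> space (std_gauss_vec d). k \<le> (\<Sum>i\<in>I. w i * g (X i z))}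
      \<le> expectation (\<lambda>z. \<Sum>i\<in>I. w i * g (X i z)) / k"
    using w g k int by (intro integral_Markov_inequality_measure[where A = "{}"])
      (auto intro!: sum_nonneg Bochner_Integration.integrable_sum)
  also have "expectation (\<lambda>z. \<Sum>i\<in>I. w i * g (X i z)) = (\<Sum>i\<in>I. w i * ?m)"
    using w int int_eq by (subst Bochner_Integration.integral_sum) (auto intro!: sum.cong)
  finally show ?thesis by (simp add: sum_distrib_right)
qed

text \<open>Chebyshev's inequality with the covariance bound for even functions. The covariances are
  bounded from above only, which is enough since the weights are nonnegative.\<close>

lemma prob_weighted_sum_deviation_le:
  fixes g :: "real \<Rightarrow> real"
  assumes [measurable]: "g \<in> borel_measurable borel" and g: "\<And>x. 0 \<le> g x" "\<And>x. g (- x) = g x"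
    and D: "integrable std_normal_measure (\<lambda>x. (g x)\<^sup>2 * exp (x\<^sup>2 / 8))"
    and w: "\<And>i. i \<in> I \<Longrightarrow> 0 \<le> w i" "I \<subseteq> {..<d}" and k: "0 < k"
  shows "prob {z \<in> space (std_gauss_vec d).
      k \<le> \<bar>(\<Sum>i\<in>I. w i * g (X i z)) - (\<Sum>i\<in>I. w i) * (\<integral>x. g x \<partial>std_normal_measure)\<bar>}
    \<le> 600 * (\<integral>x. (g x)\<^sup>2 * exp (x\<^sup>2 / 8) \<partial>std_normal_measure) *
       (\<Sum>i\<in>I. \<Sum>j\<in>I. w i * w j * (cov d B i j)\<^sup>2) / k\<^sup>2"
proof -
  let ?m = "\<integral>x. g x \<partial>std_normal_measure"
  let ?D = "\<integral>x. (g x)\<^sup>2 * exp (x\<^sup>2 / 8) \<partial>std_normal_measure"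
  let ?T = "\<lambda>z. (\<Sum>i\<in>I. w i * g (X i z)) - (\<Sum>i\<in>I. w i) * ?m"
  have [measurable]: "?T \<in> borel_measurable (std_gauss_vec d)" by measurable
  \<comment> \<open>\<open>2 * g x \<le> 1 + (g x)^2\<close> derives integrability of
    \<open>g\<close> from that of the weighted square.\<close>
  have bnd: "norm (g x) \<le> norm (1 + (g x)\<^sup>2 * exp (x\<^sup>2 / 8))" for x
  proof -
    have "g x * 2 \<le> 1 + (g x)\<^sup>2" using sum_squares_bound[of 1 "g x"] by (simp add: mult.commute)
    moreover have "(g x)\<^sup>2 * 1 \<le> (g x)\<^sup>2 * exp (x\<^sup>2 / 8)" by (intro mult_left_mono) auto
    moreover have "0 \<le> (g x)\<^sup>2" by simp
    ultimately show ?thesis using g(1)[of x] unfolding real_norm_def by linarith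
  qed
  have intg: "integrable std_normal_measure g"
    by (rule Bochner_Integration.integrable_bound[OF Bochner_Integration.integrable_add[OF _ D, of "\<lambda>_. 1"] _ AE_I2[OF bnd]])
       simp_all
  have m0: "?m \<ge> 0" using g by (simp add: integral_nonneg_AE)
  have D0: "?D \<ge> 0" by (simp add: integral_nonneg_AE)
  have nnm: "(\<integral>\<^sup>+x. ennreal (g x) \<partial>std_normal_measure) = ennreal ?m"
    using intg g by (intro nn_integral_eq_integral) auto
  have nnD: "(\<integral>\<^sup>+x. ennreal ((g x)\<^sup>2 * exp (x\<^sup>2 / 8)) \<partial>std_normal_measure) = ennreal ?D"
    using D by (intro nn_integral_eq_integral) auto
  have nn: "(\<integral>\<^sup>+z. ennreal (g (X i z)) \<partial>std_gauss_vec d) = ennreal ?m" if "i < d" for i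
    using that by (subst nn_integral_X) (auto simp: nnm)
  have int: "integrable (std_gauss_vec d) (\<lambda>z. g (X i z))" if "i < d" for i
    using nn[OF that] g by (intro integrableI_nonneg) auto
  have int_eq: "expectation (\<lambda>z. g (X i z)) = ?m" if "i < d" for i
    using nn[OF that] g m0 by (intro integral_eq_nn_integral[THEN trans]) auto
  have nn2: "(\<integral>\<^sup>+z. ennreal (g (X i z) * g (X j z)) \<partial>std_gauss_vec d) \<le> ennreal (?m\<^sup>2 + 600 * (cov d B i j)\<^sup>2 * ?D)"
    if "i < d" "j < d" for i j
    using nn_integral_even_X_product_le[OF that assms(1-3)] m0 D0
    unfolding nnm nnD by (simp add: ennreal_mult ennreal_power)
  have int2: "integrable (std_gauss_vec d) (\<lambda>z. g (X i z) * g (X j z))" if "i < d" "j < d" for i j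
    using order.strict_trans1[OF nn2[OF that] ennreal_less_top] g by (intro integrableI_nonneg) auto
  have E2: "expectation (\<lambda>z. g (X i z) * g (X j z)) \<le> ?m\<^sup>2 + 600 * (cov d B i j)\<^sup>2 * ?D" if "i < d" "j < d" for i j
  proof -
    have "ennreal (expectation (\<lambda>z. g (X i z) * g (X j z))) \<le> ennreal (?m\<^sup>2 + 600 * (cov d B i j)\<^sup>2 * ?D)"
      using nn2[OF that] int2[OF that] g by (subst nn_integral_eq_integral[symmetric]) auto
    then show ?thesis using D0 by (subst (asm) ennreal_le_iff) auto
  qed
  have int3: "integrable (std_gauss_vec d) (\<lambda>z. (g (X i z) - ?m) * (g (X j z) - ?m))" if "i < d" "j < d" for i j
    using that int int2 by (simp add: algebra_simps)
  have E3: "expectation (\<lambda>z. (g (X i z) - ?m) * (g (X j z) - ?m)) \<le> 600 * (cov d B i j)\<^sup>2 * ?D" if "i < d" "j < d" for i j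
  proof -
    have "expectation (\<lambda>z. (g (X i z) - ?m) * (g (X j z) - ?m)) =
       expectation (\<lambda>z. g (X i z) * g (X j z) - ?m * g (X i z) - ?m * g (X j z) + ?m\<^sup>2)"
      by (simp add: algebra_simps power2_eq_square)
    also have "\<dots> = expectation (\<lambda>z. g (X i z) * g (X j z)) - ?m\<^sup>2"
      using that int int2 int_eq by (simp add: power2_eq_square prob_space)
    finally show ?thesis using E2[OF that] by simp
  qed
  have Id: "i < d" if "i \<in> I" for i using w(2) that by auto
  have Tsq: "(?T z)\<^sup>2 = (\<Sum>i\<in>I. \<Sum>j\<in>I. w i * w j * ((g (X i z) - ?m) * (g (X j z) - ?m)))" for z
  proof -
    have "?T z = (\<Sum>i\<in>I. w i * (g (X i z) - ?m))"
      by (simp add: sum_distrib_right sum_subtractf right_diff_distrib)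
    then show ?thesis by (simp add: power2_eq_square sum_product ac_simps)
  qed
  have "prob {z \<in> space (std_gauss_vec d). k\<^sup>2 \<le> (?T z)\<^sup>2} \<le> expectation (\<lambda>z. (?T z)\<^sup>2) / k\<^sup>2"
  proof (rule integral_Markov_inequality_measure[where A = "{}"])
    show "integrable (std_gauss_vec d) (\<lambda>z. (?T z)\<^sup>2)"
      unfolding Tsq
      by (intro Bochner_Integration.integrable_sum Bochner_Integration.integrable_mult_right int3 Id)
  qed (use k in auto)
  also have "{z \<in> space (std_gauss_vec d). k\<^sup>2 \<le> (?T z)\<^sup>2} = {z \<in> space (std_gauss_vec d). k \<le> \<bar>?T z\<bar>}"
    using k by (intro Collect_cong conj_cong refl) (simp add: abs_le_square_iff[symmetric])
  also have "expectation (\<lambda>z. (?T z)\<^sup>2) \<le> 600 * ?D * (\<Sum>i\<in>I. \<Sum>j\<in>I. w i * w j * (cov d B i j)\<^sup>2)"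
  proof -
    have "expectation (\<lambda>z. (?T z)\<^sup>2) = (\<Sum>i\<in>I. \<Sum>j\<in>I. w i * w j * expectation (\<lambda>z. (g (X i z) - ?m) * (g (X j z) - ?m)))"
      unfolding Tsq
      by (subst Bochner_Integration.integral_sum,
          intro Bochner_Integration.integrable_sum Bochner_Integration.integrable_mult_right int3 Id, assumption+,
          rule sum.cong, rule refl, subst Bochner_Integration.integral_sum,
          intro Bochner_Integration.integrable_mult_right int3 Id, assumption+, simp)
    also have "\<dots> \<le> (\<Sum>i\<in>I. \<Sum>j\<in>I. w i * w j * (600 * (cov d B i j)\<^sup>2 * ?D))"
      using w(1) by (intro sum_mono mult_left_mono E3 Id) auto
    also have "\<dots> = 600 * ?D * (\<Sum>i\<in>I. \<Sum>j\<in>I. w i * w j * (cov d B i j)\<^sup>2)"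
      by (simp add: sum_distrib_left sum_distrib_right ac_simps)
    finally show ?thesis .
  qed
  finally show ?thesis using k by (simp add: divide_right_mono)
qed

end

section \<open>The chi-square distribution and truncated second moments\<close>

lemma measure_std_normal_eq:
  assumes "A \<in> sets borel"
  shows "measure std_normal_measure A = (\<integral>x. std_normal_density x * indicator A x \<partial>lborel)"
proof -
  have "measure std_normal_measure A = (\<integral>x. indicator A x \<partial>std_normal_measure)" using assms by simp
  also have "\<dots> = (\<integral>x. std_normal_density x * indicator A x \<partial>lborel)"
    unfolding std_normal_measure_def using assms by (subst integral_density) auto
  finally show ?thesis .
qed

lemma std_normal_density_le_half: "std_normal_density x \<le> 1 / 2"
proof -
  have "2 \<le> sqrt (2 * pi)" using pi_gt3 by (intro real_le_rsqrt) auto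
  then have "1 / sqrt (2 * pi) \<le> 1 / 2" by (intro divide_left_mono) auto
  moreover have "std_normal_density x \<le> 1 / sqrt (2 * pi) * 1"
    unfolding std_normal_density_def by (intro mult_left_mono) auto
  ultimately show ?thesis by linarith
qed

lemma measure_std_normal_le:
  assumes "A \<in> sets borel" "emeasure lborel A < \<infinity>"
  shows "measure std_normal_measure A \<le> measure lborel A / 2"
proof -
  have "(\<integral>x. std_normal_density x * indicator A x \<partial>lborel) \<le> (\<integral>x. 1/2 * indicator A x \<partial>lborel)"
    using assms std_normal_density_le_half integrable_mult_indicator[of A lborel std_normal_density]
    by (intro integral_mono) (auto split: split_indicator simp: mult.commute integrable_normal_density)
  then show ?thesis using assms by (simp add: measure_std_normal_eq)
qed

lemma measure_std_normal_ge:
  assumes "A \<in> sets borel" "emeasure lborel A < \<infinity>" "\<And>x. x \<in> A \<Longrightarrow> \<bar>x\<bar> \<le> T"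
  shows "std_normal_density T * measure lborel A \<le> measure std_normal_measure A"
proof -
  have "std_normal_density T \<le> std_normal_density x" if "x \<in> A" for x
  proof -
    have "x\<^sup>2 \<le> T\<^sup>2" using assms(3)[OF that] by (metis abs_ge_zero power2_abs power_mono)
    then show ?thesis unfolding std_normal_density_def by (intro mult_left_mono) auto
  qed
  then have "(\<integral>x. std_normal_density T * indicator A x \<partial>lborel) \<le> (\<integral>x. std_normal_density x * indicator A x \<partial>lborel)"
    using assms integrable_mult_indicator[of A lborel std_normal_density]
    by (intro integral_mono) (auto split: split_indicator simp: mult.commute integrable_normal_density)
  then show ?thesis using assms by (simp add: measure_std_normal_eq)
qed

lemma chi1_cdf_diff_eq:
  assumes "u \<le> v"
  shows "chi1_cdf v - chi1_cdf u = measure std_normal_measure {z. u < z\<^sup>2 \<and> z\<^sup>2 \<le> v}"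
proof -
  have eq: "{z. u < z\<^sup>2 \<and> z\<^sup>2 \<le> v} = {z. z\<^sup>2 \<le> v} - {z::real. z\<^sup>2 \<le> u}"
    by (auto simp: not_le)
  have m: "{z::real. z\<^sup>2 \<le> t} \<in> sets std_normal_measure" for t by simp
  have sub: "{z::real. z\<^sup>2 \<le> u} \<subseteq> {z. z\<^sup>2 \<le> v}"
    using assms by (intro Collect_mono impI) (rule order_trans)
  show ?thesis unfolding chi1_cdf_def eq by (rule std_normal.finite_measure_Diff[OF m m sub, symmetric])
qed

lemma chi1_cdf_mono: "u \<le> v \<Longrightarrow> chi1_cdf u \<le> chi1_cdf v"
  using chi1_cdf_diff_eq[of u v] measure_nonneg[of std_normal_measure "{z. u < z\<^sup>2 \<and> z\<^sup>2 \<le> v}"] by linarith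

lemma chi1_cdf_0 [simp]: "chi1_cdf 0 = 0"
  using measure_std_normal_le[of "{0}"] measure_nonneg[of std_normal_measure "{0}"] by (simp add: chi1_cdf_def)

lemma chi1_cdf_neg: "t < 0 \<Longrightarrow> chi1_cdf t = 0"
proof -
  assume "t < 0"
  then have "{z::real. z\<^sup>2 \<le> t} = {}" by (auto simp: not_le intro: less_le_trans)
  then show ?thesis by (simp add: chi1_cdf_def)
qed

text \<open>The event consists of two symmetric intervals of length \<open>sqrt v - sqrt u\<close>,
  on each of which the density is at most 1/2.\<close>

lemma chi1_cdf_diff_le:
  assumes "0 \<le> u" "u \<le> v"
  shows "chi1_cdf v - chi1_cdf u \<le> sqrt v - sqrt u"
proof -
  have "{z. u < z\<^sup>2 \<and> z\<^sup>2 \<le> v} \<subseteq> {-sqrt v..-sqrt u} \<union> {sqrt u..sqrt v}"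
  proof
    fix z assume "z \<in> {z. u < z\<^sup>2 \<and> z\<^sup>2 \<le> v}"
    then have "sqrt u \<le> \<bar>z\<bar>" "\<bar>z\<bar> \<le> sqrt v"
      using real_sqrt_le_mono[of u "z\<^sup>2"] real_sqrt_le_mono[of "z\<^sup>2" v] by auto
    then show "z \<in> {-sqrt v..-sqrt u} \<union> {sqrt u..sqrt v}" by auto
  qed
  then have "measure std_normal_measure {z. u < z\<^sup>2 \<and> z\<^sup>2 \<le> v} \<le>
      measure std_normal_measure ({-sqrt v..-sqrt u} \<union> {sqrt u..sqrt v})"
    by (intro std_normal.finite_measure_mono) auto
  also have "\<dots> \<le> measure std_normal_measure {-sqrt v..-sqrt u} + measure std_normal_measure {sqrt u..sqrt v}"
    by (intro measure_Un_le) auto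
  also have "\<dots> \<le> sqrt v - sqrt u"
    using measure_std_normal_le[of "{-sqrt v..-sqrt u}"] measure_std_normal_le[of "{sqrt u..sqrt v}"] assms
    by simp
  finally show ?thesis using chi1_cdf_diff_eq[OF assms(2)] by simp
qed

text \<open>Keeping only the positive interval, the density is at least its value at
  \<open>sqrt T\<close>, and \<open>v - u\<close> is at most \<open>2 * sqrt T\<close> times the
  length. The reciprocal of this slope is a Lipschitz constant of the quantile function on bounded
  ranges.\<close>

lemma chi1_cdf_diff_ge:
  assumes "0 \<le> u" "u \<le> v" "v \<le> T" "0 < T"
  shows "std_normal_density (sqrt T) / (2 * sqrt T) * (v - u) \<le> chi1_cdf v - chi1_cdf u"
proof -
  have "v - u = (sqrt v - sqrt u) * (sqrt v + sqrt u)"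
    using assms by (simp add: algebra_simps)
  also have "\<dots> \<le> (sqrt v - sqrt u) * (2 * sqrt T)"
    using assms real_sqrt_le_mono[of v T] real_sqrt_le_mono[of u v] by (intro mult_left_mono) linarith+
  finally have "(v - u) / (2 * sqrt T) \<le> sqrt v - sqrt u" using assms by (simp add: divide_le_eq)
  then have "std_normal_density (sqrt T) * ((v - u) / (2 * sqrt T)) \<le> std_normal_density (sqrt T) * (sqrt v - sqrt u)"
    by (intro mult_left_mono) auto
  also have "\<dots> = std_normal_density (sqrt T) * measure lborel {sqrt u<..sqrt v}" using assms by simp
  also have "\<dots> \<le> measure std_normal_measure {sqrt u<..sqrt v}"
  proof (rule measure_std_normal_ge)
    fix x assume "x \<in> {sqrt u<..sqrt v}"
    moreover have "0 \<le> sqrt u" "sqrt v \<le> sqrt T" using assms by auto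
    ultimately show "\<bar>x\<bar> \<le> sqrt T" unfolding greaterThanAtMost_iff by linarith
  qed (use assms in auto)
  also have "\<dots> \<le> measure std_normal_measure {z. u < z\<^sup>2 \<and> z\<^sup>2 \<le> v}"
  proof (rule std_normal.finite_measure_mono)
    show "{sqrt u<..sqrt v} \<subseteq> {z. u < z\<^sup>2 \<and> z\<^sup>2 \<le> v}"
    proof
      fix z assume z: "z \<in> {sqrt u<..sqrt v}"
      then have "z > 0" using real_sqrt_ge_zero[OF assms(1)] unfolding greaterThanAtMost_iff by linarith
      then show "z \<in> {z. u < z\<^sup>2 \<and> z\<^sup>2 \<le> v}"
        using z assms power_strict_mono[of "sqrt u" z 2] power_mono[of z "sqrt v" 2] by auto
    qed
  qed auto
  finally show ?thesis using chi1_cdf_diff_eq[OF assms(2)] by simp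
qed

lemma chi1_cdf_strict_mono:
  assumes "0 \<le> u" "u < v"
  shows "chi1_cdf u < chi1_cdf v"
proof -
  have "0 < std_normal_density (sqrt v) / (2 * sqrt v) * (v - u)"
    using assms by (intro mult_pos_pos divide_pos_pos normal_density_pos) auto
  also have "\<dots> \<le> chi1_cdf v - chi1_cdf u"
    using assms by (intro chi1_cdf_diff_ge) auto
  finally show ?thesis by simp
qed

lemma chi1_cdf_le_1: "chi1_cdf t \<le> 1"
  by (simp add: chi1_cdf_def)

lemma chi1_cdf_less_1: "chi1_cdf t < 1"
proof -
  have "chi1_cdf t \<le> chi1_cdf (max t 0)" by (rule chi1_cdf_mono) simp
  also have "\<dots> < chi1_cdf (max t 0 + 1)" by (rule chi1_cdf_strict_mono) auto
  also have "\<dots> \<le> 1" by (rule chi1_cdf_le_1)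
  finally show ?thesis .
qed

lemma continuous_on_chi1_cdf: "continuous_on {0..} chi1_cdf"
proof (rule continuous_on_subset[OF _ order_refl], unfold continuous_on_iff, intro ballI allI impI)
  fix x e :: real assume x: "x \<in> {0..}" and e: "0 < e"
  have "continuous_on {0..} sqrt" by (intro continuous_intros)
  with x e obtain \<delta> where \<delta>: "\<delta> > 0" "\<And>x'. x' \<in> {0..} \<Longrightarrow> dist x' x < \<delta> \<Longrightarrow> dist (sqrt x') (sqrt x) < e"
    unfolding continuous_on_iff by metis
  have "dist (chi1_cdf x') (chi1_cdf x) \<le> dist (sqrt x') (sqrt x)" if "x' \<in> {0..}" for x'
    using that x chi1_cdf_diff_le[of x x'] chi1_cdf_diff_le[of x' x] chi1_cdf_mono[of x x'] chi1_cdf_mono[of x' x]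
      real_sqrt_le_iff[of x x'] real_sqrt_le_iff[of x' x]
    by (cases "x \<le> x'") (auto simp: dist_real_def)
  then show "\<exists>\<delta>>0. \<forall>x'\<in>{0..}. dist x' x < \<delta> \<longrightarrow> dist (chi1_cdf x') (chi1_cdf x) < e"
    using \<delta> by (intro exI[of _ \<delta>]) (auto intro: le_less_trans)
qed

lemma chi1_cdf_tendsto_1: "(\<lambda>n. chi1_cdf (real n)) \<longlonglongrightarrow> 1"
proof -
  have "(\<lambda>n. measure std_normal_measure {z::real. z\<^sup>2 \<le> real n}) \<longlonglongrightarrow>
      measure std_normal_measure (\<Union>n. {z::real. z\<^sup>2 \<le> real n})"
    by (intro std_normal.finite_Lim_measure_incseq) (auto simp: incseq_def intro: order_trans)
  moreover have "(\<Union>n. {z::real. z\<^sup>2 \<le> real n}) = space std_normal_measure"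
    using real_arch_simple by auto
  ultimately show ?thesis by (simp add: chi1_cdf_def std_normal.prob_space del: space_std_normal_measure)
qed

text \<open>The intermediate value theorem gives a solution \<open>t\<close>, and strict
  monotonicity on the nonnegative reals makes the set under the infimum equal to
  \<open>{t..}\<close>, so the generalized inverse is a true inverse.\<close>

lemma chi1_quantile_props:
  assumes "0 < p" "p < 1"
  shows "0 < chi1_quantile p" "chi1_cdf (chi1_quantile p) = p"
proof -
  obtain n where n: "p < chi1_cdf (real n)"
    using order_tendstoD(1)[OF chi1_cdf_tendsto_1 assms(2)] by (auto simp: eventually_sequentially)
  have "\<exists>t\<ge>0. t \<le> real n \<and> chi1_cdf t = p"
    using n assms by (intro IVT' continuous_on_subset[OF continuous_on_chi1_cdf]) auto
  then obtain t where t: "0 \<le> t" "chi1_cdf t = p" by auto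
  have "{t'. p \<le> chi1_cdf t'} = {t..}"
  proof (intro set_eqI iffI; simp)
    fix t' assume a: "p \<le> chi1_cdf t'"
    show "t \<le> t'"
    proof (rule ccontr)
      assume "\<not> t \<le> t'"
      then have "chi1_cdf t' < p"
        using chi1_cdf_strict_mono[of t' t] chi1_cdf_neg[of t'] t assms by (cases "t' < 0") auto
      with a show False by simp
    qed
  qed (use t chi1_cdf_mono in auto)
  then have "chi1_quantile p = t" by (simp add: chi1_quantile_def)
  then show "0 < chi1_quantile p" "chi1_cdf (chi1_quantile p) = p" using t assms by (auto simp: order_less_le)
qed

lemma chi1_quantile_strict_mono:
  assumes "0 < p" "p < p'" "p' < 1"
  shows "chi1_quantile p < chi1_quantile p'"
proof (rule ccontr)
  assume "\<not> ?thesis"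
  then have "chi1_cdf (chi1_quantile p') \<le> chi1_cdf (chi1_quantile p)" by (intro chi1_cdf_mono) simp
  then show False using assms chi1_quantile_props(2)[of p] chi1_quantile_props(2)[of p'] by simp
qed

lemma chi1_quantile_mono:
  assumes "0 < p" "p \<le> p'" "p' < 1"
  shows "chi1_quantile p \<le> chi1_quantile p'"
  using chi1_quantile_strict_mono[of p p'] assms by (cases "p = p'") auto

text \<open>With an exact \<open>p\<close> the ratio would be 1. A small error keeps
  \<open>p\<close> away from 1, where the quantile function is Lipschitz; for a large error the
  ratio is merely bounded, and the bound is absorbed into the multiple of \<open>x\<close>.\<close>

lemma chi1_inv_ratio_error:
  assumes "0 < a" "a \<le> b"
  obtains C where "0 < C"
    "\<And>u p x. a \<le> u \<Longrightarrow> u \<le> b \<Longrightarrow> 1/2 \<le> p \<Longrightarrow> \<bar>p - chi1_cdf u\<bar> \<le> x \<Longrightarrow>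
       \<bar>real_of_ereal (ereal u / chi1_inv p) - 1\<bar> \<le> C * x"
proof -
  define h where "h = chi1_quantile (1/2)"
  \<comment> \<open>Half the distance to 1, so that \<open>chi1_cdf b + x0\<close> still has a
    finite quantile. The two summands of \<open>C\<close> serve errors above and below
    \<open>x0\<close>.\<close>
  define x0 where "x0 = (1 - chi1_cdf b) / 2"
  define T where "T = max b (chi1_quantile (chi1_cdf b + x0))"
  define m where "m = std_normal_density (sqrt T) / (2 * sqrt T)"
  define C where "C = (b / h + 1) / x0 + 1 / (m * h)"
  have h: "h > 0" unfolding h_def by (rule chi1_quantile_props) auto
  have x0: "x0 > 0" using chi1_cdf_less_1[of b] by (simp add: x0_def)
  have T: "T > 0" using assms by (simp add: T_def)
  have m: "m > 0" unfolding m_def using T by (intro divide_pos_pos normal_density_pos) auto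
  have c0: "0 \<le> chi1_cdf b" by (simp add: chi1_cdf_def)
  have C: "C > 0" unfolding C_def using h x0 m assms by (intro add_pos_pos divide_pos_pos mult_pos_pos) auto
  show ?thesis
  proof (rule that[OF C])
    fix u p x assume u: "a \<le> u" "u \<le> b" and p: "1/2 \<le> p" and x: "\<bar>p - chi1_cdf u\<bar> \<le> x"
    let ?R = "real_of_ereal (ereal u / chi1_inv p)"
    have xn: "x \<ge> 0" using x by linarith
    have hp: "h \<le> chi1_quantile p" if "p < 1"
      unfolding h_def using that p by (intro chi1_quantile_mono) auto
    \<comment> \<open>At \<open>p \<ge> 1\<close> the quotient by infinity is 0; this can happen
      only in the case \<open>x \<ge> x0\<close>.\<close>
    have R: "?R = (if 1 \<le> p then 0 else u / chi1_quantile p)"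
      using hp h by (auto simp: chi1_inv_def)
    have "0 \<le> ?R \<and> ?R \<le> b / h"
      using R hp h u assms by (auto intro!: frac_le)
    then have R1: "\<bar>?R - 1\<bar> \<le> b / h + 1" by linarith
    show "\<bar>?R - 1\<bar> \<le> C * x"
    proof (cases "x \<ge> x0")
      case True
      have "(b / h + 1) * 1 \<le> (b / h + 1) * (x / x0)"
        using True x0 h assms by (intro mult_left_mono) auto
      also have "\<dots> \<le> C * x" unfolding C_def using xn m h by (simp add: distrib_right)
      finally show ?thesis using R1 by simp
    next
      case False
      have cu: "chi1_cdf u \<le> chi1_cdf b" using u by (rule_tac chi1_cdf_mono)
      have "p \<le> chi1_cdf b + x0" using x cu False by linarith
      moreover have lt1: "chi1_cdf b + x0 < 1" using chi1_cdf_less_1[of b] by (simp add: x0_def field_simps)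
      ultimately have p1: "p < 1" and "chi1_quantile p \<le> chi1_quantile (chi1_cdf b + x0)"
        using p by (auto intro!: chi1_quantile_mono)
      then have GT: "chi1_quantile p \<le> T" by (simp add: T_def)
      have uT: "u \<le> T" using u by (simp add: T_def)
      have G: "chi1_cdf (chi1_quantile p) = p" "chi1_quantile p > 0" using chi1_quantile_props p p1 by auto
      have "m * \<bar>chi1_quantile p - u\<bar> \<le> x"
        using chi1_cdf_diff_ge[of u "chi1_quantile p" T] chi1_cdf_diff_ge[of "chi1_quantile p" u T] GT uT T u assms x G
        unfolding m_def[symmetric] by (cases "u \<le> chi1_quantile p") (auto simp: abs_if algebra_simps split: if_splits)
      then have "\<bar>u - chi1_quantile p\<bar> \<le> x / m" using m by (simp add: field_simps abs_minus_commute)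
      then have "\<bar>u - chi1_quantile p\<bar> / chi1_quantile p \<le> (x / m) / h"
        using hp[OF p1] h xn m by (intro frac_le) auto
      moreover have "\<bar>?R - 1\<bar> = \<bar>u - chi1_quantile p\<bar> / chi1_quantile p"
      proof -
        have "?R - 1 = (u - chi1_quantile p) / chi1_quantile p"
          unfolding R using p1 G(2) by (simp add: diff_divide_distrib)
        then show ?thesis using G(2) by simp
      qed
      ultimately have "\<bar>?R - 1\<bar> \<le> 1 / (m * h) * x" by simp
      also have "\<dots> \<le> C * x" unfolding C_def using xn x0 h assms by (intro mult_right_mono) auto
      finally show ?thesis .
    qed
  qed
qed

section \<open>Truncated second moments and their dependence on the threshold\<close>

definition tail_square :: "real \<Rightarrow> real \<Rightarrow> real" where
  "tail_square t x = x\<^sup>2 * (if \<bar>x\<bar> > t then 1 else 0)"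

lemma tail_square_measurable [measurable]: "tail_square t \<in> borel_measurable borel"
  unfolding tail_square_def by measurable

lemma tail_square_nonneg: "0 \<le> tail_square t x"
  by (simp add: tail_square_def)

lemma tail_square_even: "tail_square t (- x) = tail_square t x"
  by (simp add: tail_square_def)

lemma tail_square_antimono: "t \<le> t' \<Longrightarrow> tail_square t' x \<le> tail_square t x"
  by (simp add: tail_square_def)

lemma integral_std_normal_exp_square:
  fixes c :: real
  assumes "c < 1/2"
  shows "integrable std_normal_measure (\<lambda>x. exp (c * x\<^sup>2))"
    and "(\<integral>x. exp (c * x\<^sup>2) \<partial>std_normal_measure) = 1 / sqrt (1 - 2 * c)"
  using nn_integral_std_normal_exp_square[OF assms] assms
  by (auto intro!: integrableI_nonneg simp: integral_eq_nn_integral)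

lemma integrable_std_normal_leI:
  fixes f :: "real \<Rightarrow> real"
  assumes [measurable]: "f \<in> borel_measurable borel" and "\<And>x. 0 \<le> f x" "\<And>x. f x \<le> K * exp (c * x\<^sup>2)" "c < 1/2"
  shows "integrable std_normal_measure f" "(\<integral>x. f x \<partial>std_normal_measure) \<le> K / sqrt (1 - 2 * c)"
proof -
  have i: "integrable std_normal_measure (\<lambda>x. K * exp (c * x\<^sup>2))"
    using integral_std_normal_exp_square[OF assms(4)] by simp
  have "norm (f x) \<le> norm (K * exp (c * x\<^sup>2))" for x using assms(2,3)[of x] by simp
  then show f: "integrable std_normal_measure f"
    by (intro Bochner_Integration.integrable_bound[OF i] AE_I2) auto
  have "(\<integral>x. f x \<partial>std_normal_measure) \<le> (\<integral>x. K * exp (c * x\<^sup>2) \<partial>std_normal_measure)"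
    using f i assms(3) by (rule integral_mono)
  then show "(\<integral>x. f x \<partial>std_normal_measure) \<le> K / sqrt (1 - 2 * c)"
    using integral_std_normal_exp_square[OF assms(4)] by simp
qed

lemma square_le_exp: "y\<^sup>2 \<le> 2 * exp y" if "0 \<le> y" for y :: real
  using exp_lower_Taylor_quadratic[OF that] that by simp

text \<open>On \<open>\<bar>x\<bar> > t\<close> a factor \<open>exp (x^2 / 4)\<close> can be traded
  for \<open>exp (- t^2 / 4)\<close>. The exponents 1/16 (absorbing the fourth power), 1/8 and 1/4
  add up to 7/16, just below the integrability limit 1/2; \<open>512 * sqrt 8\<close> is at most
  1536.\<close>

lemma tail_square_weighted_moment:
  assumes "0 \<le> t"
  shows "integrable std_normal_measure (\<lambda>x. (tail_square t x)\<^sup>2 * exp (x\<^sup>2 / 8))"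
    and "(\<integral>x. (tail_square t x)\<^sup>2 * exp (x\<^sup>2 / 8) \<partial>std_normal_measure) \<le> 1536 * exp (- t\<^sup>2 / 4)"
proof -
  have le: "(tail_square t x)\<^sup>2 * exp (x\<^sup>2 / 8) \<le> 512 * exp (- t\<^sup>2 / 4) * exp (7/16 * x\<^sup>2)" for x
  proof (cases "\<bar>x\<bar> > t")
    case True
    have "t\<^sup>2 \<le> x\<^sup>2" using True assms by (metis abs_ge_zero less_imp_le power2_abs power_mono)
    then have e: "exp (x\<^sup>2 / 16) * exp (x\<^sup>2 / 8) \<le> exp (- t\<^sup>2 / 4) * exp (7/16 * x\<^sup>2)"
      unfolding exp_add[symmetric] by simp
    have "(x\<^sup>2)\<^sup>2 \<le> 512 * exp (x\<^sup>2 / 16)" using square_le_exp[of "x\<^sup>2 / 16"] by (simp add: power_divide)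
    then have "(x\<^sup>2)\<^sup>2 * exp (x\<^sup>2 / 8) \<le> 512 * exp (x\<^sup>2 / 16) * exp (x\<^sup>2 / 8)" by (intro mult_right_mono) auto
    also have "\<dots> \<le> 512 * (exp (- t\<^sup>2 / 4) * exp (7/16 * x\<^sup>2))" using e by simp
    finally show ?thesis using True by (simp add: tail_square_def)
  qed (simp add: tail_square_def)
  have "2 * sqrt (2::real) \<le> 3" using real_sqrt_le_mono[of 2 "9/4"] by (simp add: real_sqrt_divide)
  then have "1 / sqrt (1 - 2 * (7/16)) \<le> (3::real)"
    using real_sqrt_mult[of 4 2] by (simp add: real_sqrt_divide)
  then have "512 * exp (- t\<^sup>2 / 4) / sqrt (1 - 2 * (7/16)) \<le> 1536 * exp (- t\<^sup>2 / 4)"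
    using mult_left_mono[of "1 / sqrt (1 - 2 * (7/16))" 3 "512 * exp (- t\<^sup>2 / 4)"] by simp
  then show "(\<integral>x. (tail_square t x)\<^sup>2 * exp (x\<^sup>2 / 8) \<partial>std_normal_measure) \<le> 1536 * exp (- t\<^sup>2 / 4)"
    using integrable_std_normal_leI(2)[OF _ _ le] by simp
  show "integrable std_normal_measure (\<lambda>x. (tail_square t x)\<^sup>2 * exp (x\<^sup>2 / 8))"
    using integrable_std_normal_leI(1)[OF _ _ le] by simp
qed

text \<open>The same trade with total exponent 3/8. The non-strict truncation is the one in
  \<open>alpha_se\<close>, whereas \<open>Q_hat\<close> truncates strictly, as
  \<open>tail_square\<close> does. At \<open>t = 0\<close> the bound also serves for the full second
  moment.\<close>

lemma closed_tail_square_moment: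
  assumes "0 \<le> t"
  shows "integrable std_normal_measure (\<lambda>x. x\<^sup>2 * indicator {x. \<bar>x\<bar> \<ge> t} x)"
    and "(\<integral>x. x\<^sup>2 * indicator {x. \<bar>x\<bar> \<ge> t} x \<partial>std_normal_measure) \<le> 16 * exp (- t\<^sup>2 / 4)"
proof -
  have le: "x\<^sup>2 * indicator {x. \<bar>x\<bar> \<ge> t} x \<le> 8 * exp (- t\<^sup>2 / 4) * exp (3/8 * x\<^sup>2)" for x
  proof (cases "\<bar>x\<bar> \<ge> t")
    case True
    have "t\<^sup>2 \<le> x\<^sup>2" using True assms by (metis power2_abs power_mono)
    then have e: "exp (x\<^sup>2 / 8) \<le> exp (- t\<^sup>2 / 4) * exp (3/8 * x\<^sup>2)"
      unfolding exp_add[symmetric] by simp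
    have "x\<^sup>2 \<le> 8 * exp (x\<^sup>2 / 8)" using exp_ge_add_one_self[of "x\<^sup>2 / 8"] by linarith
    then show ?thesis using e True by simp
  qed simp
  have "8 * exp (- t\<^sup>2 / 4) / sqrt (1 - 2 * (3/8)) = 16 * exp (- t\<^sup>2 / 4)"
    by (simp add: real_sqrt_divide)
  then show "(\<integral>x. x\<^sup>2 * indicator {x. \<bar>x\<bar> \<ge> t} x \<partial>std_normal_measure) \<le> 16 * exp (- t\<^sup>2 / 4)"
    using integrable_std_normal_leI(2)[OF _ _ le] by simp
  show "integrable std_normal_measure (\<lambda>x. x\<^sup>2 * indicator {x. \<bar>x\<bar> \<ge> t} x)"
    using integrable_std_normal_leI(1)[OF _ _ le] by simp
qed

lemma tail_square_moment:
  assumes "0 \<le> t"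
  shows "integrable std_normal_measure (tail_square t)"
    and "(\<integral>x. tail_square t x \<partial>std_normal_measure) \<le> 16 * exp (- t\<^sup>2 / 4)"
proof -
  have le: "tail_square t x \<le> x\<^sup>2 * indicator {x. \<bar>x\<bar> \<ge> t} x" for x
    by (simp add: tail_square_def)
  have nrm: "norm (tail_square t x) \<le> norm (x\<^sup>2 * indicator {x. \<bar>x\<bar> \<ge> t} x)" for x
    using le[of x] by (simp add: tail_square_nonneg)
  show i: "integrable std_normal_measure (tail_square t)"
    by (rule Bochner_Integration.integrable_bound[OF closed_tail_square_moment(1)[OF assms] _ AE_I2[OF nrm]]) simp
  show "(\<integral>x. tail_square t x \<partial>std_normal_measure) \<le> 16 * exp (- t\<^sup>2 / 4)"
    using integral_mono[OF i closed_tail_square_moment(1)[OF assms] le] closed_tail_square_moment(2)[OF assms] by linarith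
qed

text \<open>The two truncations differ only on a shell \<open>A\<close> of relative width
  \<open>e\<close> around \<tau>, which gives an error linear in \<open>e\<close>. The exponent 1/18
  is the one needed later: \<open>\<tau>^2 \<ge> 9 * L\<close> turns the factor into
  \<open>exp (- L / 2)\<close>.\<close>

lemma tail_square_moment_perturbation:
  assumes "0 \<le> \<tau>" "0 \<le> e" "e \<le> 1/4" "\<bar>r - 1\<bar> \<le> e"
  shows "\<bar>(\<integral>x. tail_square (r * \<tau>) x \<partial>std_normal_measure) - (\<integral>x. x\<^sup>2 * indicator {x. \<bar>x\<bar> \<ge> \<tau>} x \<partial>std_normal_measure)\<bar>
    \<le> 48 * e * exp (- \<tau>\<^sup>2 / 18)"
proof -
  define lo where "lo = (1 - e) * \<tau>"
  define hi where "hi = (1 + e) * \<tau>"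
  define A where "A = {-hi..-lo} \<union> {lo..hi}"
  have rt: "(1 - e) * \<tau> \<le> r * \<tau>" "r * \<tau> \<le> (1 + e) * \<tau>" "(1 - e) * \<tau> \<le> \<tau>" "\<tau> \<le> (1 + e) * \<tau>"
    using assms mult_right_mono[of "1 - e" r \<tau>] mult_right_mono[of r "1 + e" \<tau>]
      mult_right_mono[of "1 - e" 1 \<tau>] mult_right_mono[of 1 "1 + e" \<tau>] by auto
  have tail: "\<bar>tail_square t x - x\<^sup>2 * indicator {x. \<bar>x\<bar> \<ge> \<tau>} x\<bar> \<le> x\<^sup>2 * indicator A x"
    if "lo \<le> t" "t \<le> hi" "lo \<le> \<tau>" "\<tau> \<le> hi" for t x
  proof (cases "x \<in> A")
    case False
    then have "\<bar>x\<bar> < lo \<or> hi < \<bar>x\<bar>" by (auto simp: A_def)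
    then have "(\<bar>x\<bar> > t) = (\<bar>x\<bar> \<ge> \<tau>)" using that by auto
    then show ?thesis by (simp add: tail_square_def)
  qed (simp add: tail_square_def split: split_indicator)
  have diff: "\<bar>tail_square (r * \<tau>) x - x\<^sup>2 * indicator {x. \<bar>x\<bar> \<ge> \<tau>} x\<bar> \<le> x\<^sup>2 * indicator A x" for x
    using rt by (intro tail) (auto simp: lo_def hi_def)
  have A[measurable]: "A \<in> sets borel" unfolding A_def by measurable
  have le: "lo \<le> hi" using rt by (simp add: lo_def hi_def)
  have emA: "emeasure lborel A \<le> ennreal (4 * e * \<tau>)"
  proof -
    have "emeasure lborel A \<le> emeasure lborel {-hi..-lo} + emeasure lborel {lo..hi}"
      unfolding A_def by (rule emeasure_subadditive) auto
    also have "\<dots> = ennreal (4 * e * \<tau>)" using le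
      by (simp add: ennreal_plus[symmetric] del: ennreal_plus) (simp add: lo_def hi_def algebra_simps)
    finally show ?thesis .
  qed
  have r0: "0 \<le> r * \<tau>" using assms by auto
  \<comment> \<open>\<open>e \<le> 1/4\<close> keeps the shell beyond \<open>3/4 * \<tau>\<close>,
    so \<open>x^2 / 4\<close> is at least \<open>9 * \<tau>^2 / 64\<close> there.\<close>
  have pt: "std_normal_density x * (x\<^sup>2 * indicator A x) \<le> 4 * exp (- 9 * \<tau>\<^sup>2 / 64) * indicator A x" for x
  proof (cases "x \<in> A")
    case True
    have "3/4 * \<tau> \<le> (1 - e) * \<tau>" using assms by (intro mult_right_mono) auto
    moreover have "(1 - e) * \<tau> \<le> \<bar>x\<bar>" using True unfolding A_def lo_def[symmetric] by auto
    ultimately have "3/4 * \<tau> \<le> \<bar>x\<bar>" by linarith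
    then have "(3/4 * \<tau>)\<^sup>2 \<le> \<bar>x\<bar>\<^sup>2" using assms by (intro power_mono) auto
    then have x2: "9/16 * \<tau>\<^sup>2 \<le> x\<^sup>2" by (simp add: power_mult_distrib power_divide)
    have "std_normal_density x \<le> 1 * exp (- x\<^sup>2 / 2)"
    proof -
      have "1 \<le> sqrt (2 * pi)" using pi_gt3 by (intro real_le_rsqrt) auto
      then show ?thesis unfolding std_normal_density_def by (intro mult_right_mono) auto
    qed
    moreover have "x\<^sup>2 \<le> 4 * exp (x\<^sup>2 / 4)" using exp_ge_add_one_self[of "x\<^sup>2 / 4"] by linarith
    ultimately have "std_normal_density x * x\<^sup>2 \<le> exp (- x\<^sup>2 / 2) * (4 * exp (x\<^sup>2 / 4))"
      by (intro mult_mono) auto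
    also have "\<dots> = 4 * exp (- x\<^sup>2 / 4)" by (simp add: exp_add[symmetric])
    also have "\<dots> \<le> 4 * exp (- 9 * \<tau>\<^sup>2 / 64)" using x2 by simp
    finally show ?thesis using True by simp
  qed simp
  have i1: "integrable std_normal_measure (\<lambda>x. x\<^sup>2 * indicator A x)"
  proof (rule Bochner_Integration.integrable_bound[OF closed_tail_square_moment(1)[of 0]])
    show "AE x in std_normal_measure. norm (x\<^sup>2 * indicator A x) \<le> norm (x\<^sup>2 * indicator {x. \<bar>x\<bar> \<ge> (0::real)} x)"
      by (intro AE_I2) (auto split: split_indicator)
  qed auto
  have "\<bar>(\<integral>x. tail_square (r * \<tau>) x \<partial>std_normal_measure) - (\<integral>x. x\<^sup>2 * indicator {x. \<bar>x\<bar> \<ge> \<tau>} x \<partial>std_normal_measure)\<bar>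
    = \<bar>\<integral>x. tail_square (r * \<tau>) x - x\<^sup>2 * indicator {x. \<bar>x\<bar> \<ge> \<tau>} x \<partial>std_normal_measure\<bar>"
    using tail_square_moment(1)[OF r0] closed_tail_square_moment(1)[OF assms(1)] by simp
  also have "\<dots> \<le> (\<integral>x. \<bar>tail_square (r * \<tau>) x - x\<^sup>2 * indicator {x. \<bar>x\<bar> \<ge> \<tau>} x\<bar> \<partial>std_normal_measure)"
    by (rule integral_abs_bound)
  also have "\<dots> \<le> (\<integral>x. x\<^sup>2 * indicator A x \<partial>std_normal_measure)"
    using tail_square_moment(1)[OF r0] closed_tail_square_moment(1)[OF assms(1)] i1 diff
    by (intro integral_mono) auto
  also have "\<dots> \<le> 4 * exp (- 9 * \<tau>\<^sup>2 / 64) * (4 * e * \<tau>)"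
  proof -
    have "ennreal (\<integral>x. x\<^sup>2 * indicator A x \<partial>std_normal_measure) = (\<integral>\<^sup>+x. ennreal (x\<^sup>2 * indicator A x) \<partial>std_normal_measure)"
      using i1 by (intro nn_integral_eq_integral[symmetric]) auto
    also have "\<dots> = (\<integral>\<^sup>+x. ennreal (std_normal_density x * (x\<^sup>2 * indicator A x)) \<partial>lborel)"
      by (subst nn_integral_std_normal) (auto simp: ennreal_mult[symmetric])
    also have "\<dots> \<le> (\<integral>\<^sup>+x. ennreal (4 * exp (- 9 * \<tau>\<^sup>2 / 64)) * indicator A x \<partial>lborel)"
    proof (rule nn_integral_mono)
      fix x
      show "ennreal (std_normal_density x * (x\<^sup>2 * indicator A x)) \<le> ennreal (4 * exp (- 9 * \<tau>\<^sup>2 / 64)) * indicator A x"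
        using pt[of x] by (cases "x \<in> A") auto
    qed
    also have "\<dots> = ennreal (4 * exp (- 9 * \<tau>\<^sup>2 / 64)) * emeasure lborel A"
      by (rule nn_integral_cmult_indicator) simp
    also have "\<dots> \<le> ennreal (4 * exp (- 9 * \<tau>\<^sup>2 / 64)) * ennreal (4 * e * \<tau>)"
      using emA by (intro mult_left_mono) auto
    also have "\<dots> = ennreal (4 * exp (- 9 * \<tau>\<^sup>2 / 64) * (4 * e * \<tau>))"
      using assms by (intro ennreal_mult[symmetric]) auto
    finally show ?thesis using assms by (subst (asm) ennreal_le_iff) auto
  qed
  also have "\<dots> = 16 * e * (\<tau> * exp (- 9 * \<tau>\<^sup>2 / 64))" by simp
  also have "\<dots> \<le> 16 * e * (3 * exp (- \<tau>\<^sup>2 / 18))"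
  proof (rule mult_left_mono)
    \<comment> \<open>The factor \<tau> from the length of the shell is absorbed by part of the
      exponent: \<open>9/64 - 1/32 = 7/64\<close> is still larger than 1/18.\<close>
    have "\<tau> \<le> 3 * (1 + \<tau>\<^sup>2 / 32)"
      using zero_le_power2[of "\<tau> - 6"] zero_le_power2[of "\<tau> / 4 - 4/3"] by (simp add: power2_eq_square algebra_simps)
    also have "\<dots> \<le> 3 * exp (\<tau>\<^sup>2 / 32)" by (intro mult_left_mono exp_ge_add_one_self) auto
    finally have "\<tau> * exp (- 9 * \<tau>\<^sup>2 / 64) \<le> 3 * exp (\<tau>\<^sup>2 / 32) * exp (- 9 * \<tau>\<^sup>2 / 64)"
      by (intro mult_right_mono) auto
    also have "\<dots> = 3 * exp (\<tau>\<^sup>2 / 32 + - 9 * \<tau>\<^sup>2 / 64)" unfolding exp_add by simp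
    also have "\<dots> \<le> 3 * exp (- \<tau>\<^sup>2 / 18)" by simp
    finally show "\<tau> * exp (- 9 * \<tau>\<^sup>2 / 64) \<le> 3 * exp (- \<tau>\<^sup>2 / 18)" .
  qed (use assms in auto)
  finally show ?thesis by simp
qed

section \<open>The estimator on a typical sample\<close>

text \<open>One of the two factors \<open>\<bar>sqrt \<bar>p\<bar> - sqrt q\<bar>\<close> is bounded
  by the sum of the roots. This converts an error in the squared norm into a squared error of the
  norm, also when \<open>Q_hat\<close> is negative.\<close>

lemma abs_sqrt_diff_square_le:
  fixes p q :: real
  assumes "0 \<le> q"
  shows "(sqrt \<bar>p\<bar> - sqrt q)\<^sup>2 \<le> \<bar>p - q\<bar>"
proof -
  let ?u = "sqrt \<bar>p\<bar>" and ?v = "sqrt q"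
  have "\<bar>?u - ?v\<bar> * \<bar>?u - ?v\<bar> \<le> \<bar>?u - ?v\<bar> * (?u + ?v)"
    using assms real_sqrt_ge_zero[of "\<bar>p\<bar>"] real_sqrt_ge_zero[OF assms] by (intro mult_left_mono) linarith+
  also have "\<dots> = \<bar>(?u - ?v) * (?u + ?v)\<bar>" using assms by (simp add: abs_mult)
  also have "(?u - ?v) * (?u + ?v) = \<bar>p\<bar> - q" using assms by (simp add: algebra_simps)
  also have "\<bar>\<bar>p\<bar> - q\<bar> \<le> \<bar>p - q\<bar>" using assms by linarith
  finally show ?thesis by (simp add: power2_eq_square)
qed

lemma norm_diff_square_le:
  fixes \<theta> \<xi> :: "nat \<Rightarrow> real"
  shows "(sqrt (\<Sum>i\<in>S. (\<theta> i + \<xi> i)\<^sup>2) - sqrt (\<Sum>i\<in>S. (\<theta> i)\<^sup>2))\<^sup>2 \<le> (\<Sum>i\<in>S. (\<xi> i)\<^sup>2)"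
proof -
  have "L2_set (\<lambda>i. \<theta> i + \<xi> i) S \<le> L2_set \<theta> S + L2_set \<xi> S" by (rule L2_set_triangle_ineq)
  moreover have "L2_set \<theta> S \<le> L2_set (\<lambda>i. \<theta> i + \<xi> i) S + L2_set \<xi> S"
    using L2_set_triangle_ineq[of "\<lambda>i. \<theta> i + \<xi> i" "\<lambda>i. - \<xi> i" S] by (simp add: L2_set_def)
  ultimately have "\<bar>L2_set (\<lambda>i. \<theta> i + \<xi> i) S - L2_set \<theta> S\<bar> \<le> L2_set \<xi> S" by linarith
  then have "\<bar>L2_set (\<lambda>i. \<theta> i + \<xi> i) S - L2_set \<theta> S\<bar>\<^sup>2 \<le> (L2_set \<xi> S)\<^sup>2" by (intro power_mono) auto
  then show ?thesis by (simp add: L2_set_def sum_nonneg)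
qed

text \<open>Everything in this context is deterministic: \<open>x\<close> is one realization of the
  standardized noise. The condition \<open>4 * s \<le> d\<close> encodes \<alpha> = 1/4.\<close>

locale thresholding =
  fixes \<eta> :: real and d s :: nat and \<sigma> F :: real and sig2 \<theta> x :: "nat \<Rightarrow> real"
  assumes eta: "0 < \<eta>" "\<eta> < 1" and sigma: "0 < \<sigma>" and s1: "1 \<le> s" and sd: "4 * real s \<le> real d"
    and sF: "real s \<le> F" and sig2_pos: "\<And>i. i < d \<Longrightarrow> 0 < sig2 i" and sig2_le: "\<And>i. i < d \<Longrightarrow> sig2 i \<le> 1"
    and sparse: "card {i\<in>{..<d}. \<theta> i \<noteq> 0} \<le> s"
begin

abbreviation "qlo \<equiv> chi1_quantile (\<eta>/20)"
abbreviation "qhi \<equiv> chi1_quantile (1 - \<eta>/20)"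
abbreviation "qmed \<equiv> chi1_quantile (1/2)"

definition S :: "nat set" where "S = {i\<in>{..<d}. \<theta> i \<noteq> 0}"
definition Y :: "nat \<Rightarrow> real" where "Y i = \<theta> i + \<sigma> * (sqrt (sig2 i) * x i)"
definition L :: real where "L = ln (1 + F\<^sup>2 / (real s)\<^sup>2)"
definition count :: "real \<Rightarrow> real" where "count u = (\<Sum>i<d. if (x i)\<^sup>2 \<le> u then 1 else 0)"
definition R2 :: real where "R2 = sigmaS2_hat d sig2 Y / \<sigma>\<^sup>2"
definition r :: real where
  "r = max (sqrt (sigmaS2_hat d sig2 Y)) (sqrt (sigma_eta2_hat \<eta> d sig2 Y)) / \<sigma>"
text \<open>The threshold is an argument because the random one, \<open>r * tau\<close>, has to be
  compared with deterministic ones.\<close>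

definition H :: "real \<Rightarrow> real" where "H t = (\<Sum>i\<in>{..<d} - S. sig2 i * tail_square t (x i))"

lemma quantiles: "0 < qlo" "qlo < qmed" "qmed < qhi" "0 < qhi" "0 < qmed"
  using eta by (auto intro!: chi1_quantile_props chi1_quantile_strict_mono)

lemma s_pos: "0 < real s" and d_pos: "0 < real d" and F_pos: "0 < F"
  using s1 sd sF by linarith+

lemma S_subset: "S \<subseteq> {..<d}" and card_S: "real (card S) \<le> real s"
  using sparse by (auto simp: S_def)

lemma theta_not_S: "i < d \<Longrightarrow> i \<notin> S \<Longrightarrow> \<theta> i = 0"
  by (auto simp: S_def)

lemma ratio_ge_1: "1 \<le> F\<^sup>2 / (real s)\<^sup>2"
  using sF s_pos by simp

lemma L_ge: "1/2 \<le> L"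
proof -
  have "1/2 \<le> ln (2::real)" using ln_le_minus_one[of "1/2"] by (simp add: ln_div)
  also have "\<dots> \<le> L" unfolding L_def using ratio_ge_1 by (intro ln_mono) auto
  finally show ?thesis .
qed

text \<open>\<open>exp L = 1 + F^2 / s^2\<close>. These bounds turn Gaussian tails beyond multiples
  of \<open>sqrt L\<close> into powers of \<open>s / F\<close>.\<close>

lemma exp_neg_half_L: "exp (- L / 2) \<le> real s / F" and exp_neg_L: "exp (- L) \<le> (real s / F)\<^sup>2"
proof -
  have "exp L = 1 + F\<^sup>2 / (real s)\<^sup>2" unfolding L_def using ratio_ge_1 by (intro exp_ln) linarith
  then have "(F / real s)\<^sup>2 \<le> exp L" by (simp add: power_divide)
  then have "inverse (exp L) \<le> inverse ((F / real s)\<^sup>2)" using F_pos s_pos by (intro le_imp_inverse_le) auto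
  then show l: "exp (- L) \<le> (real s / F)\<^sup>2" by (simp add: exp_minus power_divide)
  have "(exp (- L / 2))\<^sup>2 = exp (- L)" by (simp add: exp_double[symmetric])
  with l show "exp (- L / 2) \<le> real s / F"
    using F_pos s_pos power2_le_imp_le[of "exp (- L / 2)" "real s / F"] by simp
qed

lemma tau_eq: "tau \<eta> s F = 3 * sqrt (qhi / qlo * L)"
  by (simp add: tau_def L_def)

lemma tau_nonneg: "0 \<le> tau \<eta> s F" and tau_square: "(tau \<eta> s F)\<^sup>2 = 9 * (qhi / qlo) * L"
  using L_ge quantiles by (simp_all add: tau_eq power_mult_distrib)

lemma tau_square_ge: "9 * L \<le> (tau \<eta> s F)\<^sup>2"
proof -
  have "9 * L * 1 \<le> 9 * L * (qhi / qlo)" using L_ge quantiles by (intro mult_left_mono) auto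
  then show ?thesis unfolding tau_square by (simp add: mult.commute mult.left_commute)
qed

lemma alpha_bounds: "0 \<le> alpha_se \<eta> s F" "alpha_se \<eta> s F \<le> 16 * (real s / F)"
proof -
  show "0 \<le> alpha_se \<eta> s F" unfolding alpha_se_def by (simp add: integral_nonneg_AE)
  have "exp (- (tau \<eta> s F)\<^sup>2 / 4) \<le> exp (- L / 2)" using tau_square_ge L_ge by simp
  then show "alpha_se \<eta> s F \<le> 16 * (real s / F)"
    unfolding alpha_se_def using closed_tail_square_moment(2)[OF tau_nonneg] exp_neg_half_L by linarith
qed

lemma Y_scaled: "i < d \<Longrightarrow> i \<notin> S \<Longrightarrow> (Y i / sqrt (sig2 i))\<^sup>2 = \<sigma>\<^sup>2 * (x i)\<^sup>2"
  using sig2_pos[of i] by (simp add: Y_def theta_not_S power_mult_distrib)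

lemma Fhat_eq_sum: "real d * Fhat d sig2 Y t = (\<Sum>i<d. if (Y i / sqrt (sig2 i))\<^sup>2 \<le> t then 1 else 0)"
  using d_pos by (simp add: Fhat_def sum.If_cases Int_def)

text \<open>Off the support the normalized squares are exactly \<open>\<sigma>^2 * (x i)^2\<close>,
  so only the at most \<open>s\<close> indicators on the support can change.\<close>

lemma Fhat_count: "\<bar>real d * Fhat d sig2 Y t - count (t / \<sigma>\<^sup>2)\<bar> \<le> real s"
proof -
  let ?f = "\<lambda>i. (if (Y i / sqrt (sig2 i))\<^sup>2 \<le> t then 1 else 0) - (if (x i)\<^sup>2 \<le> t / \<sigma>\<^sup>2 then 1 else 0 :: real)"
  have "real d * Fhat d sig2 Y t - count (t / \<sigma>\<^sup>2) = (\<Sum>i<d. ?f i)"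
    by (simp add: Fhat_eq_sum count_def sum_subtractf)
  also have "\<dots> = (\<Sum>i\<in>S. ?f i)"
  proof (rule sum.mono_neutral_right)
    have "?f i = 0" if "i < d" "i \<notin> S" for i
      unfolding Y_scaled[OF that] using sigma by (simp add: field_simps)
    then show "\<forall>i\<in>{..<d} - S. ?f i = 0" by auto
  qed (use S_subset in auto)
  finally have "\<bar>real d * Fhat d sig2 Y t - count (t / \<sigma>\<^sup>2)\<bar> \<le> (\<Sum>i\<in>S. \<bar>?f i\<bar>)" by (simp add: sum_abs)
  also have "\<dots> \<le> (\<Sum>i\<in>S. 1)" by (intro sum_mono) auto
  finally show ?thesis using card_S by simp
qed

lemma H_antimono: "t \<le> t' \<Longrightarrow> H t' \<le> H t"
  unfolding H_def by (intro sum_mono mult_left_mono tail_square_antimono) (auto intro: less_imp_le[OF sig2_pos])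

lemma H_nonneg: "0 \<le> H t"
  unfolding H_def by (intro sum_nonneg mult_nonneg_nonneg tail_square_nonneg) (auto intro: less_imp_le[OF sig2_pos])

text \<open>The comparison passes through \<open>sqrt P\<close>, the norm of the observations on the
  support. From there to the norm of \<theta> the triangle inequality is used, so no cross term
  between signal and noise appears and the bound is free of the size of \<theta>.\<close>

lemma N_hat_error:
  assumes r0: "0 \<le> r"
  shows "(N_hat \<eta> d s sig2 F Y - sqrt (\<Sum>i<d. (\<theta> i)\<^sup>2))\<^sup>2 \<le> \<sigma>\<^sup>2 *
     (2 * (real s * (r\<^sup>2 * (tau \<eta> s F)\<^sup>2) +
       \<bar>H (r * tau \<eta> s F) - R2 * alpha_se \<eta> s F * (\<Sum>i<d. sig2 i)\<bar>) +
      2 * (\<Sum>i\<in>S. sig2 i * (x i)\<^sup>2))"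
proof -
  let ?t = "tau \<eta> s F"
  let ?m = "max (sqrt (sigmaS2_hat d sig2 Y)) (sqrt (sigma_eta2_hat \<eta> d sig2 Y))"
  have m: "?m = \<sigma> * r" using sigma by (simp add: r_def)
  have sS: "sigmaS2_hat d sig2 Y = \<sigma>\<^sup>2 * R2" using sigma by (simp add: R2_def)
  define f where "f i = (Y i)\<^sup>2 * (if \<bar>Y i\<bar> > ?m * sqrt (sig2 i) * ?t then 1 else 0)" for i
  define P where "P = (\<Sum>i\<in>S. (Y i)\<^sup>2)"
  have th: "sqrt (\<Sum>i<d. (\<theta> i)\<^sup>2) = sqrt (\<Sum>i\<in>S. (\<theta> i)\<^sup>2)"
    using S_subset theta_not_S by (intro arg_cong[where f = sqrt] sum.mono_neutral_right) auto
  have out: "f i = \<sigma>\<^sup>2 * (sig2 i * tail_square (r * ?t) (x i))" if "i < d" "i \<notin> S" for i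
  proof -
    have Yi: "Y i = \<sigma> * sqrt (sig2 i) * x i" using theta_not_S[OF that] by (simp add: Y_def)
    have pos: "0 < \<sigma> * sqrt (sig2 i)" using sigma sig2_pos[OF that(1)] by simp
    have "\<bar>Y i\<bar> = \<sigma> * sqrt (sig2 i) * \<bar>x i\<bar>" using pos unfolding Yi by (subst abs_mult) simp
    moreover have "?m * sqrt (sig2 i) * ?t = \<sigma> * sqrt (sig2 i) * (r * ?t)" unfolding m by simp
    ultimately have "(\<bar>Y i\<bar> > ?m * sqrt (sig2 i) * ?t) = (\<bar>x i\<bar> > r * ?t)"
      using pos by (simp only: mult_less_cancel_left_pos)
    moreover have "(Y i)\<^sup>2 = \<sigma>\<^sup>2 * sig2 i * (x i)\<^sup>2"
      using sig2_pos[OF that(1)] by (simp add: Yi power_mult_distrib)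
    ultimately show ?thesis by (simp add: f_def tail_square_def)
  qed
  have "(\<Sum>i<d. f i) = (\<Sum>i\<in>S. f i) + (\<Sum>i\<in>{..<d} - S. f i)"
    using S_subset by (simp add: sum.subset_diff add.commute)
  also have "(\<Sum>i\<in>{..<d} - S. f i) = \<sigma>\<^sup>2 * H (r * ?t)"
    unfolding H_def sum_distrib_left by (intro sum.cong refl out) auto
  finally have sum_f: "(\<Sum>i<d. f i) = (\<Sum>i\<in>S. f i) + \<sigma>\<^sup>2 * H (r * ?t)" .
  have "Q_hat \<eta> d s sig2 F Y = (\<Sum>i<d. f i) - sigmaS2_hat d sig2 Y * alpha_se \<eta> s F * (\<Sum>i<d. sig2 i)"
    unfolding Q_hat_def f_def ..
  then have Q: "Q_hat \<eta> d s sig2 F Y - P = ((\<Sum>i\<in>S. f i) - P) +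
     \<sigma>\<^sup>2 * (H (r * ?t) - R2 * alpha_se \<eta> s F * (\<Sum>i<d. sig2 i))"
    unfolding sum_f sS by (simp add: algebra_simps)
  \<comment> \<open>A coordinate kept by the threshold contributes no error; a discarded one loses
    at most the squared threshold.\<close>
  have inS: "\<bar>f i - (Y i)\<^sup>2\<bar> \<le> \<sigma>\<^sup>2 * (r\<^sup>2 * ?t\<^sup>2)" if "i \<in> S" for i
  proof (cases "\<bar>Y i\<bar> > ?m * sqrt (sig2 i) * ?t")
    case False
    have i: "i < d" using that S_subset by auto
    have "\<bar>Y i\<bar> \<le> ?m * sqrt (sig2 i) * ?t" using False by simp
    also have "\<dots> \<le> \<sigma> * r * 1 * ?t"
      unfolding m using sig2_le[OF i] sig2_pos[OF i] sigma r0 tau_nonneg by (intro mult_mono) auto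
    finally have "\<bar>Y i\<bar>\<^sup>2 \<le> (\<sigma> * r * 1 * ?t)\<^sup>2" by (intro power_mono) auto
    then show ?thesis using False by (simp add: f_def power_mult_distrib ac_simps)
  qed (simp add: f_def)
  have "\<bar>(\<Sum>i\<in>S. f i) - P\<bar> \<le> (\<Sum>i\<in>S. \<bar>f i - (Y i)\<^sup>2\<bar>)"
    unfolding P_def sum_subtractf[symmetric] by (rule sum_abs)
  also have "\<dots> \<le> real (card S) * (\<sigma>\<^sup>2 * (r\<^sup>2 * ?t\<^sup>2))"
    using sum_mono[OF inS] by simp
  also have "\<dots> \<le> real s * (\<sigma>\<^sup>2 * (r\<^sup>2 * ?t\<^sup>2))" using card_S by (intro mult_right_mono) auto
  finally have "\<bar>Q_hat \<eta> d s sig2 F Y - P\<bar> \<le> real s * (\<sigma>\<^sup>2 * (r\<^sup>2 * ?t\<^sup>2)) +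
     \<bar>\<sigma>\<^sup>2 * (H (r * ?t) - R2 * alpha_se \<eta> s F * (\<Sum>i<d. sig2 i))\<bar>"
    unfolding Q by linarith
  also have "\<dots> = \<sigma>\<^sup>2 * (real s * (r\<^sup>2 * ?t\<^sup>2) + \<bar>H (r * ?t) - R2 * alpha_se \<eta> s F * (\<Sum>i<d. sig2 i)\<bar>)"
    by (simp add: abs_mult distrib_left)
  finally have QP: "\<bar>Q_hat \<eta> d s sig2 F Y - P\<bar> \<le>
     \<sigma>\<^sup>2 * (real s * (r\<^sup>2 * ?t\<^sup>2) + \<bar>H (r * ?t) - R2 * alpha_se \<eta> s F * (\<Sum>i<d. sig2 i)\<bar>)" .
  have P0: "0 \<le> P" by (simp add: P_def sum_nonneg)
  let ?p = "N_hat \<eta> d s sig2 F Y - sqrt P" and ?q = "sqrt P - sqrt (\<Sum>i\<in>S. (\<theta> i)\<^sup>2)"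
  have p: "?p\<^sup>2 \<le> \<bar>Q_hat \<eta> d s sig2 F Y - P\<bar>" unfolding N_hat_def by (rule abs_sqrt_diff_square_le[OF P0])
  have "?q\<^sup>2 \<le> (\<Sum>i\<in>S. (\<sigma> * (sqrt (sig2 i) * x i))\<^sup>2)" unfolding P_def Y_def by (rule norm_diff_square_le)
  also have "\<dots> = \<sigma>\<^sup>2 * (\<Sum>i\<in>S. sig2 i * (x i)\<^sup>2)"
    unfolding sum_distrib_left using S_subset
    by (intro sum.cong refl) (auto simp: power_mult_distrib less_imp_le[OF sig2_pos])
  finally have q: "?q\<^sup>2 \<le> \<sigma>\<^sup>2 * (\<Sum>i\<in>S. sig2 i * (x i)\<^sup>2)" .
  have "(N_hat \<eta> d s sig2 F Y - sqrt (\<Sum>i<d. (\<theta> i)\<^sup>2))\<^sup>2 = (?p + ?q)\<^sup>2" unfolding th by simp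
  also have "\<dots> \<le> 2 * ?p\<^sup>2 + 2 * ?q\<^sup>2" using sum_squares_bound[of ?p ?q] unfolding power2_sum by linarith
  also have "\<dots> \<le> 2 * (\<sigma>\<^sup>2 * (real s * (r\<^sup>2 * ?t\<^sup>2) + \<bar>H (r * ?t) - R2 * alpha_se \<eta> s F * (\<Sum>i<d. sig2 i)\<bar>)) +
     2 * (\<sigma>\<^sup>2 * (\<Sum>i\<in>S. sig2 i * (x i)\<^sup>2))"
    using p q QP by linarith
  finally show ?thesis by (simp add: algebra_simps)
qed

end

section \<open>Location of the scale estimators on a sample with controlled tails\<close>

locale thresholding_median = thresholding +
  assumes few_small: "4 * (\<Sum>i<d. if (x i)\<^sup>2 \<le> qlo then 1 else 0) < real d"
    and few_large: "4 * (\<Sum>i<d. if (x i)\<^sup>2 > qhi then 1 else 0) < real d"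
begin

text \<open>Fewer than \<open>d / 4\<close> noise values lie below \<open>qlo\<close>, and the
  signal adds at most \<open>s \<le> d / 4\<close> more; together this stays below one half.\<close>

lemma Fhat_small:
  assumes "t < \<sigma>\<^sup>2 * qlo"
  shows "Fhat d sig2 Y t < 1/2"
proof -
  have "t / \<sigma>\<^sup>2 \<le> qlo" using assms sigma by (simp add: field_simps)
  then have "count (t / \<sigma>\<^sup>2) \<le> (\<Sum>i<d. if (x i)\<^sup>2 \<le> qlo then 1 else 0)"
    unfolding count_def by (intro sum_mono) auto
  then have "real d * Fhat d sig2 Y t < real d * (1/2)"
    using Fhat_count[of t] few_small sd by linarith
  then show ?thesis using d_pos by (simp only: mult_less_cancel_left_pos)
qed

lemma Fhat_large:
  assumes "\<sigma>\<^sup>2 * qhi \<le> t"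
  shows "1/2 \<le> Fhat d sig2 Y t"
proof -
  have le: "qhi \<le> t / \<sigma>\<^sup>2" using assms sigma by (simp add: field_simps)
  have "real d = (\<Sum>i<d. 1)" by simp
  also have "\<dots> \<le> (\<Sum>i<d. (if (x i)\<^sup>2 \<le> t / \<sigma>\<^sup>2 then 1 else 0) + (if (x i)\<^sup>2 > qhi then 1 else 0))"
    using le by (intro sum_mono) auto
  also have "\<dots> = count (t / \<sigma>\<^sup>2) + (\<Sum>i<d. if (x i)\<^sup>2 > qhi then 1 else 0)"
    by (simp add: count_def sum.distrib)
  finally have "real d * (1/2) \<le> real d * Fhat d sig2 Y t"
    using Fhat_count[of t] few_large sd by linarith
  then show ?thesis using d_pos by (simp only: mult_le_cancel_left_pos)
qed

lemma M_hat_ge: "\<sigma>\<^sup>2 * qlo \<le> M_hat d sig2 Y" and M_hat_le: "1/2 \<le> Fhat d sig2 Y t \<Longrightarrow> M_hat d sig2 Y \<le> t"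
proof -
  have lb: "\<sigma>\<^sup>2 * qlo \<le> t" if "1/2 \<le> Fhat d sig2 Y t" for t
    using Fhat_small[of t] that by linarith
  show "\<sigma>\<^sup>2 * qlo \<le> M_hat d sig2 Y" unfolding M_hat_def
    using Fhat_large[OF order_refl] lb by (intro cInf_greatest) auto
  show "M_hat d sig2 Y \<le> t" if "1/2 \<le> Fhat d sig2 Y t"
    unfolding M_hat_def using lb that by (intro cInf_lower bdd_belowI[of _ "\<sigma>\<^sup>2 * qlo"]) auto
qed

text \<open>The admissible exponents are bounded below, so the infimum is attained at a least
  exponent. The exponent before it is inadmissible, hence its power lies below
  \<open>\<sigma>^2 * qhi\<close>; this is the origin of the factor 2.\<close>

lemma t_hat_dyadic:
  obtains l :: int where "t_hat d sig2 Y = 2 powr l" "1/2 \<le> Fhat d sig2 Y (2 powr l)"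
    "\<sigma>\<^sup>2 * qlo \<le> 2 powr l" "2 powr l \<le> 2 * \<sigma>\<^sup>2 * qhi"
proof -
  define P where "P l = (1/2 \<le> Fhat d sig2 Y (2 powr real_of_int l))" for l
  \<comment> \<open>An integer lower bound for all admissible exponents, from which the minimum can
    be searched over the naturals with \<open>LEAST\<close>.\<close>
  define l1 where "l1 = \<lfloor>log 2 (\<sigma>\<^sup>2 * qlo)\<rfloor>"
  have pos: "0 < \<sigma>\<^sup>2 * qlo" "0 < \<sigma>\<^sup>2 * qhi" using sigma quantiles by auto
  have lb: "\<sigma>\<^sup>2 * qlo \<le> 2 powr l" if "P l" for l :: int
    using Fhat_small[of "2 powr l"] that unfolding P_def by linarith
  have lb1: "l1 \<le> l" if "P l" for l
  proof -
    have "log 2 (\<sigma>\<^sup>2 * qlo) \<le> l" using lb[OF that] pos by (simp add: log_le_iff)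
    then show ?thesis unfolding l1_def by linarith
  qed
  have "2 powr (log 2 (\<sigma>\<^sup>2 * qhi)) \<le> 2 powr (real_of_int \<lceil>log 2 (\<sigma>\<^sup>2 * qhi)\<rceil>)"
    by (intro powr_mono) auto
  then have "P \<lceil>log 2 (\<sigma>\<^sup>2 * qhi)\<rceil>" unfolding P_def using pos by (intro Fhat_large) simp
  then have ex: "\<exists>n. P (l1 + int n)" using lb1 by (metis zle_iff_zadd)
  define n0 where "n0 = (LEAST n. P (l1 + int n))"
  define l0 where "l0 = l1 + int n0"
  have P0: "P l0" unfolding l0_def n0_def using ex by (rule LeastI_ex)
  have min: "l0 \<le> l" if Pl: "P l" for l
  proof -
    obtain n where n: "l = l1 + int n" using lb1[OF Pl] by (metis zle_iff_zadd)
    then have "n0 \<le> n" unfolding n0_def using Pl by (intro Least_le) simp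
    then show ?thesis by (simp add: l0_def n)
  qed
  have "\<not> P (l0 - 1)" using min[of "l0 - 1"] by linarith
  then have "2 powr (l0 - 1) < \<sigma>\<^sup>2 * qhi" using Fhat_large[of "2 powr (l0 - 1)"] unfolding P_def by linarith
  then have ub: "2 powr l0 \<le> 2 * \<sigma>\<^sup>2 * qhi" by (simp add: powr_diff)
  have "t_hat d sig2 Y = 2 powr l0" unfolding t_hat_def P_def[symmetric]
    using P0 min by (intro cInf_eq_minimum) (auto intro!: powr_mono)
  then show ?thesis using that[of l0] P0 lb[OF P0] ub by (simp add: P_def)
qed

lemma sigma_eta2_eq: "sigma_eta2_hat \<eta> d sig2 Y / \<sigma>\<^sup>2 = M_hat d sig2 Y / \<sigma>\<^sup>2 / qhi"
  by (simp add: sigma_eta2_hat_def)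

lemma r_square: "r\<^sup>2 = max R2 (M_hat d sig2 Y / \<sigma>\<^sup>2 / qhi)" and r_nonneg: "0 \<le> r"
  if "0 \<le> R2"
proof -
  have M: "0 \<le> M_hat d sig2 Y" using M_hat_ge sigma quantiles by (meson less_imp_le mult_nonneg_nonneg order_trans zero_le_power2)
  have r: "r = max (sqrt R2) (sqrt (M_hat d sig2 Y / \<sigma>\<^sup>2 / qhi))"
    unfolding r_def R2_def sigma_eta2_eq[symmetric] using sigma
    by (simp add: max_divide_distrib_right real_sqrt_divide)
  show "0 \<le> r" unfolding r using that by (simp add: le_max_iff_disj)
  show "r\<^sup>2 = max R2 (M_hat d sig2 Y / \<sigma>\<^sup>2 / qhi)"
    unfolding r using that M quantiles by (auto simp: max_def)
qed

text \<open>\<open>t_hat\<close> is random, but it is one of the dyadic points at which the counts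
  are controlled simultaneously. There the empirical c.d.f. has error
  \<open>(k * F + s) / d\<close>, and \<open>s \<le> F\<close>; dividing by
  \<open>\<sigma>^2\<close> reduces the claim to the ratio bound in the hypothesis on
  \<open>C\<close>.\<close>

lemma R2_bounds:
  assumes C: "0 < C" "\<And>u p x. qlo \<le> u \<Longrightarrow> u \<le> 2 * qhi \<Longrightarrow> 1/2 \<le> p \<Longrightarrow> \<bar>p - chi1_cdf u\<bar> \<le> x \<Longrightarrow>
       \<bar>real_of_ereal (ereal u / chi1_inv p) - 1\<bar> \<le> C * x"
    and dyadic: "\<And>l::int. \<sigma>\<^sup>2 * qlo \<le> 2 powr l \<Longrightarrow> 2 powr l \<le> 2 * \<sigma>\<^sup>2 * qhi \<Longrightarrow>
      \<bar>count (2 powr l / \<sigma>\<^sup>2) - real d * chi1_cdf (2 powr l / \<sigma>\<^sup>2)\<bar> \<le> k * F"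
  shows "0 \<le> R2" "R2 \<le> 2 * qhi / qmed" "\<bar>R2 - 1\<bar> \<le> C * ((k + 1) * F / real d)"
proof -
  obtain l :: int where l: "t_hat d sig2 Y = 2 powr l" "1/2 \<le> Fhat d sig2 Y (2 powr l)"
    "\<sigma>\<^sup>2 * qlo \<le> 2 powr l" "2 powr l \<le> 2 * \<sigma>\<^sup>2 * qhi" by (rule t_hat_dyadic)
  define u where "u = 2 powr l / \<sigma>\<^sup>2"
  define p where "p = Fhat d sig2 Y (2 powr l)"
  have p: "1/2 \<le> p" using l by (simp add: p_def)
  have t: "2 powr l = \<sigma>\<^sup>2 * u" using sigma by (simp add: u_def)
  have u: "qlo \<le> u" "u \<le> 2 * qhi" using l(3,4) sigma by (auto simp: u_def field_simps)
  have gp: "qmed \<le> chi1_quantile p" if "p < 1" using that p by (intro chi1_quantile_mono) auto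
  have sS: "sigmaS2_hat d sig2 Y = real_of_ereal (ereal (\<sigma>\<^sup>2 * u) / chi1_inv p)"
    unfolding sigmaS2_hat_def sigmaS2_fun_def l(1) p_def[symmetric] using p by (simp add: t)
  have R: "R2 = (if 1 \<le> p then 0 else u / chi1_quantile p)"
    unfolding R2_def sS using gp quantiles sigma by (auto simp: chi1_inv_def)
  have R': "R2 = real_of_ereal (ereal u / chi1_inv p)"
    unfolding R using gp quantiles by (auto simp: chi1_inv_def)
  show "0 \<le> R2" unfolding R using gp u quantiles by (auto intro!: divide_nonneg_nonneg)
  show "R2 \<le> 2 * qhi / qmed" unfolding R using gp u quantiles by (auto intro!: frac_le)
  have "\<bar>real d * p - real d * chi1_cdf u\<bar> \<le> k * F + F"
    using Fhat_count[of "2 powr l"] dyadic[OF l(3,4)] sF unfolding p_def[symmetric] u_def[symmetric] by linarith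
  then have "real d * \<bar>p - chi1_cdf u\<bar> \<le> (k + 1) * F"
    unfolding right_diff_distrib[symmetric] abs_mult by (simp add: algebra_simps)
  then have "\<bar>p - chi1_cdf u\<bar> \<le> (k + 1) * F / real d" using d_pos by (simp add: field_simps)
  then show "\<bar>R2 - 1\<bar> \<le> C * ((k + 1) * F / real d)" unfolding R' by (intro C u p)
qed

lemma r_square_le:
  assumes "0 \<le> R2" "R2 \<le> 2 * qhi / qmed"
  shows "r\<^sup>2 \<le> 2 * qhi / qmed"
proof -
  have "M_hat d sig2 Y / \<sigma>\<^sup>2 / qhi \<le> 1"
    using M_hat_le[OF Fhat_large[OF order_refl]] sigma quantiles by (simp add: field_simps)
  also have "1 \<le> 2 * qhi / qmed" using quantiles by (simp add: field_simps)
  finally show ?thesis using assms r_square[OF assms(1)] by simp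
qed

text \<open>The ratio of quantiles in \<open>tau\<close> cancels the worst case
  \<open>qlo / qhi\<close> of the median-based variance estimate relative to
  \<open>\<sigma>^2\<close>.\<close>

lemma r_tau_ge:
  assumes "0 \<le> R2"
  shows "3 * sqrt L \<le> r * tau \<eta> s F"
proof -
  have "qlo / qhi \<le> M_hat d sig2 Y / \<sigma>\<^sup>2 / qhi" using M_hat_ge sigma quantiles by (simp add: field_simps)
  then have "qlo / qhi \<le> r\<^sup>2" using r_square[OF assms] by simp
  then have "qlo / qhi * (9 * (qhi / qlo) * L) \<le> r\<^sup>2 * (9 * (qhi / qlo) * L)"
    using L_ge quantiles by (intro mult_right_mono) auto
  also have "qlo / qhi * (9 * (qhi / qlo) * L) = 9 * L" using quantiles by simp
  finally have "(3 * sqrt L)\<^sup>2 \<le> (r * tau \<eta> s F)\<^sup>2"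
    using L_ge by (simp add: power_mult_distrib tau_square)
  then show ?thesis using r_nonneg[OF assms] tau_nonneg by (auto intro: power2_le_imp_le)
qed

lemma weights: "(\<Sum>i<d. sig2 i) \<le> real d" "0 \<le> (\<Sum>i\<in>{..<d} - S. sig2 i)"
   "(\<Sum>i\<in>{..<d} - S. sig2 i) \<le> (\<Sum>i<d. sig2 i)" "(\<Sum>i<d. sig2 i) - (\<Sum>i\<in>{..<d} - S. sig2 i) \<le> real s"
proof -
  show "(\<Sum>i<d. sig2 i) \<le> real d" using sum_mono[of "{..<d}" sig2 "\<lambda>_. 1"] sig2_le by simp
  show "0 \<le> (\<Sum>i\<in>{..<d} - S. sig2 i)" by (intro sum_nonneg) (auto intro: less_imp_le[OF sig2_pos])
  have eq: "(\<Sum>i<d. sig2 i) - (\<Sum>i\<in>{..<d} - S. sig2 i) = (\<Sum>i\<in>S. sig2 i)"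
    using S_subset by (simp add: sum.subset_diff)
  have "(\<Sum>i\<in>S. sig2 i) \<ge> 0" using S_subset by (intro sum_nonneg) (auto intro!: less_imp_le[OF sig2_pos])
  then show "(\<Sum>i\<in>{..<d} - S. sig2 i) \<le> (\<Sum>i<d. sig2 i)" using eq by linarith
  have "(\<Sum>i\<in>S. sig2 i) \<le> (\<Sum>i\<in>S. 1)" using S_subset by (intro sum_mono) (auto intro!: sig2_le)
  then show "(\<Sum>i<d. sig2 i) - (\<Sum>i\<in>{..<d} - S. sig2 i) \<le> real s" using eq card_S by simp
qed

text \<open>The scale error \<open>e\<close> costs order \<open>d * e * (s / F) = C * s\<close>,
  both in the mean of the thresholded noise and in the factor \<open>R2\<close> of the correction.
  The coefficient 64 is 48 for shifting the threshold plus 16 for replacing \<open>R2\<close> by 1;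
  the final 16 pays for adding the variances on the support.\<close>

lemma noise_small_error:
  assumes R2: "0 \<le> R2" "\<bar>R2 - 1\<bar> \<le> e" and e: "e \<le> 1/4" "e \<le> 1 - chi1_quantile (3/4) / qhi" "real d * e = C * F"
    and cnt: "\<bar>count (chi1_quantile (3/4)) - real d * (3/4)\<bar> \<le> k * F" "(k + 1) * F \<le> real d / 4"
    and H: "\<And>q. q = 1 + e \<or> q = 1 - e \<Longrightarrow> \<bar>H (q * tau \<eta> s F) -
        (\<Sum>i\<in>{..<d} - S. sig2 i) * (\<integral>x. tail_square (q * tau \<eta> s F) x \<partial>std_normal_measure)\<bar> \<le> K * real s"
  shows "\<bar>H (r * tau \<eta> s F) - R2 * alpha_se \<eta> s F * (\<Sum>i<d. sig2 i)\<bar> \<le> (K + 64 * C + 16) * real s"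
proof -
  let ?t = "tau \<eta> s F" and ?al = "alpha_se \<eta> s F"
  define W where "W = (\<Sum>i<d. sig2 i)"
  define W' where "W' = (\<Sum>i\<in>{..<d} - S. sig2 i)"
  have e0: "0 \<le> e" using R2 by linarith
  have sF': "0 \<le> real s / F" "real s / F \<le> 1" using s_pos F_pos sF by auto
  \<comment> \<open>The level 3/4 lies strictly between 1/2 and \<open>1 - \<eta>/20\<close>: above
    1/2 it leaves room for the count error and the signal, and below \<open>1 - \<eta>/20\<close> it
    keeps the median-based estimate below \<open>1 - e\<close>, hence below
    \<open>R2\<close>.\<close>
  have "real d * (1/2) \<le> real d * Fhat d sig2 Y (\<sigma>\<^sup>2 * chi1_quantile (3/4))"
    using Fhat_count[of "\<sigma>\<^sup>2 * chi1_quantile (3/4)"] cnt sF sigma by (simp add: algebra_simps)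
  then have "1/2 \<le> Fhat d sig2 Y (\<sigma>\<^sup>2 * chi1_quantile (3/4))"
    using d_pos by (simp only: mult_le_cancel_left_pos)
  then have "M_hat d sig2 Y \<le> \<sigma>\<^sup>2 * chi1_quantile (3/4)" by (rule M_hat_le)
  then have "M_hat d sig2 Y / \<sigma>\<^sup>2 / qhi \<le> chi1_quantile (3/4) / qhi"
    using sigma quantiles by (intro divide_right_mono) (auto simp: field_simps)
  also have "\<dots> \<le> R2" using e R2 by linarith
  finally have rr: "r\<^sup>2 = R2" using r_square[OF R2(1)] by simp
  have "\<bar>r - 1\<bar> * 1 \<le> \<bar>r - 1\<bar> * (r + 1)" using r_nonneg[OF R2(1)] by (intro mult_left_mono) auto
  also have "\<dots> = \<bar>(r - 1) * (r + 1)\<bar>" using r_nonneg[OF R2(1)] by (simp add: abs_mult)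
  also have "(r - 1) * (r + 1) = R2 - 1" unfolding rr[symmetric] by (simp add: algebra_simps power2_eq_square)
  finally have r1: "\<bar>r - 1\<bar> \<le> e" using R2 by simp
  have "exp (- ?t\<^sup>2 / 18) \<le> exp (- L / 2)" using tau_square_ge by simp
  then have ex: "exp (- ?t\<^sup>2 / 18) \<le> real s / F" using exp_neg_half_L by linarith
  have WC: "0 \<le> W'" "W' \<le> W" "W \<le> real d" "W - W' \<le> real s" using weights by (auto simp: W_def W'_def)
  have Cs: "real d * e * (real s / F) = C * real s" unfolding e(3) using F_pos by simp
  have Hq: "\<bar>H (q * ?t) - W' * ?al\<bar> \<le> K * real s + 48 * C * real s" if q: "q = 1 + e \<or> q = 1 - e" for q
  proof -
    have "\<bar>(\<integral>x. tail_square (q * ?t) x \<partial>std_normal_measure) - ?al\<bar> \<le> 48 * e * exp (- ?t\<^sup>2 / 18)"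
      unfolding alpha_se_def using tau_nonneg e0 e q by (intro tail_square_moment_perturbation) auto
    also have "\<dots> \<le> 48 * e * (real s / F)" using ex e0 by (intro mult_left_mono) auto
    finally have "W' * \<bar>(\<integral>x. tail_square (q * ?t) x \<partial>std_normal_measure) - ?al\<bar> \<le> real d * (48 * e * (real s / F))"
      using WC e0 sF' by (intro mult_mono) auto
    also have "\<dots> = 48 * (real d * e * (real s / F))" by (simp only: ac_simps)
    also have "\<dots> = 48 * C * real s" unfolding Cs by simp
    finally have "\<bar>W' * (\<integral>x. tail_square (q * ?t) x \<partial>std_normal_measure) - W' * ?al\<bar> \<le> 48 * C * real s"
      using WC by (simp add: right_diff_distrib[symmetric] abs_mult)
    then show ?thesis using H[OF q] unfolding W'_def[symmetric] by linarith
  qed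
  \<comment> \<open>Here the random threshold is exchanged for the two deterministic ones at which
    \<open>Hq\<close> applies.\<close>
  have "H ((1 + e) * ?t) \<le> H (r * ?t)" "H (r * ?t) \<le> H ((1 - e) * ?t)"
    using r1 tau_nonneg by (auto intro!: H_antimono mult_right_mono)
  then have H1: "\<bar>H (r * ?t) - W' * ?al\<bar> \<le> K * real s + 48 * C * real s"
    using Hq[of "1 + e", OF disjI1[OF refl]] Hq[of "1 - e", OF disjI2[OF refl]] by linarith
  have "\<bar>?al * (W' - W)\<bar> \<le> 16 * real s"
  proof -
    have "?al * (W - W') \<le> 16 * real s" using alpha_bounds sF' WC by (intro mult_mono) auto
    then show ?thesis using alpha_bounds WC by (simp add: abs_mult)
  qed
  moreover have "\<bar>?al * W * (1 - R2)\<bar> \<le> 16 * C * real s"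
  proof -
    have "?al * W * \<bar>1 - R2\<bar> \<le> 16 * (real s / F) * real d * e"
      using alpha_bounds WC R2 F_pos by (intro mult_mono) auto
    also have "\<dots> = 16 * (real d * e * (real s / F))" by (simp only: ac_simps)
    also have "\<dots> = 16 * C * real s" unfolding Cs by simp
    finally show ?thesis using alpha_bounds WC by (simp add: abs_mult)
  qed
  moreover have "H (r * ?t) - R2 * ?al * W = (H (r * ?t) - W' * ?al) + ?al * (W' - W) + ?al * W * (1 - R2)"
    by (simp add: algebra_simps)
  ultimately have "\<bar>H (r * ?t) - R2 * ?al * W\<bar> \<le> (K * real s + 48 * C * real s) + 16 * real s + 16 * C * real s"
    using H1 by linarith
  then show ?thesis unfolding W_def[symmetric] by (simp add: algebra_simps)
qed

text \<open>When \<open>d\<close> is at most of order \<open>F\<close>, the product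
  \<open>d * (s / F)\<close> is of order \<open>s\<close>. The thresholded noise and its correction
  are then small separately, and no cancellation between them is used.\<close>

lemma noise_large_error:
  assumes R2: "0 \<le> R2" "R2 \<le> 2 * qhi / qmed" and d: "real d \<le> C * F"
    and H: "H (3 * sqrt L) \<le> K * real s"
  shows "\<bar>H (r * tau \<eta> s F) - R2 * alpha_se \<eta> s F * (\<Sum>i<d. sig2 i)\<bar> \<le> (K + 2 * qhi / qmed * 16 * C) * real s"
proof -
  let ?al = "alpha_se \<eta> s F"
  have "H (r * tau \<eta> s F) \<le> K * real s"
    using H_antimono[OF r_tau_ge[OF R2(1)]] H by linarith
  moreover have "R2 * ?al * (\<Sum>i<d. sig2 i) \<le> (2 * qhi / qmed) * (16 * (real s / F)) * (C * F)"
    using R2 alpha_bounds weights d d_pos quantiles F_pos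
    by (intro mult_mono) (auto intro!: divide_nonneg_nonneg mult_nonneg_nonneg)
  moreover have "(2 * qhi / qmed) * (16 * (real s / F)) * (C * F) = 2 * qhi / qmed * 16 * C * real s"
    using F_pos by simp
  moreover have "0 \<le> R2 * ?al * (\<Sum>i<d. sig2 i)" using R2 alpha_bounds weights by simp
  ultimately show ?thesis using H_nonneg[of "r * tau \<eta> s F"] by (simp add: distrib_right)
qed

text \<open>In the range \<open>s \<le> F\<close> the rate is \<open>s * L\<close>. The squared
  threshold carries the factor \<open>L\<close> by itself; the errors of order \<open>s\<close> are
  absorbed through \<open>L \<ge> 1/2\<close>.\<close>

lemma N_hat_final_error:
  assumes R2: "0 \<le> R2" "R2 \<le> 2 * qhi / qmed"
    and E: "\<bar>H (r * tau \<eta> s F) - R2 * alpha_se \<eta> s F * (\<Sum>i<d. sig2 i)\<bar> \<le> E * real s"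
    and V: "(\<Sum>i\<in>S. sig2 i * (x i)\<^sup>2) \<le> V * real s" and EV: "0 \<le> E" "0 \<le> V"
  shows "(N_hat \<eta> d s sig2 F Y - sqrt (\<Sum>i<d. (\<theta> i)\<^sup>2))\<^sup>2 \<le>
     (36 * qhi / qmed * (qhi / qlo) + 4 * E + 4 * V) * \<sigma>\<^sup>2 * psi_star s F"
proof -
  have psi: "psi_star s F = real s * L" using sF by (simp add: psi_star_def L_def)
  have sL: "real s \<le> 2 * (real s * L)" using mult_left_mono[OF L_ge, of "real s"] s_pos by simp
  have "r\<^sup>2 * (tau \<eta> s F)\<^sup>2 \<le> (2 * qhi / qmed) * (9 * (qhi / qlo) * L)"
    unfolding tau_square using r_square_le[OF R2] L_ge quantiles by (intro mult_right_mono) auto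
  then have 1: "real s * (r\<^sup>2 * (tau \<eta> s F)\<^sup>2) \<le> real s * ((2 * qhi / qmed) * (9 * (qhi / qlo) * L))"
    by (intro mult_left_mono) auto
  have 2: "E * real s \<le> E * (2 * (real s * L))" "V * real s \<le> V * (2 * (real s * L))"
    using sL EV by (intro mult_left_mono; simp)+
  have "2 * (real s * (r\<^sup>2 * (tau \<eta> s F)\<^sup>2) +
       \<bar>H (r * tau \<eta> s F) - R2 * alpha_se \<eta> s F * (\<Sum>i<d. sig2 i)\<bar>) +
      2 * (\<Sum>i\<in>S. sig2 i * (x i)\<^sup>2) \<le>
     2 * (real s * ((2 * qhi / qmed) * (9 * (qhi / qlo) * L)) + E * (2 * (real s * L))) + 2 * (V * (2 * (real s * L)))"
    using order_trans[OF E 2(1)] order_trans[OF V 2(2)]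
    by (intro add_mono mult_left_mono[of _ _ "2::real"] 1) simp_all
  also have "\<dots> = (36 * qhi / qmed * (qhi / qlo) + 4 * E + 4 * V) * (real s * L)"
    by (simp add: algebra_simps)
  finally have "\<sigma>\<^sup>2 * (2 * (real s * (r\<^sup>2 * (tau \<eta> s F)\<^sup>2) +
       \<bar>H (r * tau \<eta> s F) - R2 * alpha_se \<eta> s F * (\<Sum>i<d. sig2 i)\<bar>) +
      2 * (\<Sum>i\<in>S. sig2 i * (x i)\<^sup>2)) \<le> \<sigma>\<^sup>2 * ((36 * qhi / qmed * (qhi / qlo) + 4 * E + 4 * V) * (real s * L))"
    by (intro mult_left_mono) auto
  then show ?thesis unfolding psi using N_hat_error[OF r_nonneg[OF R2(1)]] by (simp only: ac_simps)
qed

end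

section \<open>Measurability of the estimator\<close>

lemma Fhat_eq: "Fhat d sig2 Y t = (\<Sum>i<d. if (Y i / sqrt (sig2 i))\<^sup>2 \<le> t then 1 else 0) / real d"
  by (simp add: Fhat_def sum.If_cases Int_def)

lemma Fhat_mono: "t \<le> t' \<Longrightarrow> Fhat d sig2 Y t \<le> Fhat d sig2 Y t'"
  unfolding Fhat_eq by (intro divide_right_mono sum_mono) auto

lemma Fhat_neg: "t < 0 \<Longrightarrow> Fhat d sig2 Y t = 0"
proof -
  assume "t < 0"
  then have "\<not> (Y i / sqrt (sig2 i))\<^sup>2 \<le> t" for i using zero_le_power2[of "Y i / sqrt (sig2 i)"] by linarith
  then show ?thesis by (simp add: Fhat_eq)
qed

lemma Fhat_eq_1:
  assumes "1 \<le> d" "(\<Sum>i<d. (Y i / sqrt (sig2 i))\<^sup>2) \<le> t"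
  shows "Fhat d sig2 Y t = 1"
proof -
  have "(Y i / sqrt (sig2 i))\<^sup>2 \<le> t" if "i < d" for i
    using member_le_sum[of i "{..<d}" "\<lambda>i. (Y i / sqrt (sig2 i))\<^sup>2"] that assms(2) by auto
  then show ?thesis using assms(1) by (simp add: Fhat_eq)
qed

text \<open>Writes the event as a countable union over the exponents. The set under the infimum is
  nonempty because the empirical c.d.f. is 1 beyond the sum of the normalized squares.\<close>

lemma t_hat_less_iff:
  assumes "1 \<le> d"
  shows "t_hat d sig2 Y < a \<longleftrightarrow> (\<exists>l::int. 1/2 \<le> Fhat d sig2 Y (2 powr l) \<and> 2 powr l < a)"
proof -
  let ?X = "{2 powr (real_of_int l) | l. Fhat d sig2 Y (2 powr (real_of_int l)) \<ge> 1/2}"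
  obtain n where "(\<Sum>i<d. (Y i / sqrt (sig2 i))\<^sup>2) < 2 ^ n" using real_arch_pow[of 2] by auto
  then have "Fhat d sig2 Y (2 powr (real_of_int (int n))) = 1"
    using assms by (intro Fhat_eq_1) (auto simp: powr_realpow)
  then have "2 powr (real_of_int (int n)) \<in> ?X" by (intro CollectI exI[of _ "int n"]) simp
  then have "?X \<noteq> {}" by blast
  moreover have "bdd_below ?X" by (intro bdd_belowI[of _ 0]) auto
  ultimately have "Inf ?X < a \<longleftrightarrow> (\<exists>x\<in>?X. x < a)" by (rule cInf_less_iff)
  then show ?thesis unfolding t_hat_def by auto
qed

text \<open>Since the empirical c.d.f. is monotone, rational levels suffice, which makes the union
  countable.\<close>

lemma M_hat_less_iff:
  assumes "1 \<le> d"
  shows "M_hat d sig2 Y < a \<longleftrightarrow> (\<exists>q::rat. 1/2 \<le> Fhat d sig2 Y (of_rat q) \<and> of_rat q < a)"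
proof -
  let ?X = "{t. Fhat d sig2 Y t \<ge> 1/2}"
  have "(\<Sum>i<d. (Y i / sqrt (sig2 i))\<^sup>2) \<in> ?X" using Fhat_eq_1[OF assms order_refl, of sig2 Y] by simp
  then have "?X \<noteq> {}" by blast
  moreover have "bdd_below ?X"
  proof (rule bdd_belowI[of _ 0])
    fix t assume "t \<in> ?X"
    then show "0 \<le> t" using Fhat_neg[of t d sig2 Y] by (cases "t < 0") auto
  qed
  ultimately have "Inf ?X < a \<longleftrightarrow> (\<exists>x\<in>?X. x < a)" by (rule cInf_less_iff)
  also have "\<dots> \<longleftrightarrow> (\<exists>q::rat. 1/2 \<le> Fhat d sig2 Y (of_rat q) \<and> of_rat q < a)"
  proof
    assume "\<exists>x\<in>?X. x < a"
    then obtain t where t: "1/2 \<le> Fhat d sig2 Y t" "t < a" by auto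
    obtain q :: rat where q: "t < of_rat q" "of_rat q < a" using of_rat_dense[OF t(2)] by auto
    then show "\<exists>q::rat. 1/2 \<le> Fhat d sig2 Y (of_rat q) \<and> of_rat q < a"
      using t Fhat_mono[of t "of_rat q" d sig2 Y] by (intro exI[of _ q]) auto
  qed auto
  finally show ?thesis unfolding M_hat_def .
qed

text \<open>Isolates a function of the value of the empirical c.d.f. at \<open>t_hat\<close>. The 0
  in the else branch comes from \<open>real_of_ereal\<close> mapping infinity to 0.\<close>

lemma sigmaS2_hat_eq:
  "sigmaS2_hat d sig2 Y = t_hat d sig2 Y *
     (\<lambda>p. if p > 0 then real_of_ereal (inverse (chi1_inv p)) else 0) (Fhat d sig2 Y (t_hat d sig2 Y))"
  by (simp add: sigmaS2_hat_def sigmaS2_fun_def divide_ereal_def)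

text \<open>A non-measurable set would have \<open>measure\<close> 0, so a lower bound on the
  probability of the final event requires this.\<close>

lemma borel_measurable_N_hat:
  fixes Y :: "'a \<Rightarrow> nat \<Rightarrow> real"
  assumes "1 \<le> d" and Y: "\<And>i. i < d \<Longrightarrow> (\<lambda>z. Y z i) \<in> borel_measurable M"
  shows "(\<lambda>z. N_hat \<eta> d s sig2 F (Y z)) \<in> borel_measurable M"
proof -
  have Fh[measurable]: "(\<lambda>z. Fhat d sig2 (Y z) (T z)) \<in> borel_measurable M"
    if T: "T \<in> borel_measurable M" for T
  proof -
    have "(\<lambda>z. if (Y z i / sqrt (sig2 i))\<^sup>2 \<le> T z then 1 else 0 :: real) \<in> borel_measurable M" if "i < d" for i
    proof -
      note [measurable] = T Y[OF that]
      show ?thesis by measurable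
    qed
    then show ?thesis unfolding Fhat_eq by (intro borel_measurable_divide borel_measurable_sum) auto
  qed
  have t[measurable]: "(\<lambda>z. t_hat d sig2 (Y z)) \<in> borel_measurable M"
    unfolding borel_measurable_iff_less t_hat_less_iff[OF assms(1)] by measurable
  have [measurable]: "(\<lambda>z. M_hat d sig2 (Y z)) \<in> borel_measurable M"
    unfolding borel_measurable_iff_less M_hat_less_iff[OF assms(1)] by measurable
  \<comment> \<open>The c.d.f. value at \<open>t_hat\<close> ranges over the multiples of
    \<open>1 / d\<close>, so it is a simple function and composing it with the inverse c.d.f. is
    measurable without any regularity of the latter.\<close>
  have "finite ((\<lambda>z. Fhat d sig2 (Y z) (t_hat d sig2 (Y z))) ` space M)"
  proof (rule finite_subset)
    show "(\<lambda>z. Fhat d sig2 (Y z) (t_hat d sig2 (Y z))) ` space M \<subseteq> (\<lambda>k. real k / real d) ` {..d}"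
    proof (rule image_subsetI)
      fix z
      have "card {i\<in>{..<d}. (Y z i / sqrt (sig2 i))\<^sup>2 \<le> t_hat d sig2 (Y z)} \<le> d"
        using card_mono[of "{..<d}" "{i\<in>{..<d}. (Y z i / sqrt (sig2 i))\<^sup>2 \<le> t_hat d sig2 (Y z)}"] by auto
      then show "Fhat d sig2 (Y z) (t_hat d sig2 (Y z)) \<in> (\<lambda>k. real k / real d) ` {..d}"
        unfolding Fhat_def by blast
    qed
  qed simp
  then have "simple_function M (\<lambda>z. Fhat d sig2 (Y z) (t_hat d sig2 (Y z)))"
    by (intro simple_function_borel_measurable Fh t)
  then have [measurable]: "(\<lambda>z. (\<lambda>p. if p > 0 then real_of_ereal (inverse (chi1_inv p)) else 0)
      (Fhat d sig2 (Y z) (t_hat d sig2 (Y z)))) \<in> borel_measurable M"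
    by (intro borel_measurable_simple_function
      simple_function_compose1[where g = "\<lambda>p. if p > 0 then real_of_ereal (inverse (chi1_inv p)) else 0"])
  have s[measurable]: "(\<lambda>z. sigmaS2_hat d sig2 (Y z)) \<in> borel_measurable M"
    unfolding sigmaS2_hat_eq by measurable
  have e[measurable]: "(\<lambda>z. sigma_eta2_hat \<eta> d sig2 (Y z)) \<in> borel_measurable M"
    unfolding sigma_eta2_hat_def by measurable
  have "(\<lambda>z. (Y z i)\<^sup>2 * (if \<bar>Y z i\<bar> > max (sqrt (sigmaS2_hat d sig2 (Y z))) (sqrt (sigma_eta2_hat \<eta> d sig2 (Y z)))
        * sqrt (sig2 i) * tau \<eta> s F then 1 else 0)) \<in> borel_measurable M" if "i < d" for i
  proof -
    note [measurable] = Y[OF that]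
    show ?thesis by measurable
  qed
  then have [measurable]: "(\<lambda>z. \<Sum>i<d. (Y z i)\<^sup>2 * (if \<bar>Y z i\<bar> > max (sqrt (sigmaS2_hat d sig2 (Y z))) (sqrt (sigma_eta2_hat \<eta> d sig2 (Y z)))
        * sqrt (sig2 i) * tau \<eta> s F then 1 else 0)) \<in> borel_measurable M"
    by (intro borel_measurable_sum) auto
  show ?thesis unfolding N_hat_def Q_hat_def by measurable
qed

section \<open>Probabilities of the exceptional events\<close>

lemma integral_std_normal_square_le:
  "integral\<^sup>L std_normal_measure (\<lambda>x. if x\<^sup>2 \<le> u then 1 else 0) = chi1_cdf u"
  "integral\<^sup>L std_normal_measure (\<lambda>x. if x\<^sup>2 > u then 1 else 0) = 1 - chi1_cdf u"
proof -
  have m: "{x::real. x\<^sup>2 \<le> u} \<in> sets std_normal_measure" by simp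
  have "(\<lambda>x::real. if x\<^sup>2 \<le> u then 1 else 0::real) = indicator {x. x\<^sup>2 \<le> u}" by (auto split: split_indicator)
  then show 1: "integral\<^sup>L std_normal_measure (\<lambda>x. if x\<^sup>2 \<le> u then 1 else 0) = chi1_cdf u"
    using m by (simp add: chi1_cdf_def)
  have "(\<lambda>x::real. if x\<^sup>2 > u then 1 else 0::real) = indicator (space std_normal_measure - {x. x\<^sup>2 \<le> u})"
    by (auto split: split_indicator)
  then show "integral\<^sup>L std_normal_measure (\<lambda>x. if x\<^sup>2 > u then 1 else 0) = 1 - chi1_cdf u"
    using std_normal.prob_compl[OF m] m by (simp add: chi1_cdf_def)
qed

text \<open>Admissible exponents are integers between \<open>log 2 a\<close> and
  \<open>log 2 b\<close>. The bound depends on \<open>b / a\<close> only, so a union over dyadic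
  points costs a constant independent of \<sigma>.\<close>

lemma card_dyadic_le:
  fixes a b :: real
  assumes "0 < a" "a \<le> b"
  shows "finite {l::int. a \<le> 2 powr l \<and> 2 powr l \<le> b}"
    and "real (card {l::int. a \<le> 2 powr l \<and> 2 powr l \<le> b}) \<le> log 2 (b / a) + 1"
proof -
  have sub: "{l::int. a \<le> 2 powr l \<and> 2 powr l \<le> b} \<subseteq> {\<lceil>log 2 a\<rceil>..\<lfloor>log 2 b\<rfloor>}"
    using assms by (auto simp: ceiling_le_iff le_floor_iff log_le_iff le_log_iff)
  then show "finite {l::int. a \<le> 2 powr l \<and> 2 powr l \<le> b}" by (rule finite_subset) simp
  have "log 2 a \<le> log 2 b" using assms by simp
  have "card {l::int. a \<le> 2 powr l \<and> 2 powr l \<le> b} \<le> card {\<lceil>log 2 a\<rceil>..\<lfloor>log 2 b\<rfloor>}"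
    using sub by (intro card_mono) auto
  also have "real (card {\<lceil>log 2 a\<rceil>..\<lfloor>log 2 b\<rfloor>}) \<le> log 2 b - log 2 a + 1"
    using \<open>log 2 a \<le> log 2 b\<close> by (simp add: of_nat_nat) linarith
  finally show "real (card {l::int. a \<le> 2 powr l \<and> 2 powr l \<le> b}) \<le> log 2 (b / a) + 1"
    using assms by (simp add: log_divide)
qed

section \<open>The Gaussian model and the probabilities of its exceptional events\<close>

locale gaussian_model =
  fixes cstar \<eta> \<sigma> :: real and d s :: nat and A :: "nat \<Rightarrow> nat \<Rightarrow> real" and \<theta> :: "nat \<Rightarrow> real"
  assumes cstar: "0 < cstar" and eta: "0 < \<eta>" "\<eta> < 1" and sigma: "0 < \<sigma>" and s1: "1 \<le> s"
    and var_le: "\<And>i. i < d \<Longrightarrow> cov d A i i \<le> 1" and var_ge: "\<And>i. i < d \<Longrightarrow> cstar \<le> cov d A i i"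
    and sd: "4 * real s \<le> real d" and sF: "real s \<le> frob d (cov d A)"
    and sparse: "card {i\<in>{..<d}. \<theta> i \<noteq> 0} \<le> s"
begin

definition F :: real where "F = frob d (cov d A)"
definition sig2 :: "nat \<Rightarrow> real" where "sig2 i = cov d A i i"
definition B :: "nat \<Rightarrow> nat \<Rightarrow> real" where "B i k = A i k / sqrt (sig2 i)"
abbreviation "supp \<equiv> thresholding.S d \<theta>"

lemma sig2_pos: "i < d \<Longrightarrow> 0 < sig2 i"
  using var_ge[of i] cstar by (simp add: sig2_def)

lemma cov_B: "cov d B i j = cov d A i j / (sqrt (sig2 i) * sqrt (sig2 j))"
  by (simp add: cov_def B_def sum_divide_distrib)

sublocale gaussian_rows d B
proof
  fix i assume "i < d"
  then show "cov d B i i = 1" unfolding cov_B using sig2_pos[of i] by (simp add: sig2_def[symmetric])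
qed

lemma thresholding: "thresholding \<eta> d s \<sigma> F sig2 \<theta>"
  using eta sigma s1 sd sF sig2_pos var_le sparse by unfold_locales (auto simp: F_def sig2_def)

text \<open>A zero variance, possible for indices outside the range of the assumptions, forces the
  row of \<open>A\<close> to vanish. Covering it makes the identification of the observations an
  equality of functions on all indices.\<close>

lemma noise_eq: "sqrt (sig2 i) * X i z = (\<Sum>k<d. A i k * z k)"
proof (cases "sig2 i = 0")
  case True
  then have "A i k = 0" if "k < d" for k
    using that by (simp add: sig2_def cov_def sum_nonneg_eq_0_iff)
  then show ?thesis using True by simp
next
  case False
  then show ?thesis by (simp add: X_def B_def sum_distrib_left)
qed

lemma model_eqs:
  "(\<lambda>i. cov d A i i) = sig2" "frob d (cov d A) = F"
  "(\<lambda>i. \<theta> i + \<sigma> * (\<Sum>k<d. A i k * z k)) = thresholding.Y \<sigma> sig2 \<theta> (\<lambda>i. X i z)"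
  by (simp add: fun_eq_iff sig2_def, simp add: F_def,
      simp add: fun_eq_iff thresholding.Y_def[OF thresholding] noise_eq)

lemma F_square: "F\<^sup>2 = (\<Sum>i<d. \<Sum>j<d. (cov d A i j)\<^sup>2)"
  by (simp add: F_def frob_def sum_nonneg)

lemma F_pos: "0 < F" and d_pos: "0 < real d"
  using s1 sF sd by (auto simp: F_def)

text \<open>The weights undo the standardization: a squared correlation times both variances is a
  squared covariance.\<close>

lemma weighted_correlations_le:
  assumes I: "I \<subseteq> {..<d}"
  shows "(\<Sum>i\<in>I. \<Sum>j\<in>I. sig2 i * sig2 j * (cov d B i j)\<^sup>2) \<le> F\<^sup>2"
proof -
  have "sig2 i * sig2 j * (cov d B i j)\<^sup>2 = (cov d A i j)\<^sup>2" if "i \<in> I" "j \<in> I" for i j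
  proof -
    have "0 < sig2 i" "0 < sig2 j" using that I sig2_pos by auto
    then show ?thesis by (simp add: cov_B power_divide power_mult_distrib)
  qed
  then have "(\<Sum>i\<in>I. \<Sum>j\<in>I. sig2 i * sig2 j * (cov d B i j)\<^sup>2) = (\<Sum>i\<in>I. \<Sum>j\<in>I. (cov d A i j)\<^sup>2)" by simp
  also have "\<dots> \<le> (\<Sum>i\<in>I. \<Sum>j<d. (cov d A i j)\<^sup>2)" using I by (intro sum_mono sum_mono2) auto
  also have "\<dots> \<le> (\<Sum>i<d. \<Sum>j<d. (cov d A i j)\<^sup>2)" using I by (intro sum_mono2) (auto intro!: sum_nonneg)
  finally show ?thesis by (simp add: F_square)
qed

text \<open>Counts carry weight 1 instead of the variances; the lower bound \<open>cstar\<close> on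
  the variances pays for the missing weights.\<close>

lemma correlations_le: "(\<Sum>i<d. \<Sum>j<d. (cov d B i j)\<^sup>2) \<le> F\<^sup>2 / cstar\<^sup>2"
proof -
  have "cstar\<^sup>2 * (\<Sum>i<d. \<Sum>j<d. (cov d B i j)\<^sup>2) = (\<Sum>i<d. \<Sum>j<d. cstar * cstar * (cov d B i j)\<^sup>2)"
    by (simp add: sum_distrib_left power2_eq_square)
  also have "\<dots> \<le> (\<Sum>i<d. \<Sum>j<d. sig2 i * sig2 j * (cov d B i j)\<^sup>2)"
    using var_ge cstar less_imp_le[OF sig2_pos]
    by (intro sum_mono mult_right_mono mult_mono) (auto simp: sig2_def)
  also have "\<dots> \<le> F\<^sup>2" by (rule weighted_correlations_le) simp
  finally show ?thesis using cstar by (simp add: field_simps)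
qed

lemma prob_many:
  assumes [measurable]: "Measurable.pred borel P"
    and q: "integral\<^sup>L std_normal_measure (\<lambda>x. if P x then 1 else 0) = q"
  shows "prob {z \<in> space (std_gauss_vec d). real d \<le> 4 * (\<Sum>i<d. if P (X i z) then 1 else 0)} \<le> 4 * q"
proof -
  have "integrable std_normal_measure (\<lambda>x. if P x then 1 else 0 :: real)"
    by (intro std_normal.integrable_const_bound[where B = 1]) auto
  then have "prob {z \<in> space (std_gauss_vec d). real d / 4 \<le> (\<Sum>i<d. 1 * (if P (X i z) then 1 else 0))}
    \<le> (\<Sum>i<d. 1) * q / (real d / 4)"
    unfolding q[symmetric] using d_pos by (intro prob_weighted_sum_ge_le) auto
  then show ?thesis using d_pos by (simp add: field_simps)
qed

text \<open>The indicator is an even function whose weighted second moment is at most 2; with the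
  factor 600 this gives 1200.\<close>

lemma prob_count_deviation:
  assumes "0 < k"
  shows "prob {z \<in> space (std_gauss_vec d). k * F \<le> \<bar>(\<Sum>i<d. if (X i z)\<^sup>2 \<le> u then 1 else 0) - real d * chi1_cdf u\<bar>}
     \<le> 1200 / (cstar\<^sup>2 * k\<^sup>2)"
proof -
  let ?g = "\<lambda>x::real. if x\<^sup>2 \<le> u then 1 else 0 :: real"
  have le: "(?g x)\<^sup>2 * exp (x\<^sup>2 / 8) \<le> 1 * exp (1/8 * x\<^sup>2)" for x by simp
  note D = integrable_std_normal_leI[OF _ _ le]
  have "(1/2)\<^sup>2 \<le> (3::real)/4" by (simp add: power2_eq_square)
  then have "1/2 \<le> sqrt (3/4)" by (rule real_le_rsqrt)
  then have "1 / sqrt (3/4) \<le> 1 / (1/2)" by (intro divide_left_mono) auto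
  then have D2: "integral\<^sup>L std_normal_measure (\<lambda>x. (?g x)\<^sup>2 * exp (x\<^sup>2 / 8)) \<le> 2"
    using D(2) by simp
  have kF: "0 < k * F" using assms F_pos by simp
  have "prob {z \<in> space (std_gauss_vec d). k * F \<le> \<bar>(\<Sum>i<d. 1 * ?g (X i z)) - (\<Sum>i<d. 1) * integral\<^sup>L std_normal_measure ?g\<bar>}
     \<le> 600 * integral\<^sup>L std_normal_measure (\<lambda>x. (?g x)\<^sup>2 * exp (x\<^sup>2 / 8)) *
       (\<Sum>i<d. \<Sum>j<d. 1 * 1 * (cov d B i j)\<^sup>2) / (k * F)\<^sup>2"
    using D(1) kF by (intro prob_weighted_sum_deviation_le) auto
  also have "\<dots> \<le> 600 * 2 * (F\<^sup>2 / cstar\<^sup>2) / (k * F)\<^sup>2"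
    using D2 correlations_le by (intro divide_right_mono mult_mono) (auto intro!: sum_nonneg)
  also have "\<dots> = 1200 / (cstar\<^sup>2 * k\<^sup>2)" using F_pos by (simp add: power_mult_distrib)
  finally show ?thesis unfolding integral_std_normal_square_le by simp
qed

lemma prob_dyadic_deviation:
  assumes "0 < k" "0 < a" "a \<le> b"
  shows "prob (\<Union>l\<in>{l::int. a \<le> 2 powr l \<and> 2 powr l \<le> b}. {z \<in> space (std_gauss_vec d).
     k * F \<le> \<bar>(\<Sum>i<d. if (X i z)\<^sup>2 \<le> 2 powr l / \<sigma>\<^sup>2 then 1 else 0) - real d * chi1_cdf (2 powr l / \<sigma>\<^sup>2)\<bar>})
     \<le> (log 2 (b / a) + 1) * (1200 / (cstar\<^sup>2 * k\<^sup>2))" (is "prob (\<Union>l\<in>?\<Lambda>. ?E l) \<le> _")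
proof -
  have "prob (\<Union>l\<in>?\<Lambda>. ?E l) \<le> (\<Sum>l\<in>?\<Lambda>. prob (?E l))"
    using card_dyadic_le(1)[OF assms(2,3)] by (intro finite_measure_subadditive_finite) auto
  also have "\<dots> \<le> (\<Sum>l\<in>?\<Lambda>. 1200 / (cstar\<^sup>2 * k\<^sup>2))"
    using prob_count_deviation[OF assms(1)] by (intro sum_mono)
  also have "\<dots> = real (card ?\<Lambda>) * (1200 / (cstar\<^sup>2 * k\<^sup>2))" by simp
  also have "\<dots> \<le> (log 2 (b / a) + 1) * (1200 / (cstar\<^sup>2 * k\<^sup>2))"
    using card_dyadic_le(2)[OF assms(2,3)] by (intro mult_right_mono) auto
  finally show ?thesis .
qed

text \<open>The mean is at most \<open>16 * s\<close>, so Markov's inequality at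
  \<open>10 / \<eta>\<close> times this value explains 160.\<close>

lemma prob_signal_noise:
  "prob {z \<in> space (std_gauss_vec d). 160 / \<eta> * real s \<le> (\<Sum>i\<in>supp. sig2 i * (X i z)\<^sup>2)} \<le> \<eta> / 10"
proof -
  interpret thresholding \<eta> d s \<sigma> F sig2 \<theta> "\<lambda>i. 0" by (rule thresholding)
  have i: "integrable std_normal_measure (\<lambda>x::real. x\<^sup>2)" "integral\<^sup>L std_normal_measure (\<lambda>x. x\<^sup>2) \<le> 16"
    using closed_tail_square_moment[of 0] by auto
  have k: "0 < 160 / \<eta> * real s" using eta s_pos by simp
  have "(\<Sum>i\<in>supp. sig2 i) \<le> (\<Sum>i\<in>supp. 1)" using S_subset by (intro sum_mono) (auto intro!: sig2_le)
  then have "(\<Sum>i\<in>supp. sig2 i) \<le> real s" using card_S by simp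
  have "prob {z \<in> space (std_gauss_vec d). 160 / \<eta> * real s \<le> (\<Sum>i\<in>supp. sig2 i * (X i z)\<^sup>2)} \<le>
     (\<Sum>i\<in>supp. sig2 i) * integral\<^sup>L std_normal_measure (\<lambda>x. x\<^sup>2) / (160 / \<eta> * real s)"
    using i k S_subset by (intro prob_weighted_sum_ge_le[where g = "\<lambda>x. x\<^sup>2"]) (auto intro!: less_imp_le[OF sig2_pos])
  also have "\<dots> \<le> real s * 16 / (160 / \<eta> * real s)"
    using i k \<open>(\<Sum>i\<in>supp. sig2 i) \<le> real s\<close> by (intro divide_right_mono mult_mono) auto
  also have "\<dots> = \<eta> / 10" using eta s_pos by simp
  finally show ?thesis .
qed

text \<open>From \<open>q \<ge> 3/4\<close> and the factor 3 in \<open>tau\<close>, the squared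
  threshold is at least \<open>81/16 * L\<close>, hence above \<open>4 * L\<close>. The truncated
  second moment is then of order \<open>(s / F)^2\<close>, and the factor \<open>F^2\<close> from
  the correlations brings the variance down to order \<open>s^2\<close>.\<close>

lemma prob_noise_deviation:
  assumes "3/4 \<le> q" "0 < K"
  shows "prob {z \<in> space (std_gauss_vec d). K * real s \<le>
      \<bar>(\<Sum>i\<in>{..<d} - supp. sig2 i * tail_square (q * tau \<eta> s F) (X i z)) -
        (\<Sum>i\<in>{..<d} - supp. sig2 i) * (\<integral>x. tail_square (q * tau \<eta> s F) x \<partial>std_normal_measure)\<bar>} \<le> 921600 / K\<^sup>2"
proof -
  interpret thresholding \<eta> d s \<sigma> F sig2 \<theta> "\<lambda>i. 0" by (rule thresholding)
  let ?t = "q * tau \<eta> s F"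
  have t0: "0 \<le> ?t" using assms tau_nonneg by simp
  note D = tail_square_weighted_moment[OF t0]
  have "9/16 \<le> q\<^sup>2" using power_mono[OF assms(1), of 2] by (simp add: power_divide)
  then have "9/16 * (tau \<eta> s F)\<^sup>2 \<le> ?t\<^sup>2" unfolding power_mult_distrib by (intro mult_right_mono) auto
  then have "L \<le> ?t\<^sup>2 / 4" using tau_square_ge L_ge by linarith
  then have "exp (- ?t\<^sup>2 / 4) \<le> exp (- L)" by simp
  then have D2: "(\<integral>x. (tail_square ?t x)\<^sup>2 * exp (x\<^sup>2 / 8) \<partial>std_normal_measure) \<le> 1536 * (real s / F)\<^sup>2"
    using D(2) exp_neg_L by linarith
  have k: "0 < K * real s" using assms s_pos by simp
  have "prob {z \<in> space (std_gauss_vec d). K * real s \<le>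
      \<bar>(\<Sum>i\<in>{..<d} - supp. sig2 i * tail_square ?t (X i z)) -
        (\<Sum>i\<in>{..<d} - supp. sig2 i) * (\<integral>x. tail_square ?t x \<partial>std_normal_measure)\<bar>}
     \<le> 600 * (\<integral>x. (tail_square ?t x)\<^sup>2 * exp (x\<^sup>2 / 8) \<partial>std_normal_measure) *
       (\<Sum>i\<in>{..<d} - supp. \<Sum>j\<in>{..<d} - supp. sig2 i * sig2 j * (cov d B i j)\<^sup>2) / (K * real s)\<^sup>2"
    using D(1) k tail_square_nonneg tail_square_even
    by (intro prob_weighted_sum_deviation_le) (auto intro!: less_imp_le[OF sig2_pos])
  also have "\<dots> \<le> 600 * (1536 * (real s / F)\<^sup>2) * F\<^sup>2 / (K * real s)\<^sup>2"
    using D2 weighted_correlations_le[of "{..<d} - supp"]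
    by (intro divide_right_mono mult_mono) (auto intro!: sum_nonneg mult_nonneg_nonneg less_imp_le[OF sig2_pos])
  also have "\<dots> = 921600 / K\<^sup>2" using s_pos F_pos by (simp add: power_mult_distrib power_divide)
  finally show ?thesis .
qed

lemma prob_noise_large:
  assumes "real d \<le> C * F" "0 < K"
  shows "prob {z \<in> space (std_gauss_vec d). K * real s \<le>
      (\<Sum>i\<in>{..<d} - supp. sig2 i * tail_square (3 * sqrt (thresholding.L s F)) (X i z))} \<le> 16 * C / K"
proof -
  interpret thresholding \<eta> d s \<sigma> F sig2 \<theta> "\<lambda>i. 0" by (rule thresholding)
  let ?t = "3 * sqrt L"
  have t0: "0 \<le> ?t" using L_ge by simp
  have "exp (- ?t\<^sup>2 / 4) \<le> exp (- L / 2)" using L_ge by (simp add: power_mult_distrib)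
  then have m: "(\<integral>x. tail_square ?t x \<partial>std_normal_measure) \<le> 16 * (real s / F)"
    using tail_square_moment(2)[OF t0] exp_neg_half_L by linarith
  have m0: "0 \<le> (\<integral>x. tail_square ?t x \<partial>std_normal_measure)" by (simp add: integral_nonneg_AE tail_square_nonneg)
  have "(\<Sum>i\<in>{..<d} - supp. sig2 i) \<le> (\<Sum>i<d. sig2 i)" by (intro sum_mono2) (auto intro!: less_imp_le[OF sig2_pos])
  also have "\<dots> \<le> (\<Sum>i<d. 1)" by (intro sum_mono sig2_le) auto
  finally have W: "(\<Sum>i\<in>{..<d} - supp. sig2 i) \<le> C * F" using assms(1) by simp
  have k: "0 < K * real s" using assms s_pos by simp
  have "prob {z \<in> space (std_gauss_vec d). K * real s \<le> (\<Sum>i\<in>{..<d} - supp. sig2 i * tail_square ?t (X i z))}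
    \<le> (\<Sum>i\<in>{..<d} - supp. sig2 i) * (\<integral>x. tail_square ?t x \<partial>std_normal_measure) / (K * real s)"
    using k tail_square_moment(1)[OF t0] tail_square_nonneg
    by (intro prob_weighted_sum_ge_le) (auto intro!: less_imp_le[OF sig2_pos])
  also have "\<dots> \<le> C * F * (16 * (real s / F)) / (K * real s)"
    using W m m0 k order_trans[OF _ assms(1), of 0] by (intro divide_right_mono mult_mono) auto
  also have "\<dots> = 16 * C / K" using s_pos F_pos by simp
  finally show ?thesis .
qed

end

section \<open>The confidence bound\<close>

text \<open>All constants are fixed from \<open>cstar\<close> and \<open>\<eta>\<close> before the
  dimension, the covariance and the signal are introduced.\<close>

lemma exists_confidence_constant:
  fixes cstar \<eta> :: real
  assumes cstar: "0 < cstar" and eta: "0 < \<eta>" "\<eta> < 1"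
  shows "\<exists>c>0. \<forall>d s \<sigma> A \<theta>. gaussian_model cstar \<eta> \<sigma> d s A \<theta> \<longrightarrow>
     1 - \<eta> \<le> measure (std_gauss_vec d)
           {z \<in> space (std_gauss_vec d).
              (N_hat \<eta> d s (\<lambda>i. cov d A i i) (frob d (cov d A))
                   (\<lambda>i. \<theta> i + \<sigma> * (\<Sum>k<d. A i k * z k))
                 - sqrt (\<Sum>i<d. (\<theta> i)^2))^2
              \<le> c * \<sigma>^2 * psi_star s (frob d (cov d A))}"
proof -
  define qlo where "qlo = chi1_quantile (\<eta>/20)"
  define qhi where "qhi = chi1_quantile (1 - \<eta>/20)"
  define qmed where "qmed = chi1_quantile (1/2)"
  define u0 where "u0 = chi1_quantile (3/4)"
  have q: "0 < qlo" "0 < qhi" "0 < qmed" "0 < u0" "chi1_cdf qlo = \<eta>/20" "chi1_cdf qhi = 1 - \<eta>/20"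
    "chi1_cdf u0 = 3/4" "qlo < qmed" "qmed < u0" "u0 < qhi"
    unfolding qlo_def qhi_def qmed_def u0_def using eta
    by (auto intro!: chi1_quantile_props(1) chi1_quantile_strict_mono simp: chi1_quantile_props(2))
  obtain C2 where C2: "0 < C2"
    "\<And>u p x. qlo \<le> u \<Longrightarrow> u \<le> 2 * qhi \<Longrightarrow> 1/2 \<le> p \<Longrightarrow> \<bar>p - chi1_cdf u\<bar> \<le> x \<Longrightarrow>
       \<bar>real_of_ereal (ereal u / chi1_inv p) - 1\<bar> \<le> C2 * x"
    using chi1_inv_ratio_error[of qlo "2 * qhi"] q by auto
  \<comment> \<open>Bounds the number of points at which the count is controlled: at most
    \<open>N - 1\<close> dyadic ones and the quantile \<open>u0\<close>. The choice of
    \<open>k\<close> gives each of them failure probability at most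
    \<open>\<eta> / (20 * N)\<close>.\<close>
  define N where "N = log 2 (2 * qhi / qlo) + 2"
  define k where "k = sqrt (24000 * N / \<eta>) / cstar"
  \<comment> \<open>Dominates both \<open>C2 * (k + 1)\<close>, for the error of \<open>R2\<close>,
    and \<open>k + 1\<close>, so that \<open>e \<le> 1/4\<close> also gives
    \<open>(k + 1) * F \<le> d / 4\<close>.\<close>
  define C3 where "C3 = max C2 1 * (k + 1)"
  \<comment> \<open>The border between the two regimes: the first entry keeps \<open>1 - e\<close>
    above 3/4, the second keeps the median-based estimate below \<open>R2\<close>.\<close>
  define \<kappa> where "\<kappa> = min (1/4) (1 - u0 / qhi)"
  \<comment> \<open>Chosen so that each of the two sandwiching thresholds fails with probability at
    most \<open>\<eta>/20\<close>; \<open>K'\<close> is likewise chosen for failure probability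
    \<open>\<eta>/10\<close> in the other regime.\<close>
  define K where "K = sqrt (18432000 / \<eta>)"
  define K' where "K' = 160 * C3 / (\<kappa> * \<eta>)"
  define E where "E = (K + 64 * C3 + 16) + (K' + 2 * qhi / qmed * 16 * (C3 / \<kappa>))"
  define c where "c = 36 * qhi / qmed * (qhi / qlo) + 4 * E + 4 * (160 / \<eta>)"
  have "1 \<le> 2 * qhi / qlo" using q by (simp add: field_simps)
  then have N: "2 \<le> N" by (simp add: N_def)
  have k: "0 < k" using N eta cstar by (simp add: k_def)
  have k_prob: "1200 / (cstar\<^sup>2 * k\<^sup>2) = \<eta> / (20 * N)"
    using N eta cstar by (simp add: k_def power_divide)
  have C3: "0 < C3" "C2 * (k + 1) \<le> C3" "k + 1 \<le> C3"
    using k C2(1) mult_right_mono[of C2 "max C2 1" "k + 1"] mult_right_mono[of 1 "max C2 1" "k + 1"]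
    by (auto simp: C3_def intro!: mult_pos_pos)
  have \<kappa>: "0 < \<kappa>" "\<kappa> \<le> 1/4" "\<kappa> \<le> 1 - u0 / qhi" unfolding \<kappa>_def using q(2,10) by (simp_all only: min_less_iff_conj min.cobounded1 min.cobounded2) simp
  have K: "0 < K" "921600 / K\<^sup>2 = \<eta> / 20" using eta by (auto simp: K_def)
  have K': "0 < K'" "16 * (C3 / \<kappa>) / K' = \<eta> / 10" using eta C3 \<kappa> by (auto simp: K'_def field_simps)
  have E1: "0 \<le> K + 64 * C3 + 16" "0 \<le> K' + 2 * qhi / qmed * 16 * (C3 / \<kappa>)"
    using K K' C3 \<kappa> q by (auto intro!: add_nonneg_nonneg mult_nonneg_nonneg)
  then have E: "0 \<le> E" by (simp add: E_def)
  have "0 < 36 * qhi / qmed * (qhi / qlo)" using q by simp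
  then have c: "0 < c" using E eta by (simp add: c_def add_pos_nonneg)
  have "1 - \<eta> \<le> measure (std_gauss_vec d)
           {z \<in> space (std_gauss_vec d).
              (N_hat \<eta> d s (\<lambda>i. cov d A i i) (frob d (cov d A))
                   (\<lambda>i. \<theta> i + \<sigma> * (\<Sum>k<d. A i k * z k))
                 - sqrt (\<Sum>i<d. (\<theta> i)^2))^2
              \<le> c * \<sigma>^2 * psi_star s (frob d (cov d A))}" (is "_ \<le> measure _ ?T")
    if model: "gaussian_model cstar \<eta> \<sigma> d s A \<theta>" for d s \<sigma> A \<theta>
  proof -
    interpret G: gaussian_model cstar \<eta> \<sigma> d s A \<theta> by (rule model)
    define e where "e = C3 * G.F / real d"
    let ?sp = "space (std_gauss_vec d)"
    let ?h = "\<lambda>t z. \<Sum>i\<in>{..<d} - G.supp. G.sig2 i * tail_square t (G.X i z)"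
    let ?dev = "\<lambda>u z. \<bar>(\<Sum>i<d. if (G.X i z)\<^sup>2 \<le> u then 1 else 0) - real d * chi1_cdf u\<bar>"
    let ?nd = "\<lambda>q. {z \<in> ?sp. K * real s \<le> \<bar>?h (q * tau \<eta> s G.F) z -
        (\<Sum>i\<in>{..<d} - G.supp. G.sig2 i) * (\<integral>x. tail_square (q * tau \<eta> s G.F) x \<partial>std_normal_measure)\<bar>}"
    define B1 where "B1 = {z \<in> ?sp. real d \<le> 4 * (\<Sum>i<d. if (G.X i z)\<^sup>2 \<le> qlo then 1 else 0)}"
    define B2 where "B2 = {z \<in> ?sp. real d \<le> 4 * (\<Sum>i<d. if (G.X i z)\<^sup>2 > qhi then 1 else 0)}"
    define B3 where "B3 = (\<Union>l\<in>{l::int. \<sigma>\<^sup>2 * qlo \<le> 2 powr l \<and> 2 powr l \<le> 2 * \<sigma>\<^sup>2 * qhi}.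
       {z \<in> ?sp. k * G.F \<le> ?dev (2 powr l / \<sigma>\<^sup>2) z})"
    define B4 where "B4 = {z \<in> ?sp. k * G.F \<le> ?dev u0 z}"
    define B5 where "B5 = {z \<in> ?sp. 160 / \<eta> * real s \<le> (\<Sum>i\<in>G.supp. G.sig2 i * (G.X i z)\<^sup>2)}"
    \<comment> \<open>\<open>e\<close> is deterministic, so the regime is known before sampling and
      a single event is charged.\<close>
    define B6 where "B6 = (if e \<le> \<kappa> then ?nd (1 + e) \<union> ?nd (1 - e)
       else {z \<in> ?sp. K' * real s \<le> ?h (3 * sqrt (thresholding.L s G.F)) z})"
    define bad where "bad = B1 \<union> B2 \<union> (B3 \<union> B4) \<union> B5 \<union> B6"
    have e0: "0 \<le> e" using C3 G.F_pos by (simp add: e_def)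
    have sets: "B1 \<in> G.events" "B2 \<in> G.events" "B3 \<in> G.events" "B4 \<in> G.events" "B5 \<in> G.events" "B6 \<in> G.events"
      unfolding B1_def B2_def B3_def B4_def B5_def B6_def by auto
    have ab: "0 < \<sigma>\<^sup>2 * qlo" "\<sigma>\<^sup>2 * qlo \<le> 2 * \<sigma>\<^sup>2 * qhi" using q G.sigma by auto
    have p1: "G.prob B1 \<le> \<eta> / 5" unfolding B1_def
      using G.prob_many[of "\<lambda>x. x\<^sup>2 \<le> qlo" "\<eta>/20"] q by (simp add: integral_std_normal_square_le)
    have p2: "G.prob B2 \<le> \<eta> / 5" unfolding B2_def
      using G.prob_many[of "\<lambda>x. x\<^sup>2 > qhi" "\<eta>/20"] q by (simp add: integral_std_normal_square_le)
    have p34: "G.prob (B3 \<union> B4) \<le> \<eta> / 20"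
    proof -
      have "G.prob B3 \<le> (N - 1) * (\<eta> / (20 * N))"
      proof -
        have "log 2 (2 * \<sigma>\<^sup>2 * qhi / (\<sigma>\<^sup>2 * qlo)) + 1 = N - 1" using G.sigma by (simp add: N_def)
        then show ?thesis unfolding B3_def using G.prob_dyadic_deviation[OF k ab] unfolding k_prob by (simp only:)
      qed
      moreover have "G.prob B4 \<le> \<eta> / (20 * N)"
        unfolding B4_def using G.prob_count_deviation[OF k, of u0] unfolding k_prob .
      moreover have "G.prob (B3 \<union> B4) \<le> G.prob B3 + G.prob B4" using sets by (intro measure_Un_le)
      moreover have "(N - 1) * (\<eta> / (20 * N)) + \<eta> / (20 * N) = \<eta> / 20" using N by (simp add: field_simps)
      ultimately show ?thesis by linarith
    qed
    have p5: "G.prob B5 \<le> \<eta> / 10" unfolding B5_def by (rule G.prob_signal_noise)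
    have p6: "G.prob B6 \<le> \<eta> / 10"
    proof (cases "e \<le> \<kappa>")
      case True
      have "G.prob (?nd (1 + e)) \<le> \<eta> / 20" "G.prob (?nd (1 - e)) \<le> \<eta> / 20"
        using G.prob_noise_deviation[of "1 + e" K] G.prob_noise_deviation[of "1 - e" K] K e0 True \<kappa> by simp_all
      moreover have "G.prob (?nd (1 + e) \<union> ?nd (1 - e)) \<le> G.prob (?nd (1 + e)) + G.prob (?nd (1 - e))"
        by (intro measure_Un_le) auto
      ultimately show ?thesis using True unfolding B6_def by simp
    next
      case False
      then have "real d \<le> C3 / \<kappa> * G.F" using \<kappa> G.d_pos by (simp add: e_def field_simps)
      from G.prob_noise_large[OF this K'(1)] show ?thesis using False unfolding B6_def K'(2) by simp
    qed
    \<comment> \<open>The budget is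
      \<open>\<eta>/5 + \<eta>/5 + \<eta>/20 + \<eta>/10 + \<eta>/10\<close>, which is
      \<open>13/20 * \<eta>\<close>.\<close>
    have "G.prob bad \<le> \<eta>"
    proof -
      have "G.prob bad \<le> G.prob (B1 \<union> B2 \<union> (B3 \<union> B4) \<union> B5) + G.prob B6"
        unfolding bad_def using sets by (intro measure_Un_le) auto
      moreover have "G.prob (B1 \<union> B2 \<union> (B3 \<union> B4) \<union> B5) \<le> G.prob (B1 \<union> B2 \<union> (B3 \<union> B4)) + G.prob B5"
        using sets by (intro measure_Un_le) auto
      moreover have "G.prob (B1 \<union> B2 \<union> (B3 \<union> B4)) \<le> G.prob (B1 \<union> B2) + G.prob (B3 \<union> B4)"
        using sets by (intro measure_Un_le) auto
      moreover have "G.prob (B1 \<union> B2) \<le> G.prob B1 + G.prob B2" using sets by (intro measure_Un_le) auto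
      ultimately show ?thesis using p1 p2 p34 p5 p6 eta by linarith
    qed
    moreover have "?sp - bad \<subseteq> ?T"
    proof
      fix z assume "z \<in> ?sp - bad"
      then have z: "z \<in> ?sp" and nb: "z \<notin> B1" "z \<notin> B2" "z \<notin> B3" "z \<notin> B4" "z \<notin> B5" "z \<notin> B6"
        by (auto simp: bad_def)
      interpret T: thresholding \<eta> d s \<sigma> G.F G.sig2 \<theta> "\<lambda>i. G.X i z" by (rule G.thresholding)
      interpret T: thresholding_median \<eta> d s \<sigma> G.F G.sig2 \<theta> "\<lambda>i. G.X i z"
      proof
        show "4 * (\<Sum>i<d. if (G.X i z)\<^sup>2 \<le> chi1_quantile (\<eta> / 20) then 1 else 0) < real d"
          using nb(1) z by (simp add: B1_def qlo_def not_le)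
        show "4 * (\<Sum>i<d. if (G.X i z)\<^sup>2 > chi1_quantile (1 - \<eta> / 20) then 1 else 0) < real d"
          using nb(2) z by (simp add: B2_def qhi_def not_le)
      qed
      note qs = qlo_def[symmetric] qhi_def[symmetric] qmed_def[symmetric] u0_def[symmetric]
      have dy: "\<bar>T.count (2 powr l / \<sigma>\<^sup>2) - real d * chi1_cdf (2 powr l / \<sigma>\<^sup>2)\<bar> \<le> k * G.F"
        if "\<sigma>\<^sup>2 * qlo \<le> 2 powr l" "2 powr l \<le> 2 * \<sigma>\<^sup>2 * qhi" for l :: int
        using nb(3) z that unfolding B3_def T.count_def by force
      note R2 = T.R2_bounds[unfolded qs, OF C2 dy]
      have R2e: "\<bar>T.R2 - 1\<bar> \<le> e"
      proof -
        have "C2 * ((k + 1) * G.F / real d) = C2 * (k + 1) * (G.F / real d)" by simp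
        also have "\<dots> \<le> C3 * (G.F / real d)" using C3 G.F_pos by (intro mult_right_mono) auto
        finally show ?thesis using R2(3) by (simp add: e_def)
      qed
      have err: "\<bar>T.H (T.r * tau \<eta> s G.F) - T.R2 * alpha_se \<eta> s G.F * (\<Sum>i<d. G.sig2 i)\<bar> \<le> E * real s"
      proof (cases "e \<le> \<kappa>")
        case True
        have "\<bar>T.H (T.r * tau \<eta> s G.F) - T.R2 * alpha_se \<eta> s G.F * (\<Sum>i<d. G.sig2 i)\<bar>
            \<le> (K + 64 * C3 + 16) * real s"
        proof (rule T.noise_small_error[unfolded qs])
          show "0 \<le> T.R2" by (rule R2(1))
          show "\<bar>T.R2 - 1\<bar> \<le> e" by (rule R2e)
          show "e \<le> 1/4" "e \<le> 1 - u0 / qhi" using True \<kappa> by linarith+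
          show "real d * e = C3 * G.F" using G.d_pos by (simp add: e_def)
          show "\<bar>T.count u0 - real d * (3 / 4)\<bar> \<le> k * G.F"
            using nb(4) z unfolding B4_def T.count_def q(7) by auto
          have "(k + 1) * G.F \<le> C3 * G.F" using C3 G.F_pos by (intro mult_right_mono) auto
          also have "C3 * G.F = e * real d" using G.d_pos by (simp add: e_def)
          also have "\<dots> \<le> 1/4 * real d" using True \<kappa> by (intro mult_right_mono) auto
          finally show "(k + 1) * G.F \<le> real d / 4" by simp
          fix q assume "q = 1 + e \<or> q = 1 - e"
          then have "z \<notin> ?nd q" using nb(6) True unfolding B6_def by auto
          then show "\<bar>T.H (q * tau \<eta> s G.F) - (\<Sum>i\<in>{..<d} - T.S. G.sig2 i) *
              (\<integral>x. tail_square (q * tau \<eta> s G.F) x \<partial>std_normal_measure)\<bar> \<le> K * real s"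
            using z unfolding T.H_def by auto
        qed
        also have "\<dots> \<le> E * real s" using E1 by (intro mult_right_mono) (auto simp: E_def)
        finally show ?thesis .
      next
        case False
        have "\<bar>T.H (T.r * tau \<eta> s G.F) - T.R2 * alpha_se \<eta> s G.F * (\<Sum>i<d. G.sig2 i)\<bar>
            \<le> (K' + 2 * qhi / qmed * 16 * (C3 / \<kappa>)) * real s"
        proof (rule T.noise_large_error[unfolded qs])
          show "0 \<le> T.R2" by (rule R2(1))
          show "T.R2 \<le> 2 * qhi / qmed" by (rule R2(2))
          show "real d \<le> C3 / \<kappa> * G.F" using False \<kappa> G.d_pos by (simp add: e_def field_simps)
          show "T.H (3 * sqrt T.L) \<le> K' * real s" using nb(6) z False unfolding B6_def T.H_def by auto
        qed
        also have "\<dots> \<le> E * real s" using E1 by (intro mult_right_mono) (auto simp: E_def)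
        finally show ?thesis .
      qed
      have V: "(\<Sum>i\<in>T.S. G.sig2 i * (G.X i z)\<^sup>2) \<le> 160 / \<eta> * real s"
        using nb(5) z unfolding B5_def by auto
      have "0 \<le> 160 / \<eta>" using eta by simp
      from T.N_hat_final_error[unfolded qs, OF R2(1,2) err V E this] show "z \<in> ?T"
        using z unfolding G.model_eqs c_def by simp
    qed
    moreover have "?T \<in> G.events"
    proof -
      have "1 \<le> d" using G.d_pos by simp
      have "(\<lambda>z. N_hat \<eta> d s (\<lambda>i. cov d A i i) (frob d (cov d A)) (\<lambda>i. \<theta> i + \<sigma> * (\<Sum>k<d. A i k * z k)))
        \<in> borel_measurable (std_gauss_vec d)"
      proof (rule borel_measurable_N_hat[OF \<open>1 \<le> d\<close>])
        show "(\<lambda>z. \<theta> i + \<sigma> * (\<Sum>k<d. A i k * z k)) \<in> borel_measurable (std_gauss_vec d)" for i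
          unfolding G.noise_eq[symmetric] by measurable
      qed
      then show ?thesis by measurable
    qed
    moreover have "bad \<in> G.events" unfolding bad_def using sets by auto
    ultimately show ?thesis
      using G.finite_measure_mono[of "?sp - bad" ?T] G.prob_compl[of bad] by linarith
  qed
  then show ?thesis using c by blast
qed

theorem theorem8:
  fixes cstar :: real
  assumes "cstar > 0"
  shows "\<exists>\<alpha>::real. 0 < \<alpha> \<and> \<alpha> < 1 \<and>
    (\<exists>c :: real \<Rightarrow> real. (\<forall>\<eta>. 0 < \<eta> \<and> \<eta> < 1 \<longrightarrow> c \<eta> > 0) \<and>
      (\<forall>(\<eta>::real) (d::nat) (s::nat) (\<sigma>::real) (A :: nat \<Rightarrow> nat \<Rightarrow> real) (\<theta> :: nat \<Rightarrow> real).
         0 < \<eta> \<longrightarrow> \<eta> < 1 \<longrightarrow> 1 \<le> d \<longrightarrow> 1 \<le> s \<longrightarrow> 0 < \<sigma> \<longrightarrow>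
         (\<forall>i<d. cov d A i i \<le> 1) \<longrightarrow>
         (\<forall>i<d. cstar \<le> cov d A i i) \<longrightarrow>
         real s \<le> \<alpha> * real d \<longrightarrow> real s \<le> frob d (cov d A) \<longrightarrow>
         card {i\<in>{..<d}. \<theta> i \<noteq> 0} \<le> s \<longrightarrow>
         measure (std_gauss_vec d)
           {z \<in> space (std_gauss_vec d).
              (N_hat \<eta> d s (\<lambda>i. cov d A i i) (frob d (cov d A))
                   (\<lambda>i. \<theta> i + \<sigma> * (\<Sum>k<d. A i k * z k))
                 - sqrt (\<Sum>i<d. (\<theta> i)^2))^2
              \<le> c \<eta> * \<sigma>^2 * psi_star s (frob d (cov d A))}
         \<ge> 1 - \<eta>))"
proof -
  define Q where "Q \<eta> c \<longleftrightarrow> (\<forall>d s \<sigma> A \<theta>. gaussian_model cstar \<eta> \<sigma> d s A \<theta> \<longrightarrow>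
     1 - \<eta> \<le> measure (std_gauss_vec d)
           {z \<in> space (std_gauss_vec d).
              (N_hat \<eta> d s (\<lambda>i. cov d A i i) (frob d (cov d A))
                   (\<lambda>i. \<theta> i + \<sigma> * (\<Sum>k<d. A i k * z k))
                 - sqrt (\<Sum>i<d. (\<theta> i)^2))^2
              \<le> c * \<sigma>^2 * psi_star s (frob d (cov d A))})" for \<eta> c
  \<comment> \<open>Choice turns the existence of a constant for each \<open>\<eta>\<close> into a
    function of \<open>\<eta>\<close>, selected ahead of all other parameters.\<close>
  define c where "c \<eta> = (SOME c. 0 < c \<and> Q \<eta> c)" for \<eta>
  have c: "0 < c \<eta> \<and> Q \<eta> (c \<eta>)" if "0 < \<eta>" "\<eta> < 1" for \<eta>
    unfolding c_def using exists_confidence_constant[OF assms that] unfolding Q_def by (rule someI_ex)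
  show ?thesis
  proof (intro exI[of _ "1/4"] exI[of _ c] conjI allI impI)
    fix \<eta> \<sigma> :: real and d s :: nat and A :: "nat \<Rightarrow> nat \<Rightarrow> real" and \<theta> :: "nat \<Rightarrow> real"
    assume a: "0 < \<eta>" "\<eta> < 1" "1 \<le> d" "1 \<le> s" "0 < \<sigma>" "\<forall>i<d. cov d A i i \<le> 1"
      "\<forall>i<d. cstar \<le> cov d A i i" "real s \<le> 1/4 * real d" "real s \<le> frob d (cov d A)"
      "card {i\<in>{..<d}. \<theta> i \<noteq> 0} \<le> s"
    have "gaussian_model cstar \<eta> \<sigma> d s A \<theta>"
      using a assms by unfold_locales auto
    then show "measure (std_gauss_vec d)
           {z \<in> space (std_gauss_vec d).
              (N_hat \<eta> d s (\<lambda>i. cov d A i i) (frob d (cov d A))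
                   (\<lambda>i. \<theta> i + \<sigma> * (\<Sum>k<d. A i k * z k))
                 - sqrt (\<Sum>i<d. (\<theta> i)^2))^2
              \<le> c \<eta> * \<sigma>^2 * psi_star s (frob d (cov d A))} \<ge> 1 - \<eta>"
      using c[OF a(1,2)] unfolding Q_def by (elim conjE allE impE)
  qed (use c in auto)
qed

end
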